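(* Let $G=(V(G),E(G))$ be a finite simplicial graph of connectivity $\kappa$ whose non-triangular faces are bordered by cycles of length $\gamma_1,\dots,\gamma_\kappa$. Then (i) $$\dim_{3,2}(G)=\gamma_1+\dots+\gamma_\kappa-3\kappa.$$ (ii) For $|V(G)|\ge6$ and $1<q<\infty$, $q\ne2$, $$\dim_{3,q}(G)=\dim_{3,2}(G)+3.$$
   Context: A finite simple graph is simplicial with (topological) connectivity $\kappa$ if it has at least three edges and has a planar embedding in which exactly $\kappa$ faces (the unbounded face included) are not triangular, and these non-triangular faces have no edges in common. $\|\cdot\|_q$ is the $\ell^q$ norm on $\mathbb R^d$ (here $d=3$). A bar-joint framework $(G,p)$ in a normed space $X$ consists of a simple graph $G$ and a map (placement) $p:V(G)\to X$ with $p_v\neq p_w$ whenever $vw\in E(G)$; $P(G)$ is the set of placements in $X$. A subframework is $(H,p)$ with $H$ a subgraph and $p$ restricted to $V(H)$. An infinitesimal flex is a map $u:V(G)\to X$ with $\|(p_v+tu_v)-(p_w+tu_w)\|-\|p_v-p_w\|=o(t)$ as $t\to 0$ for each edge $vw$. A continuous rigid motion is a map $\Gamma:X\times[-1,1]\to X$, isometric in $x$, continuous in $t$, with $\Gamma(x,0)=x$; an infinitesimal rigid motion is a map $\gamma(x)=\frac{d}{dt}\Gamma(x,t)|_{t=0}$ derived from such $\Gamma$. An infinitesimal flex $u$ is trivial if $u_v=\gamma(p_v)$ for all $v$, for some infinitesimal rigid motion $\gamma$. For $X=(\mathbb R^d,\|\cdot\|_q)$ write $\mathcal F_q(G,p)$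 and $\mathcal T_q(G,p)$ for the vector spaces of infinitesimal flexes and of trivial infinitesimal flexes. For finite $G$ and $p:V(G)\to\mathbb R^d$ the rigidity matrix $R_q(G,p)$ is the $|E(G)|\times d|V(G)|$ matrix whose row for the edge $vw$ has $(p_v-p_w)^{(q-1)}$ in the $d$ columns of $v$, $-(p_v-p_w)^{(q-1)}$ in the $d$ columns of $w$ and zeros elsewhere, where $x^{(s)}=(\mathrm{sgn}(x_1)|x_1|^s,\dots,\mathrm{sgn}(x_d)|x_d|^s)$. A finite $(G,p)$ is regular if $x\mapsto \operatorname{rank}R_q(G,x)$, $x\in P(G)$, attains its maximum at $p$; it is generic if $p$ is a placement of the complete graph $K_{V(G)}$ on $V(G)$ and every subframework of $(K_{V(G)},p)$ is regular. The infinitesimal flexibility dimension of a finite simple graph $G$ in $(\mathbb R^d,\|\cdot\|_q)$ is $\dim_{d,q}(G)=\dim\mathcal F_q(G,p)/\mathcal T_q(G,p)$ for any generic placement $p$ of $G$ (independent of the choice). *)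

theory Defs
  imports "HOL-Analysis.Analysis" "HOL-Library.Landau_Symbols"
begin

section \<open>Finite simple graphs\<close>

text \<open>A graph is a pair of a vertex set \<open>V\<close> in a finite type and a set \<open>E\<close> of two-element
  subsets of \<open>V\<close>.\<close>

definition simple_graph :: "'v set \<Rightarrow> 'v set set \<Rightarrow> bool" where
  "simple_graph V E \<longleftrightarrow> finite V \<and> (\<forall>e\<in>E. e \<subseteq> V \<and> card e = 2)"

definition complete_edges :: "'v set \<Rightarrow> 'v set set" where
  "complete_edges V = {e. e \<subseteq> V \<and> card e = 2}"

definition cycle_edges :: "'v list \<Rightarrow> 'v set set" where
  "cycle_edges c = {{c ! i, c ! (Suc i mod length c)} | i. i < length c}"

definition is_cycle :: "'v set set \<Rightarrow> 'v list \<Rightarrow> bool" where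
  "is_cycle E c \<longleftrightarrow> 3 \<le> length c \<and> distinct c \<and> cycle_edges c \<subseteq> E"

section \<open>Planar embeddings, faces and simplicial graphs\<close>

text \<open>Vertices are drawn as distinct points \<open>z v\<close> of the plane and an edge \<open>e\<close> as an arc \<open>g e\<close>
  joining its end points; arcs meet the vertices, and each other, only in common end points.\<close>

definition planar_embedding ::
  "'v set \<Rightarrow> 'v set set \<Rightarrow> ('v \<Rightarrow> complex) \<Rightarrow> ('v set \<Rightarrow> real \<Rightarrow> complex) \<Rightarrow> bool" where
  "planar_embedding V E z g \<longleftrightarrow>
     inj_on z V \<and>
     (\<forall>e\<in>E. arc (g e) \<and> {pathstart (g e), pathfinish (g e)} = z ` e \<and>
             path_image (g e) \<inter> z ` V = z ` e) \<and>
     (\<forall>e\<in>E. \<forall>e'\<in>E. e \<noteq> e' \<longrightarrow> path_image (g e) \<inter> path_image (g e') = z ` (e \<inter> e'))"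

definition faces ::
  "'v set \<Rightarrow> 'v set set \<Rightarrow> ('v \<Rightarrow> complex) \<Rightarrow> ('v set \<Rightarrow> real \<Rightarrow> complex) \<Rightarrow> complex set set" where
  "faces V E z g = components (- (z ` V \<union> (\<Union>e\<in>E. path_image (g e))))"

definition bordered_by ::
  "'v set set \<Rightarrow> ('v set \<Rightarrow> real \<Rightarrow> complex) \<Rightarrow> complex set \<Rightarrow> 'v list \<Rightarrow> bool" where
  "bordered_by E g F c \<longleftrightarrow> is_cycle E c \<and> frontier F = (\<Union>e\<in>cycle_edges c. path_image (g e))"

definition triangular ::
  "'v set set \<Rightarrow> ('v set \<Rightarrow> real \<Rightarrow> complex) \<Rightarrow> complex set \<Rightarrow> bool" where
  "triangular E g F \<longleftrightarrow> (\<exists>c. bordered_by E g F c \<and> length c = 3)"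

definition nontriangular_faces ::
  "'v set \<Rightarrow> 'v set set \<Rightarrow> ('v \<Rightarrow> complex) \<Rightarrow> ('v set \<Rightarrow> real \<Rightarrow> complex) \<Rightarrow> complex set set" where
  "nontriangular_faces V E z g = {F \<in> faces V E z g. \<not> triangular E g F}"

text \<open>The graph \<open>(V, E)\<close> is simplicial with connectivity \<open>\<kappa>\<close>, as witnessed by the planar
  embedding \<open>(z, g)\<close>.\<close>

definition simplicial_via ::
  "'v set \<Rightarrow> 'v set set \<Rightarrow> ('v \<Rightarrow> complex) \<Rightarrow> ('v set \<Rightarrow> real \<Rightarrow> complex) \<Rightarrow> nat \<Rightarrow> bool" where
  "simplicial_via V E z g \<kappa> \<longleftrightarrow>
     simple_graph V E \<and> 3 \<le> card E \<and> planar_embedding V E z g \<and>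
     finite (nontriangular_faces V E z g) \<and> card (nontriangular_faces V E z g) = \<kappa> \<and>
     (\<forall>F\<in>nontriangular_faces V E z g. \<forall>F'\<in>nontriangular_faces V E z g. F \<noteq> F' \<longrightarrow>
        \<not> (\<exists>e\<in>E. path_image (g e) \<subseteq> frontier F \<and> path_image (g e) \<subseteq> frontier F'))"

section \<open>Frameworks in \<open>\<ell>\<close>-q spaces\<close>

definition lq_norm :: "real \<Rightarrow> real ^ 'd \<Rightarrow> real" where
  "lq_norm q x = (\<Sum>i\<in>UNIV. \<bar>x $ i\<bar> powr q) powr (1 / q)"

text \<open>For a graph on \<open>V\<close>, only the components of \<open>p\<close> in \<open>V\<close> are relevant.\<close>

definition placement :: "'v::finite set set \<Rightarrow> real ^ 'd ^ 'v \<Rightarrow> bool" where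
  "placement E p \<longleftrightarrow> (\<forall>v w. {v, w} \<in> E \<longrightarrow> p $ v \<noteq> p $ w)"

text \<open>Vector fields on \<open>V\<close> are represented by their extension by \<open>0\<close>, so that the following are
  subsets of a Euclidean space of vector fields.\<close>

definition flexes :: "real \<Rightarrow> 'v::finite set \<Rightarrow> 'v set set \<Rightarrow> real ^ 'd ^ 'v \<Rightarrow> (real ^ 'd ^ 'v) set" where
  "flexes q V E p = {u. (\<forall>v. v \<notin> V \<longrightarrow> u $ v = 0) \<and>
     (\<forall>v w. {v, w} \<in> E \<longrightarrow>
        (\<lambda>t. lq_norm q ((p $ v + t *\<^sub>R u $ v) - (p $ w + t *\<^sub>R u $ w)) - lq_norm q (p $ v - p $ w))
          \<in> o[at 0](\<lambda>t. t))}"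

definition rigid_motion :: "real \<Rightarrow> (real ^ 'd \<Rightarrow> real \<Rightarrow> real ^ 'd) \<Rightarrow> bool" where
  "rigid_motion q \<Gamma> \<longleftrightarrow>
     (\<forall>t\<in>{-1..1}. \<forall>x y. lq_norm q (\<Gamma> x t - \<Gamma> y t) = lq_norm q (x - y)) \<and>
     (\<forall>x. continuous_on {-1..1} (\<Gamma> x)) \<and> (\<forall>x. \<Gamma> x 0 = x)"

definition inf_rigid_motion :: "real \<Rightarrow> (real ^ 'd \<Rightarrow> real ^ 'd) \<Rightarrow> bool" where
  "inf_rigid_motion q \<gamma> \<longleftrightarrow>
     (\<exists>\<Gamma>. rigid_motion q \<Gamma> \<and> (\<forall>x. (\<Gamma> x has_vector_derivative \<gamma> x) (at 0)))"

definition trivial_flexes ::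
  "real \<Rightarrow> 'v::finite set \<Rightarrow> 'v set set \<Rightarrow> real ^ 'd ^ 'v \<Rightarrow> (real ^ 'd ^ 'v) set" where
  "trivial_flexes q V E p =
     {u \<in> flexes q V E p. \<exists>\<gamma>. inf_rigid_motion q \<gamma> \<and> (\<forall>v\<in>V. u $ v = \<gamma> (p $ v))}"

text \<open>The dimension of the quotient of the two spaces. For a generic placement \<open>p\<close> this is the
  infinitesimal flexibility dimension of the graph. As \<open>trivial_flexes q V E p\<close> is contained in
  \<open>flexes q V E p\<close>, the subtraction does not truncate.\<close>

definition flex_dim :: "real \<Rightarrow> 'v::finite set \<Rightarrow> 'v set set \<Rightarrow> real ^ 'd ^ 'v \<Rightarrow> nat" where
  "flex_dim q V E p = dim (flexes q V E p) - dim (trivial_flexes q V E p)"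

section \<open>Rigidity matrix, regular and generic placements\<close>

definition signed_powr :: "real ^ 'd \<Rightarrow> real \<Rightarrow> real ^ 'd" where
  "signed_powr x s = (\<chi> i. sgn (x $ i) * \<bar>x $ i\<bar> powr s)"

text \<open>The row of the rigidity matrix for the edge \<open>{v, w}\<close>, with the columns grouped by vertex;
  it is symmetric in \<open>v\<close> and \<open>w\<close>.\<close>

definition rigidity_row :: "real \<Rightarrow> real ^ 'd ^ 'v::finite \<Rightarrow> 'v \<Rightarrow> 'v \<Rightarrow> real ^ 'd ^ 'v" where
  "rigidity_row q p v w =
     (\<chi> z. if z = v then signed_powr (p $ v - p $ w) (q - 1)
           else if z = w then - signed_powr (p $ v - p $ w) (q - 1)
           else 0)"

text \<open>The rank of the rigidity matrix, as the dimension of its row space. The zero columns of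
  vertices that lie on no edge in \<open>E\<close> do not affect it.\<close>

definition rigidity_rank :: "real \<Rightarrow> 'v::finite set set \<Rightarrow> real ^ 'd ^ 'v \<Rightarrow> nat" where
  "rigidity_rank q E p = dim {rigidity_row q p v w | v w. {v, w} \<in> E}"

definition regular :: "real \<Rightarrow> 'v::finite set set \<Rightarrow> real ^ 'd ^ 'v \<Rightarrow> bool" where
  "regular q E (p :: real ^ 'd ^ 'v) \<longleftrightarrow>
     placement E p \<and> (\<forall>x :: real ^ 'd ^ 'v. placement E x \<longrightarrow> rigidity_rank q E x \<le> rigidity_rank q E p)"

definition generic :: "real \<Rightarrow> 'v::finite set \<Rightarrow> real ^ 'd ^ 'v \<Rightarrow> bool" where
  "generic q V p \<longleftrightarrow>
     placement (complete_edges V) p \<and>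
     (\<forall>W D. W \<subseteq> V \<and> D \<subseteq> complete_edges W \<longrightarrow> regular q D p)"

end

theory Submission
  imports Defs "HOL-Complex_Analysis.Riemann_Mapping"
begin

text \<open>Since every face is bordered by a cycle, Euler's formula and double counting give
  \<open>|E| = 3 |V| - 6 - \<Sum> (\<gamma>\<^sub>i - 3)\<close>. So it suffices that the rows of the rigidity matrix are linearly
  independent at some placement, for every \<open>q > 1\<close>, and that the trivial flexes have dimension 6 for
  \<open>q = 2\<close> and 3 otherwise.

  Independence holds for all simple planar graphs and is proved by vertex splitting: a planar graph with
  an edge has an edge whose ends have at most two common neighbours; contract it, place the contracted
  graph by induction, and pull the two ends apart a little. Planarity enters only through an abstract
  dual, that is, maps \<open>l\<close>, \<open>r\<close> from edges to faces such that the circulations are exactly the functions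
  \<open>e \<mapsto> \<phi> (l e) - \<phi> (r e)\<close>. Contracting an edge of the graph deletes it in the dual and conversely, so
  that no drawing of the contracted graph is needed.

  For the given drawing, the potential \<open>\<phi>\<close> of a circulation is its winding number as a function of the
  face. The winding number is locally constant off the drawing and jumps by the value of the circulation
  across an edge, and by the Jordan curve theorem a face is one side of its bordering cycle. This also
  yields Euler's formula.\<close>

text \<open>Why two common neighbours: when the ends of the edge coincide, equilibrium at the moved
  end involves only the vectors to the common neighbours and the direction of the new edge, and
  three-space has room for three independent vectors. The new direction can be chosen, the other
  vectors cannot; hence the induction also carries that no three points are collinear. The exponent
  enters only through \<open>signed_powr\<close>, which is odd, homogeneous, continuous and
  bijective, so one argument serves all \<open>q > 1\<close>.

  The topological obstacle: an arc is merely continuous, so neither its two sides nor the jump of a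
  winding number across it can be read off locally. But each edge lies on a cycle, and the known
  jump across that Jordan curve calibrates the arc for every circulation.

  The numbers: for every \<open>q\<close> the flexes have dimension \<open>3 |V| - |E|\<close>,
  which is 6 plus the sum of all \<open>\<gamma> i - 3\<close>. The extra 3 for
  \<open>q \<noteq> 2\<close> are the missing rotations.\<close>

lemma dim_image_eq_card_iff:
  fixes b :: "'i \<Rightarrow> 'a::euclidean_space"
  assumes "finite I"
  shows "dim (b ` I) = card I \<longleftrightarrow>
    (\<forall>a. (\<Sum>i\<in>I. a i *\<^sub>R b i) = 0 \<longrightarrow> (\<forall>i\<in>I. a i = 0))"
proof
  assume d: "dim (b ` I) = card I"
  have "dim (b ` I) \<le> card (b ` I)" by (simp add: assms dim_le_card')
  then have ce: "card (b ` I) = card I" using card_image_le[OF assms, of b] d by simp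
  then have inj: "inj_on b I" by (simp add: assms eq_card_imp_inj_on)
  have ind: "independent (b ` I)"
    by (rule card_le_dim_spanning[of _ "b ` I"]) (auto simp: assms span_superset ce d)
  show "\<forall>a. (\<Sum>i\<in>I. a i *\<^sub>R b i) = 0 \<longrightarrow> (\<forall>i\<in>I. a i = 0)"
  proof (intro allI impI)
    fix a assume s: "(\<Sum>i\<in>I. a i *\<^sub>R b i) = 0"
    have "(\<Sum>v\<in>b ` I. a (inv_into I b v) *\<^sub>R v) = 0"
      using s by (simp add: sum.reindex[OF inj] inj)
    then have "\<forall>v\<in>b ` I. a (inv_into I b v) = 0"
      using ind unfolding dependent_finite[OF finite_imageI[OF assms]]
      by (auto dest: spec[of _ "\<lambda>v. a (inv_into I b v)"])
    then show "\<forall>i\<in>I. a i = 0" by (auto simp: inj)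
  qed
next
  assume *: "\<forall>a. (\<Sum>i\<in>I. a i *\<^sub>R b i) = 0 \<longrightarrow> (\<forall>i\<in>I. a i = 0)"
  have inj: "inj_on b I"
  proof (rule inj_onI, rule ccontr)
    fix i j assume ij: "i \<in> I" "j \<in> I" "b i = b j" "i \<noteq> j"
    have "(\<Sum>k\<in>I. (of_bool (k = i) - of_bool (k = j)) *\<^sub>R b k)
        = (\<Sum>k\<in>I. (if k = i then b k else 0)) - (\<Sum>k\<in>I. (if k = j then b k else 0))"
      by (subst sum_subtractf[symmetric]) (rule sum.cong, auto)
    also have "\<dots> = 0" using ij assms by (simp add: sum.delta)
    finally have "(\<Sum>k\<in>I. (of_bool (k = i) - of_bool (k = j)) *\<^sub>R b k) = 0" .
    from *[rule_format, OF this ij(1)] ij(4) show False by simp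
  qed
  have "independent (b ` I)"
    unfolding dependent_finite[OF finite_imageI[OF assms]]
  proof clarsimp
    fix u i assume i: "i \<in> I" "u (b i) \<noteq> 0" and "(\<Sum>v\<in>b ` I. u v *\<^sub>R v) = 0"
    then have "(\<Sum>i\<in>I. u (b i) *\<^sub>R b i) = 0" by (simp add: sum.reindex[OF inj])
    from *[rule_format, OF this i(1)] i(2) show False by simp
  qed
  then show "dim (b ` I) = card I"
    by (simp add: card_image dim_eq_card_independent inj)
qed

section \<open>Circulations and abstract duals of multigraphs\<close>

text \<open>For a loop the two terms cancel, so loops impose no condition on a circulation.\<close>

definition incid :: "('e \<Rightarrow> 'v) \<Rightarrow> ('e \<Rightarrow> 'v) \<Rightarrow> 'e \<Rightarrow> 'v \<Rightarrow> real" where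
  "incid t h e x = of_bool (t e = x) - of_bool (h e = x)"

definition circulation :: "'e set \<Rightarrow> ('e \<Rightarrow> 'v) \<Rightarrow> ('e \<Rightarrow> 'v) \<Rightarrow> ('e \<Rightarrow> real) \<Rightarrow> bool" where
  "circulation E t h \<zeta> \<longleftrightarrow> (\<forall>x. (\<Sum>e\<in>E. \<zeta> e * incid t h e x) = 0)"

text \<open>The cycle space of the graph is the cut space of a second graph on the same edges, with
  ends \<open>l\<close> and \<open>r\<close>: an algebraic form of Whitney's abstract dual. No set
  of faces is recorded, only the ends of the dual edges.\<close>

definition dual_pair ::
  "'e set \<Rightarrow> ('e \<Rightarrow> 'v) \<Rightarrow> ('e \<Rightarrow> 'v) \<Rightarrow> ('e \<Rightarrow> 'f) \<Rightarrow> ('e \<Rightarrow> 'f) \<Rightarrow> bool" where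
  "dual_pair E t h l r \<longleftrightarrow>
     (\<forall>\<zeta>. circulation E t h \<zeta> \<longleftrightarrow> (\<exists>\<phi>. \<forall>e\<in>E. \<zeta> e = \<phi> (l e) - \<phi> (r e)))"

lemma circulation_cong:
  assumes "\<And>e. e \<in> E \<Longrightarrow> \<zeta> e = \<zeta>' e"
  shows "circulation E t h \<zeta> \<longleftrightarrow> circulation E t h \<zeta>'"
  unfolding circulation_def using assms by (metis (mono_tags, lifting) sum.cong)

text \<open>Circulations of the smaller graph are those of the larger one that vanish on
  \<open>e0\<close>. For the potential this means equal values at the two ends of the dual edge,
  that is, a potential on the dual with these ends identified.\<close>

lemma dual_pair_delete:
  assumes d: "dual_pair E t h l r" and "finite E" "e0 \<in> E"
  defines "m \<equiv> (\<lambda>x. if x = l e0 then r e0 else x)"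
  shows "dual_pair (E - {e0}) t h (m \<circ> l) (m \<circ> r)"
  unfolding dual_pair_def
proof
  fix \<zeta> :: "'a \<Rightarrow> real"
  let ?z = "\<zeta>(e0 := 0)"
  have "(\<Sum>e\<in>E. ?z e * incid t h e x) = (\<Sum>e\<in>E - {e0}. \<zeta> e * incid t h e x)" for x
    using assms(2,3) by (subst sum.remove[of _ e0]) (auto intro!: sum.cong)
  then have "circulation (E - {e0}) t h \<zeta> \<longleftrightarrow> circulation E t h ?z"
    by (simp add: circulation_def)
  also have "\<dots> \<longleftrightarrow> (\<exists>\<phi>. \<forall>e\<in>E. ?z e = \<phi> (l e) - \<phi> (r e))" using d by (simp add: dual_pair_def)
  also have "\<dots> \<longleftrightarrow> (\<exists>\<phi>. \<forall>e\<in>E - {e0}. \<zeta> e = \<phi> ((m \<circ> l) e) - \<phi> ((m \<circ> r) e))" (is "?A \<longleftrightarrow> ?B")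
  proof
    assume ?A
    then obtain \<phi> where p: "\<forall>e\<in>E. ?z e = \<phi> (l e) - \<phi> (r e)" by blast
    then have "\<phi> (m x) = \<phi> x" for x using assms(3) by (force simp: m_def)
    with p show ?B by (intro exI[of _ \<phi>]) (auto split: if_splits)
  next
    assume ?B
    then obtain \<phi> where "\<forall>e\<in>E - {e0}. \<zeta> e = \<phi> ((m \<circ> l) e) - \<phi> ((m \<circ> r) e)" by blast
    then show ?A by (intro exI[of _ "\<phi> \<circ> m"]) (auto simp: m_def)
  qed
  finally show "circulation (E - {e0}) t h \<zeta> \<longleftrightarrow>
    (\<exists>\<phi>. \<forall>e\<in>E - {e0}. \<zeta> e = \<phi> ((m \<circ> l) e) - \<phi> ((m \<circ> r) e))" .
qed

text \<open>The balance at the merged vertex is the sum of the balances at the two ends, so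
  restriction to the other edges maps circulations onto circulations. In the dual this only drops
  the condition at \<open>e0\<close>.\<close>

lemma dual_pair_contract:
  assumes d: "dual_pair E t h l r" and "finite E" "e0 \<in> E" and ne: "t e0 \<noteq> h e0"
  defines "m \<equiv> (\<lambda>x. if x = t e0 then h e0 else x)"
  shows "dual_pair (E - {e0}) (m \<circ> t) (m \<circ> h) l r"
  unfolding dual_pair_def
proof
  fix \<zeta> :: "'a \<Rightarrow> real"
  let ?I = "incid t h" and ?I' = "incid (m \<circ> t) (m \<circ> h)"
  have I': "?I' e x = (if x = t e0 then 0 else if x = h e0 then ?I e (t e0) + ?I e (h e0) else ?I e x)"
    for e x using ne by (auto simp: incid_def m_def)
  have split: "(\<Sum>e\<in>E. z e * ?I e x) = z e0 * ?I e0 x + (\<Sum>e\<in>E - {e0}. z e * ?I e x)" for z x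
    using assms(2,3) by (simp add: sum.remove)
  have I0: "?I e0 (t e0) = 1" "?I e0 (h e0) = -1" "x \<noteq> t e0 \<Longrightarrow> x \<noteq> h e0 \<Longrightarrow> ?I e0 x = 0" for x
    using ne by (auto simp: incid_def)
  have 1: "circulation (E - {e0}) (m \<circ> t) (m \<circ> h) z" if c: "circulation E t h z" for z
    unfolding circulation_def
  proof
    fix x
    from c have c': "z e0 * ?I e0 x + (\<Sum>e\<in>E - {e0}. z e * ?I e x) = 0" for x
      by (simp add: circulation_def flip: split)
    consider "x = t e0" | "x = h e0" "x \<noteq> t e0" | "x \<noteq> h e0" "x \<noteq> t e0" by blast
    then show "(\<Sum>e\<in>E - {e0}. z e * ?I' e x) = 0"
    proof cases
      case 2
      then show ?thesis using c'[of "t e0"] c'[of "h e0"]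
        by (simp add: I' I0 distrib_left sum.distrib)
    qed (use c'[of x] in \<open>simp_all add: I' I0\<close>)
  qed
  \<comment> \<open>The value on \<open>e0\<close> is the one that balances \<open>t e0\<close>;
    balance at \<open>h e0\<close> then follows from that at the merged vertex.\<close>
  have 2: "circulation E t h (z(e0 := - (\<Sum>e\<in>E - {e0}. z e * ?I e (t e0))))"
    if c: "circulation (E - {e0}) (m \<circ> t) (m \<circ> h) z" for z
    unfolding circulation_def
  proof
    fix x
    have s: "(\<Sum>e\<in>E - {e0}. (z(e0 := w)) e * ?I e x) = (\<Sum>e\<in>E - {e0}. z e * ?I e x)" for w x
      by (rule sum.cong) auto
    from c have c': "(\<Sum>e\<in>E - {e0}. z e * ?I' e x) = 0" for x by (simp add: circulation_def)
    from c'[of "h e0"] ne have "(\<Sum>e\<in>E - {e0}. z e * ?I e (t e0)) + (\<Sum>e\<in>E - {e0}. z e * ?I e (h e0)) = 0"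
      by (simp add: I' sum.distrib distrib_left)
    moreover from c'[of x] have "x \<noteq> t e0 \<Longrightarrow> x \<noteq> h e0 \<Longrightarrow> (\<Sum>e\<in>E - {e0}. z e * ?I e x) = 0"
      by (simp add: I')
    ultimately show "(\<Sum>e\<in>E. (z(e0 := - (\<Sum>e\<in>E - {e0}. z e * ?I e (t e0)))) e * ?I e x) = 0"
      unfolding split s using I0 by (cases "x = t e0"; cases "x = h e0") auto
  qed
  show "circulation (E - {e0}) (m \<circ> t) (m \<circ> h) \<zeta> \<longleftrightarrow> (\<exists>\<phi>. \<forall>e\<in>E - {e0}. \<zeta> e = \<phi> (l e) - \<phi> (r e))"
  proof
    assume "circulation (E - {e0}) (m \<circ> t) (m \<circ> h) \<zeta>"
    from 2[OF this] d obtain \<phi> where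
      "\<forall>e\<in>E. (\<zeta>(e0 := - (\<Sum>e\<in>E - {e0}. \<zeta> e * ?I e (t e0)))) e = \<phi> (l e) - \<phi> (r e)"
      unfolding dual_pair_def by blast
    then show "\<exists>\<phi>. \<forall>e\<in>E - {e0}. \<zeta> e = \<phi> (l e) - \<phi> (r e)" by (intro exI[of _ \<phi>]) (auto split: if_splits)
  next
    assume "\<exists>\<phi>. \<forall>e\<in>E - {e0}. \<zeta> e = \<phi> (l e) - \<phi> (r e)"
    then obtain \<phi> where p: "\<forall>e\<in>E - {e0}. \<zeta> e = \<phi> (l e) - \<phi> (r e)" by blast
    have "circulation E t h (\<lambda>e. \<phi> (l e) - \<phi> (r e))" using d unfolding dual_pair_def by blast
    from 1[OF this] show "circulation (E - {e0}) (m \<circ> t) (m \<circ> h) \<zeta>"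
      by (rule circulation_cong[THEN iffD1, rotated]) (use p in auto)
  qed
qed

text \<open>Needed for closed neighbourhoods, and to discard parallel edges after a contraction. The
  dual ends change with each deletion, hence the existential form.\<close>

lemma dual_pair_subset:
  fixes l r :: "'e \<Rightarrow> 'f"
  assumes "dual_pair E t h l r" "finite E" "D \<subseteq> E"
  shows "\<exists>l' r'. dual_pair D t h (l' :: 'e \<Rightarrow> 'f) r'"
proof -
  have "\<exists>l' r' :: 'e \<Rightarrow> 'f. dual_pair (E - X) t h l' r'" if "finite X" "X \<subseteq> E" for X
    using that
  proof (induction X)
    case empty
    then show ?case using assms(1) by auto
  next
    case (insert x X)
    then obtain l' r' :: "'e \<Rightarrow> 'f" where "dual_pair (E - X) t h l' r'" by auto
    from dual_pair_delete[OF this, of x] insert assms(2)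
    show ?case by (metis DiffI Diff_insert finite_Diff insert_subset)
  qed
  from this[of "E - D"] assms show ?thesis
    by (metis Diff_subset double_diff finite_Diff order_refl)
qed

section \<open>Dimensions of cut spaces\<close>

text \<open>The coboundary of a potential, padded by zero so that it lives in a Euclidean space. It
  is used both with the ends in the graph and with the ends in the dual.\<close>

definition cut_vec :: "'e::finite set \<Rightarrow> ('e \<Rightarrow> 'x) \<Rightarrow> ('e \<Rightarrow> 'x) \<Rightarrow> ('x \<Rightarrow> real) \<Rightarrow> real ^ 'e" where
  "cut_vec E a b \<phi> = (\<chi> e. if e \<in> E then \<phi> (a e) - \<phi> (b e) else 0)"

lemma subspace_cut_space: "subspace (range (cut_vec E a b))"
  unfolding subspace_def
proof (intro conjI allI ballI)
  show "0 \<in> range (cut_vec E a b)"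
    by (rule range_eqI[of _ _ "\<lambda>_. 0"]) (simp add: cut_vec_def vec_eq_iff)
next
  fix x y assume "x \<in> range (cut_vec E a b)" "y \<in> range (cut_vec E a b)"
  then obtain \<phi> \<psi> where "x = cut_vec E a b \<phi>" "y = cut_vec E a b \<psi>" by blast
  then have "x + y = cut_vec E a b (\<lambda>i. \<phi> i + \<psi> i)" by (simp add: cut_vec_def vec_eq_iff)
  then show "x + y \<in> range (cut_vec E a b)" by blast
next
  fix c :: real and x assume "x \<in> range (cut_vec E a b)"
  then obtain \<phi> where "x = cut_vec E a b \<phi>" by blast
  then have "c *\<^sub>R x = cut_vec E a b (\<lambda>i. c * \<phi> i)" by (simp add: cut_vec_def vec_eq_iff algebra_simps)
  then show "c *\<^sub>R x \<in> range (cut_vec E a b)" by blast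
qed

text \<open>Constants have zero coboundary, so the potential may be normalised to vanish at
  \<open>x0\<close>. Ends of loops may lie outside \<open>X\<close>, since loops contribute
  nothing.\<close>

lemma cut_vec_eq_sum:
  assumes X: "finite X" and "x0 \<in> X"
    and ab: "\<And>e. e \<in> E \<Longrightarrow> a e \<noteq> b e \<Longrightarrow> a e \<in> X \<and> b e \<in> X"
  shows "cut_vec E a b \<phi> = (\<Sum>x\<in>X - {x0}. (\<phi> x - \<phi> x0) *\<^sub>R cut_vec E a b (\<lambda>y. of_bool (y = x)))"
proof -
  have "(\<Sum>x\<in>X - {x0}. (\<phi> x - \<phi> x0) * (of_bool (a e = x) - of_bool (b e = x))) = \<phi> (a e) - \<phi> (b e)"
    if e: "e \<in> E" for e
  proof (cases "a e = b e")
    case False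
    have *: "(\<Sum>x\<in>X - {x0}. (\<phi> x - \<phi> x0) * of_bool (y = x)) = \<phi> y - \<phi> x0" if "y \<in> X" for y
    proof -
      have "(\<Sum>x\<in>X - {x0}. (\<phi> x - \<phi> x0) * of_bool (y = x)) = (\<Sum>x\<in>X - {x0}. if x = y then \<phi> x - \<phi> x0 else 0)"
        by (rule sum.cong) auto
      then show ?thesis using X that by (simp add: sum.delta)
    qed
    show ?thesis using *[of "a e"] *[of "b e"] ab[OF e False] by (simp add: right_diff_distrib sum_subtractf)
  qed simp
  then show ?thesis by (simp add: cut_vec_def vec_eq_iff)
qed

lemma cut_space_eq_span:
  assumes X: "finite X" and "x0 \<in> X"
    and ab: "\<And>e. e \<in> E \<Longrightarrow> a e \<noteq> b e \<Longrightarrow> a e \<in> X \<and> b e \<in> X"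
  shows "range (cut_vec E a b) = span ((\<lambda>x. cut_vec E a b (\<lambda>y. of_bool (y = x))) ` (X - {x0}))"
proof
  show "range (cut_vec E a b) \<subseteq> span ((\<lambda>x. cut_vec E a b (\<lambda>y. of_bool (y = x))) ` (X - {x0}))"
  proof (rule image_subsetI)
    fix \<phi>
    show "cut_vec E a b \<phi> \<in> span ((\<lambda>x. cut_vec E a b (\<lambda>y. of_bool (y = x))) ` (X - {x0}))"
      by (subst cut_vec_eq_sum[OF assms(1,2) ab]) (auto intro!: span_sum span_scale intro: span_base)
  qed
  show "span ((\<lambda>x. cut_vec E a b (\<lambda>y. of_bool (y = x))) ` (X - {x0})) \<subseteq> range (cut_vec E a b)"
    by (rule span_minimal[OF _ subspace_cut_space]) auto
qed

lemma dim_cut_space_le: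
  assumes X: "finite X" and "x0 \<in> X"
    and ab: "\<And>e. e \<in> E \<Longrightarrow> a e \<noteq> b e \<Longrightarrow> a e \<in> X \<and> b e \<in> X"
  shows "dim (range (cut_vec E a b)) + 1 \<le> card X"
proof -
  have "range (cut_vec E a b) = span ((\<lambda>x. cut_vec E a b (\<lambda>y. of_bool (y = x))) ` (X - {x0}))"
    by (rule cut_space_eq_span) (use assms in auto)
  then have "dim (range (cut_vec E a b)) \<le> card (X - {x0})"
    by (simp only: dim_span)
      (meson X card_image_le dim_le_card' finite_Diff finite_imageI le_trans)
  then show ?thesis using assms(1,2) by (metis add.commute add_le_mono1 card.remove plus_1_eq_Suc)
qed

text \<open>The hypothesis \<open>conn\<close> expresses connectedness: only constants have zero
  coboundary.\<close>

lemma dim_cut_space_eq: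
  assumes X: "finite X" and x0: "x0 \<in> X"
    and ab: "\<And>e. e \<in> E \<Longrightarrow> a e \<in> X \<and> b e \<in> X"
    and conn: "\<And>\<phi>. \<forall>e\<in>E. \<phi> (a e) = \<phi> (b e) \<Longrightarrow> \<forall>x\<in>X. \<phi> x = (\<phi> x0 :: real)"
  shows "dim (range (cut_vec E a b)) + 1 = card X"
proof -
  let ?b = "\<lambda>x. cut_vec E a b (\<lambda>y. of_bool (y = x))"
  have "dim (?b ` (X - {x0})) = card (X - {x0})"
  proof (subst dim_image_eq_card_iff, use X in simp, intro allI impI)
    fix c assume s: "(\<Sum>i\<in>X - {x0}. c i *\<^sub>R ?b i) = 0"
    \<comment> \<open>This potential vanishes at \<open>x0\<close>, so if it is constant then all
      coefficients vanish.\<close>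
    define \<phi> where "\<phi> x = (if x \<in> X - {x0} then c x else 0)" for x
    have "cut_vec E a b \<phi> = (\<Sum>x\<in>X - {x0}. (\<phi> x - \<phi> x0) *\<^sub>R ?b x)"
      by (rule cut_vec_eq_sum) (use X x0 ab in auto)
    also have "\<dots> = (\<Sum>x\<in>X - {x0}. c x *\<^sub>R ?b x)" by (rule sum.cong) (auto simp: \<phi>_def)
    finally have "cut_vec E a b \<phi> = 0" using s by simp
    then have "\<forall>e\<in>E. \<phi> (a e) = \<phi> (b e)"
      by (simp add: cut_vec_def vec_eq_iff) (metis eq_iff_diff_eq_0)
    from conn[OF this] show "\<forall>i\<in>X - {x0}. c i = 0" by (auto simp: \<phi>_def split: if_splits)
  qed
  moreover have "range (cut_vec E a b) = span (?b ` (X - {x0}))"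
    by (rule cut_space_eq_span) (use X x0 ab in auto)
  ultimately show ?thesis using X x0 by (simp add: dim_span) (metis Suc_pred card_gt_0_iff empty_iff)
qed

lemma dim_supported: "dim {\<zeta> :: real ^ 'e. \<forall>e. e \<notin> E \<longrightarrow> \<zeta> $ e = 0} = card E"
  using dim_substandard_cart[where 'a = real, of E] by (simp add: dim_vec_eq)

lemma subspace_supported: "subspace {\<zeta> :: real ^ 'e. \<forall>e. e \<notin> E \<longrightarrow> \<zeta> $ e = 0}"
  by (auto simp: subspace_def)

text \<open>Circulations are the orthogonal complement of the cut space among the functions on
  \<open>E\<close>, and duality identifies them with the cut space of the dual. For connected graph
  and dual this is Euler's formula.\<close>

lemma dual_pair_dim:
  fixes E :: "'e::finite set"
  assumes d: "dual_pair E t h l r"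
  shows "dim (range (cut_vec E t h)) + dim (range (cut_vec E l r)) = card E"
proof -
  let ?S = "{\<zeta> :: real ^ 'e. \<forall>e. e \<notin> E \<longrightarrow> \<zeta> $ e = 0}"
  have orth: "orthogonal (cut_vec E t h \<phi>) \<zeta> \<longleftrightarrow> (\<Sum>e\<in>E. \<zeta> $ e * (\<phi> (t e) - \<phi> (h e))) = 0" for \<phi> \<zeta>
  proof -
    have "cut_vec E t h \<phi> \<bullet> \<zeta> = (\<Sum>e\<in>UNIV. if e \<in> E then \<zeta> $ e * (\<phi> (t e) - \<phi> (h e)) else 0)"
      by (auto simp: cut_vec_def inner_vec_def intro!: sum.cong)
    then show ?thesis by (simp add: orthogonal_def sum.If_cases)
  qed
  have "{y \<in> ?S. \<forall>x\<in>range (cut_vec E t h). orthogonal x y} = range (cut_vec E l r)" (is "?L = ?R")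
  proof (intro equalityI subsetI)
    fix y assume y: "y \<in> ?L"
    have "circulation E t h (($) y)"
      unfolding circulation_def incid_def
    proof
      fix x
      have "orthogonal (cut_vec E t h (\<lambda>v. of_bool (v = x))) y" using y by blast
      then show "(\<Sum>e\<in>E. y $ e * (of_bool (t e = x) - of_bool (h e = x))) = 0" by (simp add: orth)
    qed
    then obtain \<phi> where "\<forall>e\<in>E. y $ e = \<phi> (l e) - \<phi> (r e)" using d unfolding dual_pair_def by blast
    then have "y = cut_vec E l r \<phi>" using y by (simp add: cut_vec_def vec_eq_iff)
    then show "y \<in> ?R" by blast
  next
    fix y assume "y \<in> ?R"
    then obtain \<psi> where y: "y = cut_vec E l r \<psi>" by blast
    have c: "circulation E t h (($) y)"
      using d unfolding dual_pair_def y cut_vec_def by auto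
    have "orthogonal (cut_vec E t h \<phi>) y" for \<phi>
    proof -
      let ?X = "t ` E \<union> h ` E"
      \<comment> \<open>Expands the potential in vertex indicators, so that interchanging the sums
        isolates the balance at each vertex.\<close>
      have p: "\<phi> (t e) - \<phi> (h e) = (\<Sum>x\<in>?X. \<phi> x * incid t h e x)" if "e \<in> E" for e
      proof -
        have *: "(\<Sum>x\<in>?X. \<phi> x * of_bool (y = x)) = \<phi> y" if "y \<in> ?X" for y
        proof -
          have "(\<Sum>x\<in>?X. \<phi> x * of_bool (y = x)) = (\<Sum>x\<in>?X. if x = y then \<phi> x else 0)"
            by (rule sum.cong) auto
          then show ?thesis using that by (simp add: sum.delta)
        qed
        from *[of "t e"] *[of "h e"] that show ?thesis
          by (simp add: incid_def right_diff_distrib sum_subtractf)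
      qed
      have "(\<Sum>e\<in>E. y $ e * (\<phi> (t e) - \<phi> (h e))) = (\<Sum>e\<in>E. \<Sum>x\<in>?X. \<phi> x * (y $ e * incid t h e x))"
        by (rule sum.cong) (auto simp: p sum_distrib_left mult_ac)
      also have "\<dots> = (\<Sum>x\<in>?X. \<phi> x * (\<Sum>e\<in>E. y $ e * incid t h e x))"
        by (subst sum.swap) (simp add: sum_distrib_left)
      also have "\<dots> = 0" using c by (simp add: circulation_def)
      finally show ?thesis by (simp add: orth)
    qed
    moreover have "y \<in> ?S" by (simp add: y cut_vec_def)
    ultimately show "y \<in> ?L" by blast
  qed
  moreover have "dim {y \<in> ?S. \<forall>x\<in>range (cut_vec E t h). orthogonal x y} + dim (range (cut_vec E t h)) = dim ?S"
    by (rule dim_subspace_orthogonal_to_vectors[OF subspace_cut_space subspace_supported])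
       (auto simp: cut_vec_def)
  ultimately show ?thesis by (simp add: dim_supported)
qed

section \<open>Edge bounds for simple graphs with an abstract dual\<close>

text \<open>Edges are names rather than pairs of vertices: a contraction changes the ends of an edge
  but keeps its name, as the dual maps require.\<close>

definition simple_ends :: "'e set \<Rightarrow> ('e \<Rightarrow> 'v) \<Rightarrow> ('e \<Rightarrow> 'v) \<Rightarrow> bool" where
  "simple_ends E t h \<longleftrightarrow> (\<forall>e\<in>E. t e \<noteq> h e) \<and> inj_on (\<lambda>e. {t e, h e}) E"

lemma simple_ends_subset: "simple_ends E t h \<Longrightarrow> D \<subseteq> E \<Longrightarrow> simple_ends D t h"
  by (auto simp: simple_ends_def intro: inj_on_subset)

text \<open>Balance at each end of \<open>e0\<close> demands a further edge of the support there.
  The two further edges differ, as otherwise they would be parallel to \<open>e0\<close>.\<close>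

lemma circulation_support_ge_3:
  assumes simple: "simple_ends E t h" and fin: "finite E" and circ: "circulation E t h \<zeta>"
    and e0: "e0 \<in> E" "\<zeta> e0 \<noteq> 0"
  shows "3 \<le> card {e\<in>E. \<zeta> e \<noteq> 0}"
proof -
  have ex: "\<exists>e1\<in>E - {e0}. \<zeta> e1 \<noteq> 0 \<and> x \<in> {t e1, h e1}" if x: "x \<in> {t e0, h e0}" for x
  proof (rule ccontr)
    assume *: "\<not> ?thesis"
    have "0 = (\<Sum>e\<in>E. \<zeta> e * incid t h e x)" using circ by (simp add: circulation_def)
    also have "\<dots> = \<zeta> e0 * incid t h e0 x + (\<Sum>e\<in>E - {e0}. \<zeta> e * incid t h e x)"
      using fin e0 by (simp add: sum.remove)
    also have "(\<Sum>e\<in>E - {e0}. \<zeta> e * incid t h e x) = 0"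
      using * by (intro sum.neutral) (auto simp: incid_def)
    finally show False using x simple e0 by (auto simp: incid_def simple_ends_def)
  qed
  obtain e1 where e1: "e1 \<in> E - {e0}" "\<zeta> e1 \<noteq> 0" "t e0 \<in> {t e1, h e1}" using ex by blast
  obtain e2 where e2: "e2 \<in> E - {e0}" "\<zeta> e2 \<noteq> 0" "h e0 \<in> {t e2, h e2}" using ex by blast
  have "e1 \<noteq> e2"
  proof
    assume "e1 = e2"
    then have "{t e1, h e1} = {t e0, h e0}" using e1 e2 e0 simple by (auto simp: simple_ends_def)
    then show False using simple e1 e0 by (auto simp: simple_ends_def inj_on_def)
  qed
  then have "card {e0, e1, e2} = 3" using e1 e2 by auto
  moreover have "{e0, e1, e2} \<subseteq> {e\<in>E. \<zeta> e \<noteq> 0}" using e0 e1 e2 by auto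
  ultimately show ?thesis using card_mono[of "{e\<in>E. \<zeta> e \<noteq> 0}" "{e0, e1, e2}"] fin by simp
qed

text \<open>The star of a dual vertex is a circulation, so if it has a non-loop it has at least
  three; each edge is in at most two stars. With \<open>F\<close> dual vertices,
  \<open>3 F \<le> 2 |E|\<close> and \<open>|E| \<le> (|V| - 1) + (F - 1)\<close> combine to the
  bound. Edges with equal dual ends are left out of \<open>E'\<close>, since they cancel in their
  star.\<close>

lemma simple_dual_card_le:
  fixes E :: "'e::finite set"
  assumes simple: "simple_ends E t h" and dual: "dual_pair E t h l r"
    and V: "finite V" "\<And>e. e \<in> E \<Longrightarrow> t e \<in> V \<and> h e \<in> V" "3 \<le> card V"
  shows "card E + 6 \<le> 3 * card V"
proof -
  define E' where "E' = {e\<in>E. l e \<noteq> r e}"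
  define F where "F = l ` E' \<union> r ` E'"
  have finF: "finite F" by (simp add: F_def)
  obtain v0 where "v0 \<in> V" using V(3) by fastforce
  then have dV: "dim (range (cut_vec E t h)) + 1 \<le> card V"
    by (rule dim_cut_space_le[OF V(1)]) (use V in auto)
  show ?thesis
  proof (cases "F = {}")
    \<comment> \<open>All dual edges are loops, so only the zero function is a circulation: the
      graph is a forest.\<close>
    case True
    then have "l e = r e" if "e \<in> E" for e using that by (auto simp: F_def E'_def)
    then have "cut_vec E l r = (\<lambda>_. 0)" by (auto simp: cut_vec_def vec_eq_iff fun_eq_iff)
    then have "dim (range (cut_vec E l r)) = 0" by (simp add: dim_eq_0)
    then show ?thesis using dual_pair_dim[OF dual] dV V(3) by linarith
  next
    case False
    then obtain f0 where "f0 \<in> F" by blast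
    then have dF: "dim (range (cut_vec E l r)) + 1 \<le> card F"
      by (rule dim_cut_space_le[OF finF]) (auto simp: F_def E'_def)
    have "3 \<le> card {e\<in>E'. l e = f \<or> r e = f}" if f: "f \<in> F" for f
    proof -
      let ?z = "\<lambda>e. of_bool (l e = f) - of_bool (r e = f) :: real"
      obtain e0 where "e0 \<in> E" "?z e0 \<noteq> 0" using f by (auto simp: F_def E'_def)
      moreover have "circulation E t h ?z"
        by (rule dual[unfolded dual_pair_def, rule_format, THEN iffD2]) (rule exI[of _ "\<lambda>y. of_bool (y = f)"], simp)
      ultimately have "3 \<le> card {e\<in>E. ?z e \<noteq> 0}"
        by (intro circulation_support_ge_3[OF simple]) auto
      also have "{e\<in>E. ?z e \<noteq> 0} = {e\<in>E'. l e = f \<or> r e = f}" by (auto simp: E'_def)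
      finally show ?thesis .
    qed
    then have "(\<Sum>f\<in>F. 3) \<le> (\<Sum>f\<in>F. card {e\<in>E'. l e = f \<or> r e = f})" by (intro sum_mono) auto
    also have "\<dots> = (\<Sum>f\<in>F. \<Sum>e\<in>E'. of_bool (l e = f \<or> r e = f))" by (simp add: Int_def del: of_bool_or_iff)
    also have "\<dots> = (\<Sum>e\<in>E'. card {f\<in>F. l e = f \<or> r e = f})"
      by (subst sum.swap) (simp add: Int_def finF del: of_bool_or_iff)
    also have "\<dots> \<le> (\<Sum>e\<in>E'. 2)"
    proof (rule sum_mono)
      fix e
      have "{f\<in>F. l e = f \<or> r e = f} \<subseteq> {l e, r e}" by auto
      then show "card {f\<in>F. l e = f \<or> r e = f} \<le> 2"
        using card_mono[of "{l e, r e}" "{f\<in>F. l e = f \<or> r e = f}"]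
        by (auto simp: card_insert_if split: if_splits)
    qed
    also have "\<dots> \<le> 2 * card E" by (simp add: E'_def card_mono)
    finally have "3 * card F \<le> 2 * card E" by simp
    then show ?thesis using dual_pair_dim[OF dual] dV dF by linarith
  qed
qed

definition neighbours :: "'e set \<Rightarrow> ('e \<Rightarrow> 'v) \<Rightarrow> ('e \<Rightarrow> 'v) \<Rightarrow> 'v \<Rightarrow> 'v set" where
  "neighbours E t h x = {y. \<exists>e\<in>E. {t e, h e} = {x, y}}"

lemma card_neighbours:
  assumes "simple_ends E t h"
  shows "card (neighbours E t h x) = card {e\<in>E. t e = x \<or> h e = x}"
proof -
  have "bij_betw (\<lambda>e. if t e = x then h e else t e) {e\<in>E. t e = x \<or> h e = x} (neighbours E t h x)"
    unfolding bij_betw_def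
  proof
    show "inj_on (\<lambda>e. if t e = x then h e else t e) {e \<in> E. t e = x \<or> h e = x}"
    proof (rule inj_onI)
      fix e f assume *: "e \<in> {e \<in> E. t e = x \<or> h e = x}" "f \<in> {e \<in> E. t e = x \<or> h e = x}"
        "(if t e = x then h e else t e) = (if t f = x then h f else t f)"
      then have "{t e, h e} = {t f, h f}" by (auto split: if_splits)
      then show "e = f" using assms * by (auto simp: simple_ends_def inj_on_def)
    qed
  qed (auto simp: neighbours_def doubleton_eq_iff image_iff; blast)
  then show ?thesis by (simp add: bij_betw_same_card)
qed

lemma handshake:
  assumes "simple_ends E t h" "finite E" "finite V" "\<And>e. e \<in> E \<Longrightarrow> t e \<in> V \<and> h e \<in> V"
  shows "(\<Sum>x\<in>V. card (neighbours E t h x)) = 2 * card E"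
proof -
  have "(\<Sum>x\<in>V. card (neighbours E t h x)) = (\<Sum>x\<in>V. \<Sum>e\<in>E. of_bool (t e = x \<or> h e = x))"
    using assms by (simp add: card_neighbours Int_def del: of_bool_or_iff)
  also have "\<dots> = (\<Sum>e\<in>E. card {x\<in>V. t e = x \<or> h e = x})"
    by (subst sum.swap) (simp add: Int_def assms del: of_bool_or_iff)
  also have "\<dots> = (\<Sum>e\<in>E. 2)"
  proof (rule sum.cong)
    fix e assume e: "e \<in> E"
    then have "{x\<in>V. t e = x \<or> h e = x} = {t e, h e}" using assms(4)[OF e] by auto
    then show "card {x\<in>V. t e = x \<or> h e = x} = 2" using assms(1) e by (simp add: simple_ends_def)
  qed simp
  finally show ?thesis by simp
qed

text \<open>A vertex \<open>u\<close> of degree \<open>k \<le> 5\<close> exists by the bound on the number of edges. If every edge were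
  in three triangles, the closed neighbourhood of \<open>u\<close> would have at least \<open>5 k / 2\<close> edges, against
  the bound \<open>3 (k + 1) - 6\<close>.\<close>

lemma ex_edge_few_common_neighbours:
  fixes E :: "'e::finite set" and t h :: "'e \<Rightarrow> 'v" and l r :: "'e \<Rightarrow> 'f"
  assumes simple: "simple_ends E t h" and dual: "dual_pair E t h l r" and "E \<noteq> {}"
  shows "\<exists>e\<in>E. card (neighbours E t h (t e) \<inter> neighbours E t h (h e)) \<le> 2"
proof (rule ccontr)
  let ?N = "neighbours E t h"
  assume "\<not> ?thesis"
  then have c: "3 \<le> card (?N (t e) \<inter> ?N (h e))" if "e \<in> E" for e using that by force
  have finN: "finite (?N x)" for x
  proof -
    have "?N x \<subseteq> t ` E \<union> h ` E" by (auto simp: neighbours_def doubleton_eq_iff)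
    then show ?thesis by (rule finite_subset) simp
  qed
  have c': "3 \<le> card (?N x \<inter> ?N y)" if "y \<in> ?N x" for x y
    using that c by (auto simp: neighbours_def doubleton_eq_iff Int_commute)
  have nx: "x \<notin> ?N x" for x using simple by (auto simp: neighbours_def simple_ends_def)
  have sym: "y \<in> ?N x \<longleftrightarrow> x \<in> ?N y" for x y by (auto simp: neighbours_def insert_commute)
  define V where "V = t ` E \<union> h ` E"
  have finV: "finite V" by (simp add: V_def)
  have NV: "?N x \<subseteq> V" for x by (auto simp: neighbours_def V_def doubleton_eq_iff)
  obtain e where e: "e \<in> E" using \<open>E \<noteq> {}\<close> by blast
  have "3 \<le> card (?N (t e))" using c[OF e] finN by (meson Int_lower1 card_mono le_trans)
  then have "3 \<le> card V" using card_mono[OF finV NV] le_trans by blast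
  then have "card E + 6 \<le> 3 * card V"
    by (intro simple_dual_card_le[OF simple dual finV]) (auto simp: V_def)
  moreover have hs: "(\<Sum>x\<in>V. card (?N x)) = 2 * card E"
    by (rule handshake[OF simple _ finV]) (auto simp: V_def)
  ultimately have "\<exists>u\<in>V. card (?N u) \<le> 5"
  proof -
    have "\<not> (\<forall>u\<in>V. 6 \<le> card (?N u))"
    proof
      assume "\<forall>u\<in>V. 6 \<le> card (?N u)"
      then have "(\<Sum>x\<in>V. 6) \<le> (\<Sum>x\<in>V. card (?N x))" by (intro sum_mono) auto
      then show False using hs \<open>card E + 6 \<le> 3 * card V\<close> by simp
    qed
    then show ?thesis by force
  qed
  then obtain u where u: "u \<in> V" "card (?N u) \<le> 5" by blast
  define W where "W = insert u (?N u)"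
  define H where "H = {e\<in>E. t e \<in> W \<and> h e \<in> W}"
  have cW: "card W = card (?N u) + 1" using finN nx by (simp add: W_def)
  obtain y where y: "y \<in> ?N u"
    using u by (auto simp: V_def neighbours_def insert_commute)
  have k3: "3 \<le> card (?N u)" using c'[OF y] finN by (meson Int_lower1 card_mono le_trans)
  obtain l' r' :: "'e \<Rightarrow> 'f" where "dual_pair H t h l' r'"
    using dual_pair_subset[OF dual, of H] by (auto simp: H_def)
  then have "card H + 6 \<le> 3 * card W"
    by (rule simple_dual_card_le[rotated])
       (use simple_ends_subset[OF simple, of H] cW k3 finN in \<open>auto simp: H_def W_def\<close>)
  moreover have "(\<Sum>x\<in>W. card (neighbours H t h x)) = 2 * card H"
    by (rule handshake) (use simple_ends_subset[OF simple, of H] finN in \<open>auto simp: H_def W_def\<close>)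
  moreover have NH: "neighbours H t h x = ?N x \<inter> W" if "x \<in> W" for x
    using that by (auto simp: neighbours_def H_def doubleton_eq_iff)
  have "(\<Sum>x\<in>W. card (neighbours H t h x)) = card (neighbours H t h u) + (\<Sum>x\<in>?N u. card (neighbours H t h x))"
    unfolding W_def using nx finN by (simp add: sum.insert)
  moreover have "neighbours H t h u = ?N u" using NH[of u] by (auto simp: W_def)
  moreover have "(\<Sum>x\<in>?N u. 4) \<le> (\<Sum>x\<in>?N u. card (neighbours H t h x))"
  proof (rule sum_mono)
    fix x assume x: "x \<in> ?N u"
    \<comment> \<open>Within \<open>W\<close>, a neighbour of \<open>u\<close> is adjacent to
      \<open>u\<close> itself and to the three or more common neighbours.\<close>
    have "card (insert u (?N u \<inter> ?N x)) \<le> card (neighbours H t h x)"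
      using x sym finN by (intro card_mono) (auto simp: NH W_def)
    then show "4 \<le> card (neighbours H t h x)" using c'[OF x] nx finN by simp
  qed
  \<comment> \<open>For \<open>k\<close> neighbours, \<open>5 k \<le> 2 |H| \<le> 6 k - 6\<close>
    would force \<open>k \<ge> 6\<close>.\<close>
  ultimately show False using cW u by simp
qed

section \<open>Stresses and vertex splitting\<close>

text \<open>Independence of the rows of a rigidity matrix with edge vectors \<open>F e\<close>.
  These are arbitrary, not derived from positions, because in the limiting position of a split the
  new edge has length zero but still a direction.\<close>

definition stress_free :: "'e set \<Rightarrow> ('e \<Rightarrow> 'v) \<Rightarrow> ('e \<Rightarrow> 'v) \<Rightarrow> ('e \<Rightarrow> 'a::real_vector) \<Rightarrow> bool" where
  "stress_free E t h F \<longleftrightarrow>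
     (\<forall>\<omega>. (\<forall>x. (\<Sum>e\<in>E. (\<omega> e * incid t h e x) *\<^sub>R F e) = 0) \<longrightarrow> (\<forall>e\<in>E. \<omega> e = 0))"

text \<open>Trades the limiting direction of the new edge for its true short edge vector.\<close>

lemma stress_free_scale:
  assumes sf: "stress_free E t h F" and c: "\<And>e. e \<in> E \<Longrightarrow> c e \<noteq> 0 \<and> G e = c e *\<^sub>R F e"
  shows "stress_free E t h G"
  unfolding stress_free_def
proof (intro allI impI)
  fix \<omega> assume "\<forall>x. (\<Sum>e\<in>E. (\<omega> e * incid t h e x) *\<^sub>R G e) = 0"
  then have "\<forall>x. (\<Sum>e\<in>E. ((c e * \<omega> e) * incid t h e x) *\<^sub>R F e) = 0"
    by (simp add: c mult_ac cong: sum.cong)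
  then have "\<forall>e\<in>E. c e * \<omega> e = 0"
    using sf[unfolded stress_free_def, THEN spec, of "\<lambda>e. c e * \<omega> e"] by blast
  then show "\<forall>e\<in>E. \<omega> e = 0" using c by auto
qed

text \<open>With both ends of \<open>e0\<close> at one point, adding their equilibrium conditions
  eliminates \<open>e0\<close>, and the two edges to a common neighbour merge into one. The result
  is a stress of the contracted graph, hence zero. At \<open>t e0\<close> only the edges to common
  neighbours and \<open>e0\<close> can then carry stress, and \<open>ind\<close> removes
  these.\<close>

lemma vertex_split_stress_free:
  fixes E :: "'e set" and p :: "'v \<Rightarrow> 'a::real_vector" and \<sigma> :: "'a \<Rightarrow> 'b::real_vector"
  assumes simple: "simple_ends E t h" and fin: "finite E" and e0: "e0 \<in> E"
    and odd: "\<And>x. \<sigma> (- x) = - \<sigma> x" and puv: "p (t e0) = p (h e0)"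
  defines "m \<equiv> (\<lambda>x. if x = t e0 then h e0 else x)"
    and "C \<equiv> neighbours E t h (t e0) \<inter> neighbours E t h (h e0)"
  defines "E' \<equiv> E - {e0} - {f\<in>E. \<exists>w\<in>C. {t f, h f} = {t e0, w}}"
  assumes sf: "stress_free E' (m \<circ> t) (m \<circ> h) (\<lambda>f. \<sigma> (p (t f) - p (h f)))"
    and ind: "\<And>a b. (\<Sum>w\<in>C. a w *\<^sub>R \<sigma> (p (h e0) - p w)) + b *\<^sub>R \<eta> = 0 \<Longrightarrow> b = 0 \<and> (\<forall>w\<in>C. a w = 0)"
  shows "stress_free E t h (\<lambda>f. if f = e0 then \<eta> else \<sigma> (p (t f) - p (h f)))"
  unfolding stress_free_def
proof (intro allI impI)
  define u v where "u = t e0" and "v = h e0"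
  let ?s = "\<lambda>f. \<sigma> (p (t f) - p (h f))"
  let ?I = "incid t h" and ?I' = "incid (m \<circ> t) (m \<circ> h)"
  have uv: "u \<noteq> v" using simple e0 by (auto simp: simple_ends_def u_def v_def)
  have uniq: "f = g" if "f \<in> E" "g \<in> E" "{t f, h f} = {t g, h g}" for f g
    using simple that by (auto simp: simple_ends_def inj_on_def)
  have ne: "t f \<noteq> h f" if "f \<in> E" for f using simple that by (auto simp: simple_ends_def)
  fix \<omega> assume eq: "\<forall>x. (\<Sum>e\<in>E. (\<omega> e * ?I e x) *\<^sub>R (if e = e0 then \<eta> else ?s e)) = 0"
  have split: "(\<omega> e0 * ?I e0 x) *\<^sub>R \<eta> + (\<Sum>e\<in>E - {e0}. (\<omega> e * ?I e x) *\<^sub>R ?s e) = 0" for x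
    using eq[rule_format, of x] fin e0 by (simp add: sum.remove)
  have I0: "?I e0 u = 1" "?I e0 v = -1" "x \<noteq> u \<Longrightarrow> x \<noteq> v \<Longrightarrow> ?I e0 x = 0" for x
    using uv by (auto simp: incid_def u_def v_def)
  have I': "?I' e x = (if x = u then 0 else if x = v then ?I e u + ?I e v else ?I e x)" for e x
    using uv by (auto simp: incid_def m_def u_def v_def)
  \<comment> \<open>At the merged vertex the contributions of \<open>e0\<close> cancel, as its
    incidences there are 1 and -1.\<close>
  have merged: "(\<Sum>e\<in>E - {e0}. (\<omega> e * ?I' e x) *\<^sub>R ?s e) = 0" for x
  proof -
    consider "x = u" | "x = v" "x \<noteq> u" | "x \<noteq> v" "x \<noteq> u" by blast
    then show ?thesis
    proof cases
      case 2
      have "(\<Sum>e\<in>E - {e0}. (\<omega> e * ?I' e x) *\<^sub>R ?s e)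
        = (\<Sum>e\<in>E - {e0}. (\<omega> e * ?I e u) *\<^sub>R ?s e) + (\<Sum>e\<in>E - {e0}. (\<omega> e * ?I e v) *\<^sub>R ?s e)"
        using 2 by (simp add: I' distrib_left scaleR_add_left sum.distrib)
      also have "\<dots> = - (\<omega> e0 *\<^sub>R \<eta>) + \<omega> e0 *\<^sub>R \<eta>"
        using minus_unique[OF split[of u]] minus_unique[OF split[of v]]
        by (simp add: I0) (metis minus_minus)
      finally show ?thesis by simp
    qed (use split[of x] in \<open>simp_all add: I' I0\<close>)
  qed
  have "\<forall>w\<in>C. \<exists>f. f \<in> E \<and> {t f, h f} = {u, w}" "\<forall>w\<in>C. \<exists>f. f \<in> E \<and> {t f, h f} = {v, w}"
    by (auto simp: C_def neighbours_def u_def v_def)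
  then obtain dU dV where dU: "\<And>w. w \<in> C \<Longrightarrow> dU w \<in> E \<and> {t (dU w), h (dU w)} = {u, w}"
    and dV: "\<And>w. w \<in> C \<Longrightarrow> dV w \<in> E \<and> {t (dV w), h (dV w)} = {v, w}" by metis
  have Cuv: "w \<noteq> u" "w \<noteq> v" if "w \<in> C" for w
    using that simple by (auto simp: C_def neighbours_def u_def v_def simple_ends_def)
  have finC: "finite C"
  proof -
    have "C \<subseteq> t ` E \<union> h ` E" by (auto simp: C_def neighbours_def doubleton_eq_iff)
    then show ?thesis using fin by (simp add: finite_subset)
  qed
  have E': "E' = E - {e0} - dU ` C"
  proof -
    have "{f\<in>E. \<exists>w\<in>C. {t f, h f} = {t e0, w}} = dU ` C"
      using dU by (force simp: u_def intro!: uniq)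
    then show ?thesis by (simp add: E'_def)
  qed
  have injU: "inj_on dU C"
    by (rule inj_onI) (metis dU doubleton_eq_iff)
  have e0ends: "{t e0, h e0} = {u, v}" by (simp add: u_def v_def)
  have dU0: "dU w \<noteq> e0" if "w \<in> C" for w
    using dU[OF that] Cuv[OF that] e0ends uv by (metis doubleton_eq_iff)
  have dVE': "dV w \<in> E'" if w: "w \<in> C" for w
  proof -
    have u: "u \<notin> {t (dV w), h (dV w)}" using dV[OF w] uv Cuv[OF w] by auto
    then have "dV w \<noteq> e0" by (auto simp: u_def)
    moreover have "dV w \<noteq> dU w'" if "w' \<in> C" for w' using u dU[OF that] by auto
    ultimately show ?thesis using dV[OF w] by (auto simp: E')
  qed
  \<comment> \<open>The two edges may be oriented differently; oddness of \<open>\<sigma>\<close>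
    compensates the sign of the incidence.\<close>
  have par: "?I' (dU w) x *\<^sub>R ?s (dU w) = ?I' (dV w) x *\<^sub>R ?s (dV w)" if w: "w \<in> C" for w x
  proof -
    have sU: "\<sigma> (p w - p u) = - \<sigma> (p u - p w)" using odd[of "p u - p w"] by simp
    have "t (dU w) = u \<and> h (dU w) = w \<or> t (dU w) = w \<and> h (dU w) = u"
      using dU[OF w] by (auto simp: doubleton_eq_iff)
    moreover have "t (dV w) = v \<and> h (dV w) = w \<or> t (dV w) = w \<and> h (dV w) = v"
      using dV[OF w] by (auto simp: doubleton_eq_iff)
    ultimately show ?thesis using puv sU Cuv[OF w] uv
      by (auto simp: incid_def m_def u_def[symmetric] v_def[symmetric] algebra_simps)
  qed
  \<comment> \<open>Each edge retained for a common neighbour also takes over the stress of its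
    removed twin.\<close>
  define \<omega>' where "\<omega>' f = \<omega> f + (\<Sum>w\<in>C. if dV w = f then \<omega> (dU w) else 0)" for f
  have finE': "finite E'" using fin by (simp add: E')
  have "(\<Sum>f\<in>E'. (\<omega>' f * ?I' f x) *\<^sub>R ?s f) = 0" for x
  proof -
    have "(\<Sum>f\<in>E'. (\<omega>' f * ?I' f x) *\<^sub>R ?s f) = (\<Sum>f\<in>E'. (\<omega> f * ?I' f x) *\<^sub>R ?s f)
      + (\<Sum>f\<in>E'. \<Sum>w\<in>C. if dV w = f then (\<omega> (dU w) * ?I' f x) *\<^sub>R ?s f else 0)"
      by (simp add: \<omega>'_def distrib_right scaleR_add_left sum.distrib sum_distrib_right scaleR_sum_left if_distrib
          if_distribR cong: if_cong)
    also have "(\<Sum>f\<in>E'. \<Sum>w\<in>C. if dV w = f then (\<omega> (dU w) * ?I' f x) *\<^sub>R ?s f else 0)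
      = (\<Sum>w\<in>C. (\<omega> (dU w) * ?I' (dV w) x) *\<^sub>R ?s (dV w))"
      by (subst sum.swap) (simp add: finE' dVE' sum.delta)
    also have "\<dots> = (\<Sum>w\<in>C. \<omega> (dU w) *\<^sub>R (?I' (dU w) x *\<^sub>R ?s (dU w)))"
      by (simp add: par)
    also have "\<dots> = (\<Sum>f\<in>dU ` C. (\<omega> f * ?I' f x) *\<^sub>R ?s f)"
      by (simp add: sum.reindex[OF injU])
    also have "(\<Sum>f\<in>E'. (\<omega> f * ?I' f x) *\<^sub>R ?s f) + \<dots> = (\<Sum>f\<in>E - {e0}. (\<omega> f * ?I' f x) *\<^sub>R ?s f)"
      unfolding E' using fin dU dU0 by (subst sum.subset_diff[of "dU ` C"]) (auto simp: add.commute)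
    finally show ?thesis by (simp only: merged)
  qed
  then have \<omega>'0: "\<omega>' f = 0" if "f \<in> E'" for f
    using sf that unfolding stress_free_def by blast
  \<comment> \<open>Retained twins end at \<open>v\<close>, so edges of \<open>E'\<close> at
    \<open>u\<close> received nothing and keep their old coefficient.\<close>
  have u0: "\<omega> f = 0" if f: "f \<in> E'" "?I f u \<noteq> 0" for f
  proof -
    have "u \<in> {t f, h f}" using f by (auto simp: incid_def split: if_splits)
    moreover have "u \<notin> {t (dV w), h (dV w)}" if "w \<in> C" for w using dV[OF that] uv Cuv[OF that] by auto
    ultimately have "(\<Sum>w\<in>C. if dV w = f then \<omega> (dU w) else 0) = 0" by (intro sum.neutral) auto
    then show ?thesis using \<omega>'0[OF f(1)] by (simp add: \<omega>'_def)
  qed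
  have dUu: "?I (dU w) u *\<^sub>R ?s (dU w) = \<sigma> (p (h e0) - p w)" if w: "w \<in> C" for w
  proof -
    have "\<sigma> (p w - p u) = - \<sigma> (p u - p w)" using odd[of "p u - p w"] by simp
    moreover have "t (dU w) = u \<and> h (dU w) = w \<or> t (dU w) = w \<and> h (dU w) = u"
      using dU[OF w] by (auto simp: doubleton_eq_iff)
    ultimately show ?thesis using puv Cuv[OF w]
      by (auto simp: incid_def u_def[symmetric] v_def[symmetric])
  qed
  have "0 = \<omega> e0 *\<^sub>R \<eta> + (\<Sum>e\<in>E - {e0}. (\<omega> e * ?I e u) *\<^sub>R ?s e)" using split[of u] by (simp add: I0)
  also have "(\<Sum>e\<in>E - {e0}. (\<omega> e * ?I e u) *\<^sub>R ?s e) = (\<Sum>e\<in>dU ` C. (\<omega> e * ?I e u) *\<^sub>R ?s e)"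
    by (rule sum.mono_neutral_right) (use fin dU dU0 u0 in \<open>auto simp: E'\<close>)
  also have "\<dots> = (\<Sum>w\<in>C. \<omega> (dU w) *\<^sub>R (?I (dU w) u *\<^sub>R ?s (dU w)))"
    by (simp add: sum.reindex[OF injU])
  also have "\<dots> = (\<Sum>w\<in>C. \<omega> (dU w) *\<^sub>R \<sigma> (p (h e0) - p w))" by (simp add: dUu)
  finally have "(\<Sum>w\<in>C. \<omega> (dU w) *\<^sub>R \<sigma> (p (h e0) - p w)) + \<omega> e0 *\<^sub>R \<eta> = 0" by (simp add: add.commute)
  from ind[OF this] have z: "\<omega> e0 = 0" "\<And>w. w \<in> C \<Longrightarrow> \<omega> (dU w) = 0" by auto
  have "\<omega> f = 0" if "f \<in> E'" for f
  proof -
    have "(\<Sum>w\<in>C. if dV w = f then \<omega> (dU w) else 0) = 0" using z by (intro sum.neutral) auto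
    then show ?thesis using \<omega>'0[OF that] by (simp add: \<omega>'_def)
  qed
  then show "\<forall>e\<in>E. \<omega> e = 0" using z by (auto simp: E')
qed

text \<open>Independence is an open condition: the linear map formed from the limit vectors is
  injective, hence bounded below, and survives a perturbation smaller than that bound.\<close>

lemma eventually_independent_family:
  fixes b0 :: "'e::finite \<Rightarrow> 'a::euclidean_space"
  assumes lim: "\<And>e. e \<in> E \<Longrightarrow> ((\<lambda>s. b s e) \<longlongrightarrow> b0 e) F"
    and ind: "\<And>a. (\<Sum>e\<in>E. a e *\<^sub>R b0 e) = 0 \<Longrightarrow> \<forall>e\<in>E. a e = 0"
  shows "\<forall>\<^sub>F s in F. \<forall>a. (\<Sum>e\<in>E. a e *\<^sub>R b s e) = 0 \<longrightarrow> (\<forall>e\<in>E. a e = 0)"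
proof -
  \<comment> \<open>The second component records the coordinates outside \<open>E\<close>, which
    makes the map injective on the whole space.\<close>
  define T where "T a = (\<Sum>e\<in>E. a $ e *\<^sub>R b0 e, \<chi> e. if e \<in> E then 0 else a $ e)" for a :: "real ^ 'e"
  have "linear T"
    by (rule linearI) (auto simp: T_def vec_eq_iff scaleR_add_left sum.distrib scaleR_sum_right)
  moreover have "inj T"
    unfolding linear_injective_0[OF \<open>linear T\<close>]
  proof (intro allI impI)
    fix a assume a: "T a = 0"
    then have "(\<Sum>e\<in>E. a $ e *\<^sub>R b0 e) = 0" by (simp add: T_def zero_prod_def)
    from ind[OF this] have "a $ e = 0" if "e \<in> E" for e using that by blast
    moreover have "a $ e = 0" if "e \<notin> E" for e
      using arg_cong[OF a, of "\<lambda>y. snd y $ e"] that by (simp add: T_def)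
    ultimately have "a $ e = 0" for e by blast
    then show "a = 0" by (simp add: vec_eq_iff)
  qed
  ultimately obtain B where B: "B > 0" "\<And>a. B * norm a \<le> norm (T a)"
    by (rule linear_inj_bounded_below_pos) blast
  have "((\<lambda>s. \<Sum>e\<in>E. norm (b s e - b0 e)) \<longlongrightarrow> (\<Sum>e\<in>E. 0)) F"
    by (intro tendsto_sum tendsto_norm_zero) (use lim LIM_zero in blast)
  then have "\<forall>\<^sub>F s in F. (\<Sum>e\<in>E. norm (b s e - b0 e)) < B"
    using B(1) by (simp add: order_tendstoD(2))
  then show ?thesis
  proof (rule eventually_mono, intro allI impI)
    fix s c assume s: "(\<Sum>e\<in>E. norm (b s e - b0 e)) < B" and c: "(\<Sum>e\<in>E. c e *\<^sub>R b s e) = 0"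
    define a :: "real ^ 'e" where "a = (\<chi> e. if e \<in> E then c e else 0)"
    have Ta: "T a = (\<Sum>e\<in>E. c e *\<^sub>R b0 e, 0)" by (simp add: T_def a_def vec_eq_iff)
    have "(\<Sum>e\<in>E. c e *\<^sub>R b0 e) = - (\<Sum>e\<in>E. c e *\<^sub>R (b s e - b0 e))"
      using c by (simp add: scaleR_diff_right sum_subtractf)
    then have "norm (T a) = norm (\<Sum>e\<in>E. c e *\<^sub>R (b s e - b0 e))" by (simp add: Ta norm_Pair)
    also have "\<dots> \<le> (\<Sum>e\<in>E. norm a * norm (b s e - b0 e))"
    proof (rule sum_norm_le)
      fix e assume "e \<in> E"
      then have "\<bar>c e\<bar> \<le> norm a" using component_le_norm_cart[of a e] by (simp add: a_def)
      then show "norm (c e *\<^sub>R (b s e - b0 e)) \<le> norm a * norm (b s e - b0 e)"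
        by (simp add: mult_right_mono)
    qed
    also have "\<dots> = norm a * (\<Sum>e\<in>E. norm (b s e - b0 e))" by (simp add: sum_distrib_left)
    finally have "B * norm a \<le> norm a * (\<Sum>e\<in>E. norm (b s e - b0 e))" using B(2)[of a] by linarith
    then have "norm a = 0" using s
      by (metis mult.commute mult_le_cancel_left_pos not_le zero_less_norm_iff norm_eq_zero)
    then show "\<forall>e\<in>E. c e = 0" by (simp add: a_def vec_eq_iff) metis
  qed
qed

lemma eventually_stress_free:
  fixes t h :: "'e::finite \<Rightarrow> 'v::finite" and G0 :: "'e \<Rightarrow> real ^ 'd"
  assumes "stress_free E t h G0" and lim: "\<And>e. e \<in> E \<Longrightarrow> ((\<lambda>s. G s e) \<longlongrightarrow> G0 e) F"
  shows "\<forall>\<^sub>F s in F. stress_free E t h (G s)"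
proof -
  define R where "R G e = (\<chi> x. incid t h e x *\<^sub>R G e)" for G :: "'e \<Rightarrow> real ^ 'd" and e
  have sf: "stress_free E t h G \<longleftrightarrow> (\<forall>a. (\<Sum>e\<in>E. a e *\<^sub>R R G e) = 0 \<longrightarrow> (\<forall>e\<in>E. a e = 0))" for G
    by (simp add: stress_free_def R_def vec_eq_iff[where 'b = 'v])
  have "\<forall>\<^sub>F s in F. \<forall>a. (\<Sum>e\<in>E. a e *\<^sub>R R (G s) e) = 0 \<longrightarrow> (\<forall>e\<in>E. a e = 0)"
  proof (rule eventually_independent_family)
    show "((\<lambda>s. R (G s) e) \<longlongrightarrow> R G0 e) F" if "e \<in> E" for e
      unfolding R_def by (intro tendsto_vec_lambda tendsto_scaleR tendsto_const lim that)
  qed (use assms(1) sf in blast)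
  then show ?thesis by (simp add: sf)
qed

lemma signed_powr_minus: "signed_powr (- x) s = - signed_powr x s"
  by (simp add: signed_powr_def vec_eq_iff sgn_minus)

lemma signed_powr_scaleR: "signed_powr (c *\<^sub>R x) s = (sgn c * \<bar>c\<bar> powr s) *\<^sub>R signed_powr x s"
  by (simp add: signed_powr_def vec_eq_iff sgn_mult abs_mult powr_mult)

lemma signed_powr_0: "signed_powr 0 s = 0"
  by (simp add: signed_powr_def vec_eq_iff)

lemma signed_powr_1: "signed_powr x 1 = x"
  by (simp add: signed_powr_def vec_eq_iff sgn_mult_abs)

text \<open>Bijectivity lets a prescribed edge vector be realised by an actual displacement.\<close>

lemma signed_powr_inverse:
  assumes "s > 0"
  shows "signed_powr (signed_powr x s) (1 / s) = x" "signed_powr (signed_powr x (1 / s)) s = x"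
  using assms by (auto simp: signed_powr_def vec_eq_iff sgn_mult abs_mult powr_mult powr_powr sgn_if)

lemma tendsto_signed_powr:
  fixes f :: "'b \<Rightarrow> real ^ 'd"
  assumes "s > 0" and f: "(f \<longlongrightarrow> x) F"
  shows "((\<lambda>a. signed_powr (f a) s) \<longlongrightarrow> signed_powr x s) F"
proof -
  have cont: "isCont (\<lambda>y::real. sgn y * \<bar>y\<bar> powr s) y" for y
  proof -
    \<comment> \<open>Powers of the positive and negative parts avoid the discontinuity of the sign
      at 0.\<close>
    have "(\<lambda>y::real. sgn y * \<bar>y\<bar> powr s) = (\<lambda>y. (max y 0) powr s - (max (- y) 0) powr s)"
      by (auto simp: fun_eq_iff sgn_if max_def)
    moreover have "continuous_on UNIV (\<lambda>y::real. (max y 0) powr s - (max (- y) 0) powr s)"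
      using \<open>s > 0\<close> by (intro continuous_intros continuous_on_powr') auto
    ultimately show ?thesis by (simp add: continuous_on_eq_continuous_at)
  qed
  then show ?thesis
    unfolding signed_powr_def
    by (intro tendsto_vec_lambda isCont_tendsto_compose[OF cont] tendsto_vec_nth f)
qed

lemma signed_powr_parallel:
  assumes "s > 0" "signed_powr x s = c *\<^sub>R signed_powr y s"
  shows "\<exists>c'. x = c' *\<^sub>R y"
  by (metis assms signed_powr_inverse(1) signed_powr_scaleR)

section \<open>General position and placement of planar graphs\<close>

text \<open>Excluding collinear triples keeps the vectors from one point to two others independent,
  also after \<open>signed_powr\<close>. Injectivity is required separately, as graphs with two
  vertices have no triples.\<close>

definition gen_pos :: "'v set \<Rightarrow> ('v \<Rightarrow> 'a::real_vector) \<Rightarrow> bool" where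
  "gen_pos V p \<longleftrightarrow> inj_on p V \<and>
     (\<forall>a\<in>V. \<forall>b\<in>V. \<forall>c\<in>V. a \<noteq> b \<and> b \<noteq> c \<and> a \<noteq> c \<longrightarrow> \<not> collinear {p a, p b, p c})"

lemma collinear_cross3: "collinear {x, a, b} \<longleftrightarrow> cross3 (x - a) (b - a) = 0"
  by (subst collinear_3) (simp_all add: cross_eq_0)

text \<open>Points on a parabola work: the third coordinate of the cross product is a Vandermonde
  product.\<close>

lemma ex_gen_pos: "\<exists>p :: 'v::finite \<Rightarrow> real ^ 3. gen_pos V p"
proof -
  obtain i :: "'v \<Rightarrow> nat" where i: "inj i" using finite_imp_inj_to_nat_seg[of "UNIV :: 'v set"] by auto
  define p :: "'v \<Rightarrow> real ^ 3" where "p v = vector [real (i v), real (i v) ^ 2, 0]" for v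
  have "\<not> collinear {p a, p b, p c}" if "a \<noteq> b" "b \<noteq> c" "a \<noteq> c" for a b c
  proof -
    let ?x = "real (i a)" and ?y = "real (i b)" and ?z = "real (i c)"
    have "cross3 (p a - p b) (p c - p b) $ 3 = (?x - ?y) * (?z - ?y) * (?z - ?x)"
      by (simp add: cross3_def p_def vector_3 power2_eq_square algebra_simps)
    moreover have "\<dots> \<noteq> 0" using that i by (auto simp: inj_eq)
    ultimately show ?thesis by (auto simp: collinear_cross3)
  qed
  moreover have "inj p" by (rule injI) (use i in \<open>auto simp: p_def vec_eq_iff forall_3 vector_3 inj_eq\<close>)
  ultimately show ?thesis by (auto simp: gen_pos_def intro: inj_on_subset)
qed

text \<open>Each set lies in a proper subspace and is therefore null, and so is a finite union of
  them.\<close>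

lemma ex_avoiding_subspaces:
  fixes S :: "'i \<Rightarrow> 'a::euclidean_space set"
  assumes "finite I" "\<And>i. i \<in> I \<Longrightarrow> dim (S i) < DIM('a)"
  shows "\<exists>x. \<forall>i\<in>I. x \<notin> S i"
proof -
  have "negligible (\<Union> (S ` I))"
    using assms by (intro negligible_Union) (auto intro: negligible_lowdim)
  then have "\<Union> (S ` I) \<noteq> UNIV" by (metis non_negligible_UNIV)
  then show ?thesis by blast
qed

text \<open>A new vertex is placed at \<open>p v + \<tau> d\<close> for small \<open>\<tau> > 0\<close>; the direction \<open>d\<close> has to avoid
  finitely many lines and planes.\<close>

theorem ex_stress_free_gen_pos:
  fixes E :: "'e::finite set" and t h :: "'e \<Rightarrow> 'v::finite" and l r :: "'e \<Rightarrow> 'f"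
  assumes "s > 0" "simple_ends E t h" "dual_pair E t h l r" "\<And>e. e \<in> E \<Longrightarrow> t e \<in> V \<and> h e \<in> V"
  shows "\<exists>p :: 'v \<Rightarrow> real ^ 3. gen_pos V p \<and> stress_free E t h (\<lambda>e. signed_powr (p (t e) - p (h e)) s)"
  using assms(2-)
proof (induction "card E" arbitrary: E t h l r V rule: less_induct)
  case less
  note simple = less.prems(1) and dual = less.prems(2) and ends = less.prems(3)
  show ?case
  proof (cases "E = {}")
    case True
    then show ?thesis using ex_gen_pos by (auto simp: stress_free_def)
  next
    case False
    let ?\<sigma> = "\<lambda>x :: real ^ 3. signed_powr x s"
    obtain e0 where e0: "e0 \<in> E" "card (neighbours E t h (t e0) \<inter> neighbours E t h (h e0)) \<le> 2"
      using ex_edge_few_common_neighbours[OF simple dual False] by blast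
    define u v where "u = t e0" and "v = h e0"
    define m where "m = (\<lambda>x. if x = t e0 then h e0 else x)"
    define C where "C = neighbours E t h (t e0) \<inter> neighbours E t h (h e0)"
    \<comment> \<open>Of the two edges that contraction makes parallel, the one at \<open>u\<close>
      is dropped, which keeps the contracted graph simple.\<close>
    define E' where "E' = E - {e0} - {f\<in>E. \<exists>w\<in>C. {t f, h f} = {t e0, w}}"
    have ne: "t f \<noteq> h f" if "f \<in> E" for f using simple that by (auto simp: simple_ends_def)
    have uniq: "f = g" if "f \<in> E" "g \<in> E" "{t f, h f} = {t g, h g}" for f g
      using simple that by (auto simp: simple_ends_def inj_on_def)
    have uv: "u \<noteq> v" "u \<in> V" "v \<in> V" using ne[OF e0(1)] ends[OF e0(1)] by (auto simp: u_def v_def)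
    have "dual_pair (E - {e0}) (m \<circ> t) (m \<circ> h) l r"
      unfolding m_def by (rule dual_pair_contract[OF dual _ e0(1)]) (use ne e0 in auto)
    from dual_pair_subset[OF this, of E'] obtain l' r' :: "'e \<Rightarrow> 'f"
      where dual': "dual_pair E' (m \<circ> t) (m \<circ> h) l' r'" by (auto simp: E'_def)
    have simple': "simple_ends E' (m \<circ> t) (m \<circ> h)"
      unfolding simple_ends_def
    proof
      show "\<forall>e\<in>E'. (m \<circ> t) e \<noteq> (m \<circ> h) e"
      proof
        fix f assume f: "f \<in> E'"
        then have "{t f, h f} \<noteq> {t e0, h e0}" "f \<in> E"
          using uniq[of f e0] e0 by (auto simp: E'_def)
        then show "(m \<circ> t) f \<noteq> (m \<circ> h) f"
          using ne[of f] by (auto simp: m_def split: if_splits)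
      qed
      show "inj_on (\<lambda>e. {(m \<circ> t) e, (m \<circ> h) e}) E'"
      proof (rule inj_onI)
        fix f g assume f: "f \<in> E'" and g: "g \<in> E'" and eq: "{(m \<circ> t) f, (m \<circ> h) f} = {(m \<circ> t) g, (m \<circ> h) g}"
        have fg: "f \<in> E" "g \<in> E" using f g by (auto simp: E'_def)
        \<comment> \<open>Such a \<open>w\<close> is a common neighbour, so the edge from
          \<open>u\<close> to \<open>w\<close> was removed.\<close>
        have main: "\<not> ({t f, h f} = {u, w} \<and> {t g, h g} = {v, w})" if f: "f \<in> E'" and "g \<in> E'" for f g w
        proof
          assume *: "{t f, h f} = {u, w} \<and> {t g, h g} = {v, w}"
          then have "w \<in> C" using that by (auto simp: C_def neighbours_def E'_def u_def v_def)
          then show False using f * by (auto simp: E'_def u_def)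
        qed
        show "f = g"
        proof (cases "{t f, h f} = {t g, h g}")
          case True
          then show ?thesis using uniq fg by blast
        next
          case False
          have "\<exists>w. {t f, h f} = {u, w} \<and> {t g, h g} = {v, w} \<or> {t g, h g} = {u, w} \<and> {t f, h f} = {v, w}"
            using eq False ne[OF fg(1)] ne[OF fg(2)] unfolding m_def comp_def u_def[symmetric] v_def[symmetric]
            by (auto simp: doubleton_eq_iff split: if_splits)
          then show ?thesis using main f g by blast
        qed
      qed
    qed
    have "card E' < card E" by (rule psubset_card_mono) (use e0 in \<open>auto simp: E'_def\<close>)
    moreover have "(m \<circ> t) e \<in> V - {u} \<and> (m \<circ> h) e \<in> V - {u}" if "e \<in> E'" for e
      using that ends[of e] uv by (auto simp: E'_def m_def simp flip: u_def v_def)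
    ultimately obtain p :: "'v \<Rightarrow> real ^ 3"
      where gp: "gen_pos (V - {u}) p"
        and sf: "stress_free E' (m \<circ> t) (m \<circ> h) (\<lambda>e. ?\<sigma> (p ((m \<circ> t) e) - p ((m \<circ> h) e)))"
      using less.hyps[OF _ simple' dual', of "V - {u}"] by blast
    have gpc: "\<not> collinear {p a, p b, p c}" if "a \<in> V - {u}" "b \<in> V - {u}" "c \<in> V - {u}" "a \<noteq> b" "b \<noteq> c" "a \<noteq> c" for a b c
      using gp that unfolding gen_pos_def by simp
    have gpi: "p a \<noteq> p b" if "a \<in> V - {u}" "b \<in> V - {u}" "a \<noteq> b" for a b
      using gp that unfolding gen_pos_def inj_on_def by blast
    \<comment> \<open>The limiting position, with \<open>u\<close> on top of
      \<open>v\<close>.\<close>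
    define p0 where "p0 = p(u := p v)"
    have p0: "p0 u = p0 v" "p0 x = p (m x)" "x \<noteq> u \<Longrightarrow> p0 x = p x" for x
      using uv by (auto simp: p0_def m_def u_def v_def)
    have CV: "w \<in> V - {u, v}" if "w \<in> C" for w
      using that unfolding C_def neighbours_def u_def v_def by (auto simp: doubleton_eq_iff dest: ends ne)
    have par: "x \<noteq> 0 \<and> \<not> collinear {0, x, y}" if "x = p v - p a" "y = p v - p b"
      "a \<in> V - {u, v}" "b \<in> V - {u, v}" "a \<noteq> b" for x y a b
    proof -
      have "\<not> collinear {p a, p v, p b}" by (rule gpc) (use that uv in auto)
      moreover have "p a - p v = - x" "p b - p v = - y" using that by simp_all
      ultimately have "cross3 x y \<noteq> 0"
        using cross_minus_left[of x "- y"] cross_minus_right[of x y]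
        by (simp add: collinear_3[of "p a"] cross_eq_0[symmetric])
      then show ?thesis by (auto simp: cross_eq_0)
    qed
    \<comment> \<open>\<open>Inl ()\<close> indexes the span of the vectors to common neighbours, of
      dimension at most 2, which \<eta> avoids for independence. \<open>Inr w\<close> indexes a
      line, avoided so that \<open>u\<close>, \<open>v\<close> and \<open>w\<close> do not become
      collinear.\<close>
    define Z where "Z = insert (Inl ()) (Inr ` (V - {u, v}))"
    define S where "S = (\<lambda>i. case i of Inl (_::unit) \<Rightarrow> span ((\<lambda>w. ?\<sigma> (p v - p w)) ` C) | Inr w \<Rightarrow> span {?\<sigma> (p v - p w)})"
    have "\<exists>\<eta>. \<forall>i\<in>Z. \<eta> \<notin> S i"
    proof (rule ex_avoiding_subspaces)
      fix i assume "i \<in> Z"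
      have "dim ((\<lambda>w. ?\<sigma> (p v - p w)) ` C) \<le> card ((\<lambda>w. ?\<sigma> (p v - p w)) ` C)" by (rule dim_le_card') simp
      also have "\<dots> \<le> card C" by (rule card_image_le) simp
      finally have "dim ((\<lambda>w. ?\<sigma> (p v - p w)) ` C) \<le> 2" using e0 by (simp add: C_def)
      then show "dim (S i) < DIM(real ^ 3)"
        by (auto simp: S_def dim_span split: sum.split)
    qed (simp add: Z_def)
    then obtain \<eta> where \<eta>C: "\<eta> \<notin> span ((\<lambda>w. ?\<sigma> (p v - p w)) ` C)"
      and \<eta>w: "\<And>w. w \<in> V - {u, v} \<Longrightarrow> \<eta> \<notin> span {?\<sigma> (p v - p w)}"
      by (auto simp: Z_def S_def)
    have \<eta>0: "\<eta> \<noteq> 0" using \<eta>C by (auto simp: span_zero)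
    define d where "d = signed_powr \<eta> (1 / s)"
    have \<sigma>d: "?\<sigma> d = \<eta>" unfolding d_def by (rule signed_powr_inverse(2)[OF \<open>s > 0\<close>])
    have d0: "d \<noteq> 0" using \<sigma>d \<eta>0 by (auto simp: signed_powr_0)
    have sf0: "stress_free E t h (\<lambda>f. if f = e0 then \<eta> else ?\<sigma> (p0 (t f) - p0 (h f)))"
    proof (rule vertex_split_stress_free[OF simple _ e0(1)])
      show "stress_free (E - {e0} - {f \<in> E. \<exists>w\<in>neighbours E t h (t e0) \<inter> neighbours E t h (h e0). {t f, h f} = {t e0, w}})
        ((\<lambda>x. if x = t e0 then h e0 else x) \<circ> t) ((\<lambda>x. if x = t e0 then h e0 else x) \<circ> h)
        (\<lambda>f. ?\<sigma> (p0 (t f) - p0 (h f)))"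
        using sf unfolding E'_def C_def m_def p0(2) by (simp add: comp_def)
      show "b = 0 \<and> (\<forall>w\<in>neighbours E t h (t e0) \<inter> neighbours E t h (h e0). a w = 0)"
        if sum: "(\<Sum>w\<in>neighbours E t h (t e0) \<inter> neighbours E t h (h e0). a w *\<^sub>R ?\<sigma> (p0 (h e0) - p0 w)) + b *\<^sub>R \<eta> = 0"
        for a b
      proof -
        have "(\<Sum>w\<in>C. a w *\<^sub>R ?\<sigma> (p0 (h e0) - p0 w)) = (\<Sum>w\<in>C. a w *\<^sub>R ?\<sigma> (p v - p w))"
          using CV p0 uv by (intro sum.cong) (auto simp: v_def[symmetric])
        then have sum': "(\<Sum>w\<in>C. a w *\<^sub>R ?\<sigma> (p v - p w)) + b *\<^sub>R \<eta> = 0" using sum by (simp add: C_def)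
        have "b = 0"
        proof (rule ccontr)
          assume b: "b \<noteq> 0"
          have "\<eta> = (- 1 / b) *\<^sub>R (\<Sum>w\<in>C. a w *\<^sub>R ?\<sigma> (p v - p w))"
            using sum' b by (simp add: eq_neg_iff_add_eq_0[symmetric])
          also have "\<dots> \<in> span ((\<lambda>w. ?\<sigma> (p v - p w)) ` C)"
            by (intro span_scale span_sum) (auto intro: span_base)
          finally show False using \<eta>C by simp
        qed
        then have sum0: "(\<Sum>w\<in>C. a w *\<^sub>R ?\<sigma> (p v - p w)) = 0" using sum' by simp
        have nz: "?\<sigma> (p v - p w) \<noteq> 0" if "w \<in> C" for w
        proof
          assume "?\<sigma> (p v - p w) = 0"
          then have "p v - p w = 0" using signed_powr_inverse(1)[OF \<open>s > 0\<close>, of "p v - p w"]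
            by (simp add: signed_powr_0)
          then show False using gpi[of v w] CV[OF that] uv by auto
        qed
        have "card C \<le> 2" using e0 by (simp add: C_def)
        then have "card C = 0 \<or> card C = 1 \<or> card C = 2" by linarith
        then have "\<forall>w\<in>C. a w = 0"
        proof (elim disjE)
          assume "card C = 1"
          then obtain w where "C = {w}" by (auto simp: card_1_singleton_iff)
          then show ?thesis using sum0 nz by auto
        next
          assume "card C = 2"
          then obtain x y where C: "C = {x, y}" "x \<noteq> y" by (auto simp: card_2_iff)
          have xy: "a x *\<^sub>R ?\<sigma> (p v - p x) + a y *\<^sub>R ?\<sigma> (p v - p y) = 0" using sum0 C by simp
          \<comment> \<open>Parallel images under \<open>signed_powr\<close> have parallel
            arguments, which would put \<open>v\<close>, \<open>x\<close> and \<open>y\<close> on a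
            line.\<close>
          have "a y = 0" if xy: "a x *\<^sub>R ?\<sigma> (p v - p x) + a y *\<^sub>R ?\<sigma> (p v - p y) = 0"
            and "x \<in> C" "y \<in> C" "x \<noteq> y" for x y
          proof (rule ccontr)
            assume ay: "a y \<noteq> 0"
            have "a y *\<^sub>R ?\<sigma> (p v - p y) = - (a x *\<^sub>R ?\<sigma> (p v - p x))" using xy by (simp add: eq_neg_iff_add_eq_0 add.commute)
            then have "inverse (a y) *\<^sub>R a y *\<^sub>R ?\<sigma> (p v - p y) = inverse (a y) *\<^sub>R (- (a x *\<^sub>R ?\<sigma> (p v - p x)))" by simp
            then have "?\<sigma> (p v - p y) = (- a x / a y) *\<^sub>R ?\<sigma> (p v - p x)" using ay by (simp add: field_simps)
            from signed_powr_parallel[OF \<open>s > 0\<close> this] obtain c where "p v - p y = c *\<^sub>R (p v - p x)" by blast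
            then have "collinear {0, p v - p x, p v - p y}" by (auto simp: collinear_lemma)
            then show False using par[OF refl refl, of x y] CV that by blast
          qed
          from this[OF xy] this[of y x] xy C show ?thesis by (auto simp: add.commute)
        qed auto
        then show ?thesis using \<open>b = 0\<close> by (simp add: C_def)
      qed
    qed (use p0 in \<open>auto simp: signed_powr_minus u_def v_def\<close>)
    define P where "P \<tau> = p(u := p v + \<tau> *\<^sub>R d)" for \<tau>
    have P: "P \<tau> u = p v + \<tau> *\<^sub>R d" "x \<noteq> u \<Longrightarrow> P \<tau> x = p x" for \<tau> x by (auto simp: P_def)
    have limP: "((\<lambda>\<tau>. P \<tau> x) \<longlongrightarrow> p0 x) (at_right 0)" for x
    proof (cases "x = u")
      case True
      have "((\<lambda>\<tau>. p v + \<tau> *\<^sub>R d) \<longlongrightarrow> p v + 0 *\<^sub>R d) (at_right 0)" by (intro tendsto_intros)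
      then show ?thesis using True by (simp add: P p0_def)
    qed (simp add: P p0(3))
    have pos: "\<forall>\<^sub>F \<tau> in at_right 0. (\<tau>::real) > 0" by (simp add: eventually_at_right_less)
    have "\<forall>\<^sub>F \<tau> in at_right 0. stress_free E t h (\<lambda>f. if f = e0 then \<eta> else ?\<sigma> (P \<tau> (t f) - P \<tau> (h f)))"
      by (rule eventually_stress_free[OF sf0]) (auto intro!: tendsto_signed_powr \<open>s > 0\<close> tendsto_diff limP)
    moreover note pos
    moreover have "\<forall>\<^sub>F \<tau> in at_right 0. \<forall>w\<in>V - {u}. P \<tau> u \<noteq> p w"
    proof (intro eventually_ball_finite ballI)
      fix w assume w: "w \<in> V - {u}"
      show "\<forall>\<^sub>F \<tau> in at_right 0. P \<tau> u \<noteq> p w"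
      proof (cases "w = v")
        case True
        from pos show ?thesis by eventually_elim (use True d0 in \<open>simp add: P\<close>)
      next
        case False
        then have "p0 u \<noteq> p w" using w gpi[of v w] uv by (auto simp: p0_def)
        with limP[of u] show ?thesis by (rule tendsto_imp_eventually_ne)
      qed
    qed simp
    moreover have "\<forall>\<^sub>F \<tau> in at_right 0. \<forall>a\<in>V - {u}. \<forall>b\<in>V - {u}. a \<noteq> b \<longrightarrow> \<not> collinear {P \<tau> u, p a, p b}"
    proof (intro eventually_ball_finite ballI)
      fix a b assume ab: "a \<in> V - {u}" "b \<in> V - {u}"
      \<comment> \<open>Triples containing both \<open>u\<close> and \<open>v\<close> are collinear
        in the limit, so openness cannot help; here the direction \<open>d\<close> itself must miss
        the line towards \<open>w\<close>.\<close>
      have dv: "\<not> collinear {p v + \<tau> *\<^sub>R d, p v, p w}" if "\<tau> > 0" "w \<in> V - {u, v}" for \<tau> w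
      proof
        assume "collinear {p v + \<tau> *\<^sub>R d, p v, p w}"
        then have "cross3 d (p w - p v) = 0" using that by (simp add: collinear_cross3 cross_mult_left)
        then have "collinear {0, p w - p v, d}" by (simp add: cross_eq_0 insert_commute)
        moreover have "p w - p v \<noteq> 0" using gpi[of w v] that uv by auto
        ultimately obtain c where "d = c *\<^sub>R (p w - p v)" using d0 by (auto simp: collinear_lemma)
        then have "d = (- c) *\<^sub>R (p v - p w)" by (simp add: algebra_simps)
        then have "\<eta> = (sgn (- c) * \<bar>- c\<bar> powr s) *\<^sub>R ?\<sigma> (p v - p w)"
          using \<sigma>d signed_powr_scaleR[of "- c" "p v - p w" s] by simp
        then have "\<eta> \<in> span {?\<sigma> (p v - p w)}" by (metis span_base span_scale singletonI)
        then show False using \<eta>w that by blast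
      qed
      show "\<forall>\<^sub>F \<tau> in at_right 0. a \<noteq> b \<longrightarrow> \<not> collinear {P \<tau> u, p a, p b}"
      proof (cases "a = b \<or> a = v \<or> b = v")
        case True
        from pos show ?thesis
        proof eventually_elim
          case (elim \<tau>)
          show ?case using True dv[OF elim, of a] dv[OF elim, of b] ab
            by (auto simp: P insert_commute)
        qed
      next
        case False
        \<comment> \<open>Without \<open>v\<close>, the limiting triple has \<open>p v\<close> in
          place of \<open>u\<close> and is not collinear, which persists nearby.\<close>
        have "((\<lambda>\<tau>. cross3 (P \<tau> u - p a) (p b - p a)) \<longlongrightarrow> cross3 (p0 u - p a) (p b - p a)) (at_right 0)"
          by (rule bounded_linear.tendsto[OF bounded_bilinear.bounded_linear_left[OF bilinear_conv_bounded_bilinear[THEN iffD1, OF bilinear_cross]]])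
             (intro tendsto_diff limP tendsto_const)
        moreover have "cross3 (p0 u - p a) (p b - p a) \<noteq> 0"
        proof -
          have "\<not> collinear {p v, p a, p b}" by (rule gpc) (use False ab uv in auto)
          then show ?thesis by (simp add: collinear_cross3 p0_def)
        qed
        ultimately have "\<forall>\<^sub>F \<tau> in at_right 0. cross3 (P \<tau> u - p a) (p b - p a) \<noteq> 0"
          by (rule tendsto_imp_eventually_ne)
        then show ?thesis by eventually_elim (simp add: collinear_cross3)
      qed
    qed auto
    ultimately have "\<forall>\<^sub>F \<tau> in at_right 0. gen_pos V (P \<tau>) \<and> stress_free E t h (\<lambda>e. ?\<sigma> (P \<tau> (t e) - P \<tau> (h e)))"
    proof eventually_elim
      case (elim \<tau>)
      have "stress_free E t h (\<lambda>e. ?\<sigma> (P \<tau> (t e) - P \<tau> (h e)))"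
      \<comment> \<open>The true edge from \<open>v\<close> to \<open>u\<close> is \<tau> times
        \<open>d\<close>, so its vector is \<open>\<tau> powr s\<close> times \<eta>.\<close>
      proof (rule stress_free_scale[OF elim(1), where c = "\<lambda>e. if e = e0 then \<tau> powr s else 1"])
        have "P \<tau> (t e0) - P \<tau> (h e0) = \<tau> *\<^sub>R d" using uv by (simp add: P flip: u_def v_def)
        then have "?\<sigma> (P \<tau> (t e0) - P \<tau> (h e0)) = \<tau> powr s *\<^sub>R \<eta>" using elim(2) \<sigma>d by (simp add: signed_powr_scaleR)
        then show "(if e = e0 then \<tau> powr s else 1) \<noteq> 0 \<and> ?\<sigma> (P \<tau> (t e) - P \<tau> (h e)) =
          (if e = e0 then \<tau> powr s else 1) *\<^sub>R (if e = e0 then \<eta> else ?\<sigma> (P \<tau> (t e) - P \<tau> (h e)))" for e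
          using elim(2) by simp
      qed
      moreover have "inj_on (P \<tau>) V"
      proof (rule inj_onI)
        fix a b assume "a \<in> V" "b \<in> V" "P \<tau> a = P \<tau> b"
        then show "a = b" using elim(3) gpi[of a b]
          by (cases "a = u"; cases "b = u") (auto simp: P dest: sym)
      qed
      moreover have "\<not> collinear {P \<tau> a, P \<tau> b, P \<tau> c}"
        if abc: "a \<in> V" "b \<in> V" "c \<in> V" "a \<noteq> b" "b \<noteq> c" "a \<noteq> c" for a b c
      proof -
        consider "a = u" | "b = u" | "c = u" | "a \<noteq> u" "b \<noteq> u" "c \<noteq> u" by blast
        then show ?thesis
        proof cases
          case 1 then show ?thesis using elim(4) abc by (auto simp: P)
        next
          case 2 then show ?thesis using elim(4) abc by (auto simp: P insert_commute[of "p a"])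
        next
          case 3
          have "{p a, p b, P \<tau> u} = {P \<tau> u, p a, p b}" by blast
          then show ?thesis using 3 elim(4) abc by (auto simp: P(2))
        next
          case 4 then show ?thesis using gpc[of a b c] abc by (simp add: P)
        qed
      qed
      ultimately show ?case unfolding gen_pos_def by blast
    qed
    then have "\<exists>\<tau>. gen_pos V (P \<tau>) \<and> stress_free E t h (\<lambda>e. ?\<sigma> (P \<tau> (t e) - P \<tau> (h e)))"
      by (rule eventually_happens'[rotated]) simp
    then show ?thesis by (rule exE) (rule exI)
  qed
qed

section \<open>Winding numbers of arcs\<close>

text \<open>An open subset of the plane inside an arc would embed into the line, against invariance
  of dimension. This makes every edge point a limit of points off the drawing.\<close>

lemma interior_arc_image:
  fixes g :: "real \<Rightarrow> complex"
  assumes "arc g"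
  shows "interior (path_image g) = {}"
proof (rule ccontr)
  assume ne: "interior (path_image g) \<noteq> {}"
  obtain k where k: "homeomorphism {0..1} (path_image g) g k" using homeomorphism_arc[OF assms] by blast
  have "DIM(complex) \<le> DIM(real)"
  proof (rule invariance_of_dimension)
    show "continuous_on (interior (path_image g)) k"
      using k interior_subset by (metis continuous_on_subset homeomorphism_cont2)
    show "inj_on k (interior (path_image g))"
      by (rule inj_on_subset[OF _ interior_subset], rule inj_on_inverseI[of _ g])
        (use k in \<open>simp add: homeomorphism_def\<close>)
  qed (use ne in auto)
  then show False by simp
qed

text \<open>Two continuous logarithms of the same path differ by a continuous function with values
  in the multiples of \<open>2 * pi * \<i>\<close>, hence by a constant.\<close>

lemma winding_number_continuous_log:
  assumes \<gamma>: "path \<gamma>" "x \<notin> path_image \<gamma>" and q: "continuous_on {0..1} q"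
    and eq: "\<And>t. t \<in> {0..1} \<Longrightarrow> \<gamma> t = x + exp (q t)"
  shows "2 * of_real pi * \<i> * winding_number \<gamma> x = q 1 - q 0"
proof -
  obtain p where p: "path p" "pathfinish p - pathstart p = 2 * of_real pi * \<i> * winding_number \<gamma> x"
    "\<And>t. t \<in> {0..1} \<Longrightarrow> \<gamma> t = x + exp (p t)"
    using winding_number_as_continuous_log[OF \<gamma>] by blast
  have e: "exp (p t - q t) = 1" if "t \<in> {0..1}" for t
    using p(3)[OF that] eq[OF that] by (simp add: exp_diff)
  have "(\<lambda>t. p t - q t) constant_on {0..1}"
  proof (rule continuous_discrete_range_constant)
    show "continuous_on {0..1} (\<lambda>t. p t - q t)" using p(1) q by (intro continuous_intros) (auto simp: path_def)
    fix s :: real assume s: "s \<in> {0..1}"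
    show "\<exists>e>0. \<forall>t. t \<in> {0..1} \<and> p t - q t \<noteq> p s - q s \<longrightarrow> e \<le> norm (p t - q t - (p s - q s))"
    proof (intro exI[of _ "2 * pi"] conjI allI impI)
      fix t assume t: "t \<in> {0..1} \<and> p t - q t \<noteq> p s - q s"
      have "exp (p t - q t) = exp (p s - q s)" using e s t by simp
      then obtain n :: int where n: "p t - q t = p s - q s + (of_int (2 * n) * pi) * \<i>" by (auto simp: exp_eq)
      then have "n \<noteq> 0" using t by auto
      then have "1 \<le> \<bar>real_of_int n\<bar>" by linarith
      moreover have "norm (p t - q t - (p s - q s)) = 2 * pi * \<bar>real_of_int n\<bar>"
        using n by (simp add: norm_mult)
      ultimately show "2 * pi \<le> norm (p t - q t - (p s - q s))" by simp
    qed simp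
  qed simp
  then obtain c where c: "\<And>t. t \<in> {0..1} \<Longrightarrow> p t - q t = c" by (auto simp: constant_on_def)
  from c[of 0] c[of 1] have "p 1 - p 0 = q 1 - q 0" by (auto simp: algebra_simps)
  then show ?thesis using p(2) by (simp add: pathstart_def pathfinish_def)
qed

text \<open>The winding number of an open arc varies with the point, but a small move changes it by
  a quantity that depends only on the ends of the arc: by \<open>near\<close> the quotient
  \<open>r\<close> stays in the right half-plane, where \<open>Ln\<close> is continuous.\<close>

lemma winding_number_diff_Ln:
  assumes \<gamma>: "path \<gamma>" and near: "\<And>\<zeta>. \<zeta> \<in> path_image \<gamma> \<Longrightarrow> dist x x0 < dist \<zeta> x0"
  shows "2 * of_real pi * \<i> * (winding_number \<gamma> x - winding_number \<gamma> x0) =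
    Ln ((pathfinish \<gamma> - x) / (pathfinish \<gamma> - x0)) - Ln ((pathstart \<gamma> - x) / (pathstart \<gamma> - x0))"
proof -
  have x0: "x0 \<notin> path_image \<gamma>" and x: "x \<notin> path_image \<gamma>" using near by force+
  obtain q where q: "path q" "pathfinish q - pathstart q = 2 * of_real pi * \<i> * winding_number \<gamma> x0"
    "\<And>t. t \<in> {0..1} \<Longrightarrow> \<gamma> t = x0 + exp (q t)"
    using winding_number_as_continuous_log[OF \<gamma> x0] by blast
  define r where "r t = (\<gamma> t - x) / (\<gamma> t - x0)" for t
  have im: "\<gamma> t \<in> path_image \<gamma>" if "t \<in> {0..1}" for t using that by (auto simp: path_image_def)
  have re: "Re (r t) > 0" if t: "t \<in> {0..1}" for t
  proof -
    have n0: "\<gamma> t - x0 \<noteq> 0" using im[OF t] x0 by auto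
    have "r t = 1 - (x - x0) / (\<gamma> t - x0)" using n0 by (simp add: r_def divide_simps)
    moreover have "norm ((x - x0) / (\<gamma> t - x0)) < 1"
      using near[OF im[OF t]] n0 by (simp add: norm_divide dist_norm divide_simps)
    ultimately show ?thesis using complex_Re_le_cmod[of "(x - x0) / (\<gamma> t - x0)"] by simp
  qed
  have cr: "continuous_on {0..1} r"
    unfolding r_def using \<gamma> im x0 by (intro continuous_intros) (auto simp: path_def)
  have "2 * of_real pi * \<i> * winding_number \<gamma> x = (q 1 + Ln (r 1)) - (q 0 + Ln (r 0))"
  proof (rule winding_number_continuous_log[OF \<gamma> x])
    show "continuous_on {0..1} (\<lambda>t. q t + Ln (r t))"
      using q(1) cr re by (intro continuous_intros) (auto simp: path_def complex_nonpos_Reals_iff not_le)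
    fix t :: real assume t: "t \<in> {0..1}"
    have "r t \<noteq> 0" using re[OF t] by auto
    then have "exp (q t + Ln (r t)) = exp (q t) * r t" by (simp add: exp_add)
    also have "exp (q t) = \<gamma> t - x0" using q(3)[OF t] by simp
    also have "(\<gamma> t - x0) * r t = \<gamma> t - x" using im[OF t] x0 by (auto simp: r_def)
    finally show "\<gamma> t = x + exp (q t + Ln (r t))" by simp
  qed
  then show ?thesis using q(2) by (simp add: pathstart_def pathfinish_def r_def algebra_simps)
qed

section \<open>Plane drawings all of whose faces are bordered by cycles\<close>

text \<open>The assumption \<open>face_cycle\<close> also covers the unbounded face, and excludes
  bridges and disconnected drawings.\<close>

locale cycle_faced_drawing =
  fixes V :: "'v::finite set" and E :: "'v set set" and z :: "'v \<Rightarrow> complex"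
    and g :: "'v set \<Rightarrow> real \<Rightarrow> complex"
  assumes simple: "simple_graph V E" and emb: "planar_embedding V E z g"
    and face_cycle: "\<And>F. F \<in> faces V E z g \<Longrightarrow> \<exists>c. bordered_by E g F c"
begin

definition K where "K = z ` V \<union> (\<Union>e\<in>E. path_image (g e))"
text \<open>Edges are oriented in the direction in which their arcs run.\<close>

definition src where "src e = inv_into V z (pathstart (g e))"
definition tgt where "tgt e = inv_into V z (pathfinish (g e))"

abbreviation "circ \<equiv> circulation E src tgt"

lemma arc_g: "e \<in> E \<Longrightarrow> arc (g e)"
  and ends_g: "e \<in> E \<Longrightarrow> {pathstart (g e), pathfinish (g e)} = z ` e"
  and verts_g: "e \<in> E \<Longrightarrow> path_image (g e) \<inter> z ` V = z ` e"
  and cross_g: "e \<in> E \<Longrightarrow> e' \<in> E \<Longrightarrow> e \<noteq> e' \<Longrightarrow> path_image (g e) \<inter> path_image (g e') = z ` (e \<inter> e')"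
  and inj_z: "inj_on z V"
  using emb by (simp_all add: planar_embedding_def)

lemma edge_sub: "e \<in> E \<Longrightarrow> e \<subseteq> V" and edge_card: "e \<in> E \<Longrightarrow> card e = 2"
  using simple by (simp_all add: simple_graph_def)

lemma path_g: "e \<in> E \<Longrightarrow> path (g e)"
  using arc_g arc_imp_path by blast

lemma edge_ends:
  assumes "e \<in> E"
  shows "src e \<in> V" "tgt e \<in> V" "z (src e) = pathstart (g e)" "z (tgt e) = pathfinish (g e)"
    "e = {src e, tgt e}" "src e \<noteq> tgt e"
proof -
  have "pathstart (g e) \<in> z ` V" "pathfinish (g e) \<in> z ` V"
    using ends_g[OF assms] edge_sub[OF assms] by blast+
  then show 1: "src e \<in> V" "tgt e \<in> V" "z (src e) = pathstart (g e)" "z (tgt e) = pathfinish (g e)"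
    by (auto simp: src_def tgt_def inv_into_into f_inv_into_f)
  have "z ` e = z ` {src e, tgt e}" using ends_g[OF assms] 1 by simp
  then show "e = {src e, tgt e}"
    using inj_on_image_eq_iff[OF inj_z, of e "{src e, tgt e}"] 1 edge_sub[OF assms] by simp
  then show "src e \<noteq> tgt e" using edge_card[OF assms] by (metis card_2_iff doubleton_eq_iff insert_absorb2)
qed

lemma closed_K: "closed K" and K_edge: "e \<in> E \<Longrightarrow> path_image (g e) \<subseteq> K"
  unfolding K_def by (intro closed_Un closed_UN ballI) (auto intro: finite_imp_closed closed_path_image path_g)

lemma faces_eq: "faces V E z g = components (- K)" by (simp add: faces_def K_def)

lemma face_props:
  assumes "F \<in> faces V E z g"
  shows "open F" "connected F" "F \<noteq> {}" "F \<subseteq> - K"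
  using assms closed_K unfolding faces_eq
  by (auto simp: in_components_connected in_components_nonempty dest: in_components_subset)
    (meson open_Compl open_components)

lemma Union_faces: "\<Union> (faces V E z g) = - K"
  unfolding faces_eq by (rule Union_components)

lemma faces_disjoint: "F \<in> faces V E z g \<Longrightarrow> F' \<in> faces V E z g \<Longrightarrow> F \<noteq> F' \<Longrightarrow> F \<inter> F' = {}"
  unfolding faces_eq by (simp add: components_nonoverlap)

text \<open>The single terms are winding numbers of open arcs and need be neither integers nor
  locally constant; only for circulations is the sum constant on faces.\<close>

definition wind where "wind \<zeta> x = (\<Sum>e\<in>E. of_real (\<zeta> e) * winding_number (g e) x)"

lemma wind_sum: "wind (\<lambda>e. \<Sum>i\<in>I. c i * \<zeta> i e) x = (\<Sum>i\<in>I. of_real (c i) * wind (\<zeta> i) x)"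
proof -
  have "wind (\<lambda>e. \<Sum>i\<in>I. c i * \<zeta> i e) x = (\<Sum>e\<in>E. \<Sum>i\<in>I. of_real (c i) * (of_real (\<zeta> i e) * winding_number (g e) x))"
    by (simp add: wind_def sum_distrib_right mult.assoc)
  also have "\<dots> = (\<Sum>i\<in>I. of_real (c i) * wind (\<zeta> i) x)"
    by (subst sum.swap) (simp add: wind_def sum_distrib_left)
  finally show ?thesis .
qed

lemma wind_cong: "(\<And>e. e \<in> E \<Longrightarrow> \<zeta> e = \<zeta>' e) \<Longrightarrow> wind \<zeta> = wind \<zeta>'"
  by (auto simp: wind_def fun_eq_iff intro!: sum.cong)

text \<open>By \<open>winding_number_diff_Ln\<close> each edge changes by a difference of one
  function of its two ends. Regrouped by vertices, these changes cancel by balance.\<close>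

lemma wind_locally_constant:
  assumes c: "circ \<zeta>" and x0: "x0 \<notin> K" 
  shows "\<exists>r>0. \<forall>x\<in>ball x0 r. wind \<zeta> x = wind \<zeta> x0"
proof -
  obtain r where r: "r > 0" "ball x0 r \<subseteq> - K"
    using closed_K x0 by (meson ComplI open_Compl open_contains_ball)
  have "wind \<zeta> x = wind \<zeta> x0" if x: "x \<in> ball x0 r" for x
  proof -
    let ?L = "\<lambda>v. Ln ((z v - x) / (z v - x0))"
    have "2 * of_real pi * \<i> * (winding_number (g e) x - winding_number (g e) x0) = ?L (tgt e) - ?L (src e)"
      if e: "e \<in> E" for e
    proof -
      have "dist x x0 < dist \<zeta> x0" if "\<zeta> \<in> path_image (g e)" for \<zeta>
      proof -
        have "\<zeta> \<notin> ball x0 r" using that K_edge[OF e] r by auto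
        then show ?thesis using x by (simp add: dist_commute)
      qed
      from winding_number_diff_Ln[OF path_g[OF e] this] show ?thesis by (simp add: edge_ends(3,4)[OF e])
    qed
    note diff = this
    have "wind \<zeta> x - wind \<zeta> x0 = (\<Sum>e\<in>E. of_real (\<zeta> e) * (winding_number (g e) x - winding_number (g e) x0))"
      by (simp only: wind_def right_diff_distrib sum_subtractf)
    then have "2 * of_real pi * \<i> * (wind \<zeta> x - wind \<zeta> x0)
      = (\<Sum>e\<in>E. of_real (\<zeta> e) * (2 * of_real pi * \<i> * (winding_number (g e) x - winding_number (g e) x0)))"
      by (simp only: sum_distrib_left) (intro sum.cong refl mult.left_commute)
    also have "\<dots> = (\<Sum>e\<in>E. of_real (\<zeta> e) * (?L (tgt e) - ?L (src e)))"
      by (rule sum.cong[OF refl]) (simp only: diff)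
    also have "\<dots> = (\<Sum>e\<in>E. \<Sum>v\<in>UNIV. - (of_real (\<zeta> e * incid src tgt e v) * ?L v))"
    proof (rule sum.cong)
      fix e
      have "(\<Sum>v\<in>UNIV. of_real (of_bool (y = v)) * ?L v) = ?L y" for y
      proof -
        have "(\<Sum>v\<in>UNIV. of_real (of_bool (y = v)) * ?L v) = (\<Sum>v\<in>UNIV. if v = y then ?L v else 0)"
          by (rule sum.cong) auto
        then show ?thesis by (simp add: sum.delta)
      qed
      from this[of "src e"] this[of "tgt e"]
      have "?L (tgt e) - ?L (src e) = (\<Sum>v\<in>UNIV. - (of_real (incid src tgt e v) * ?L v))"
        by (simp add: incid_def left_diff_distrib sum_subtractf sum_negf)
      then show "of_real (\<zeta> e) * (?L (tgt e) - ?L (src e)) = (\<Sum>v\<in>UNIV. - (of_real (\<zeta> e * incid src tgt e v) * ?L v))"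
        by (simp add: sum_distrib_left mult.assoc)
    qed simp
    also have "\<dots> = - (\<Sum>v\<in>UNIV. of_real (\<Sum>e\<in>E. \<zeta> e * incid src tgt e v) * ?L v)"
      by (subst sum.swap) (simp add: sum_negf sum_distrib_right)
    also have "\<dots> = 0" using c by (simp add: circulation_def del: of_real_sum)
    finally show ?thesis by simp
  qed
  then show ?thesis using r(1) by blast
qed

lemma wind_constant:
  assumes c: "circ \<zeta>" and F: "F \<in> faces V E z g" and "x \<in> F" "y \<in> F"
  shows "wind \<zeta> x = wind \<zeta> y"
proof -
  have "wind \<zeta> constant_on F"
  proof (rule locally_constant_imp_constant[OF face_props(2)[OF F]])
    fix a assume a: "a \<in> F"
    then obtain r where r: "r > 0" "\<forall>x\<in>ball a r. wind \<zeta> x = wind \<zeta> a"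
      using wind_locally_constant[OF c, of a] face_props(4)[OF F] by blast
    show "\<exists>T. openin (top_of_set F) T \<and> a \<in> T \<and> (\<forall>x\<in>T. wind \<zeta> x = wind \<zeta> a)"
    proof (intro exI conjI)
      show "openin (top_of_set F) (F \<inter> ball a r)" by (simp add: openin_open_Int)
      show "a \<in> F \<inter> ball a r" using r(1) a by simp
      show "\<forall>x\<in>F \<inter> ball a r. wind \<zeta> x = wind \<zeta> a" using r(2) by blast
    qed
  qed
  then show ?thesis using assms(3,4) by (auto simp: constant_on_def)
qed

end

section \<open>Graph cycles as Jordan curves\<close>

text \<open>The open counterpart of \<open>cycle_edges\<close>, suited to induction; a cycle is such
  a walk together with its closing edge.\<close>

fun walk_edges :: "'v list \<Rightarrow> 'v set set" where
  "walk_edges (x # y # xs) = insert {x, y} (walk_edges (y # xs))"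
| "walk_edges _ = {}"

lemma walk_edges_nth: "walk_edges xs = {{xs ! i, xs ! Suc i} | i. Suc i < length xs}"
proof (induction xs rule: walk_edges.induct)
  case (1 x y xs)
  have "{{(x # y # xs) ! i, (x # y # xs) ! Suc i} | i. Suc i < length (x # y # xs)} =
    insert {x, y} {{(y # xs) ! i, (y # xs) ! Suc i} | i. Suc i < length (y # xs)}" (is "?L = ?R")
  proof
    show "?L \<subseteq> ?R"
    proof
      fix e assume "e \<in> ?L"
      then obtain i where i: "e = {(x # y # xs) ! i, (x # y # xs) ! Suc i}" "Suc i < length (x # y # xs)" by blast
      then show "e \<in> ?R" by (cases i) auto
    qed
    show "?R \<subseteq> ?L"
    proof
      fix e assume "e \<in> ?R"
      then consider "e = {x, y}" | i where "e = {(y # xs) ! i, (y # xs) ! Suc i}" "Suc i < length (y # xs)" by blast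
      then show "e \<in> ?L"
      proof cases
        case 1 then show ?thesis by (auto intro!: exI[of _ 0])
      next
        case 2 then show ?thesis by (intro CollectI exI[of _ "Suc i"]) auto
      qed
    qed
  qed
  with 1 show ?case by simp
qed auto

lemma walk_edges_subset: "e \<in> walk_edges xs \<Longrightarrow> e \<subseteq> set xs"
  by (induction xs rule: walk_edges.induct) auto

lemma finite_walk_edges: "finite (walk_edges xs)"
  by (induction xs rule: walk_edges.induct) auto

lemma cycle_edges_walk: "xs \<noteq> [] \<Longrightarrow> cycle_edges xs = insert {last xs, hd xs} (walk_edges xs)"
proof -
  assume ne: "xs \<noteq> []"
  have "i < length xs \<longleftrightarrow> Suc i < length xs \<or> i = length xs - 1" for i using ne by (cases xs) auto
  then have "cycle_edges xs = {{xs ! i, xs ! (Suc i mod length xs)} | i. Suc i < length xs}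
    \<union> {{xs ! i, xs ! (Suc i mod length xs)} | i. i = length xs - 1}"
    unfolding cycle_edges_def by blast
  moreover have "{{xs ! i, xs ! (Suc i mod length xs)} | i. i = length xs - 1} = {{last xs, hd xs}}"
    using ne by (simp add: last_conv_nth hd_conv_nth)
  moreover have "{{xs ! i, xs ! (Suc i mod length xs)} | i. Suc i < length xs} = walk_edges xs"
    unfolding walk_edges_nth by auto
  ultimately show ?thesis by auto
qed

lemma closing_edge_notin_walk_edges:
  assumes "distinct xs" "3 \<le> length xs"
  shows "{last xs, hd xs} \<notin> walk_edges xs"
proof
  assume "{last xs, hd xs} \<in> walk_edges xs"
  then obtain i where i: "Suc i < length xs" "{last xs, hd xs} = {xs ! i, xs ! Suc i}"
    by (auto simp: walk_edges_nth)
  have "hd xs = xs ! 0" "last xs = xs ! (length xs - 1)" using assms(2)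
    by (auto simp: hd_conv_nth last_conv_nth simp flip: length_greater_0_conv)
  then have "(xs ! i = xs ! 0 \<and> xs ! Suc i = xs ! (length xs - 1)) \<or>
     (xs ! Suc i = xs ! 0 \<and> xs ! i = xs ! (length xs - 1))"
    using i(2) by (auto simp: doubleton_eq_iff)
  moreover have "0 < length xs" "length xs - 1 < length xs" "i < length xs" using i assms(2) by auto
  ultimately show False
    using assms i(1) nth_eq_iff_index_eq[OF assms(1)] by (metis One_nat_def Suc_inject Suc_leI diff_Suc_1
      nat.distinct(1) Suc_1 eval_nat_numeral(3) not_less_eq_eq le_refl Suc_pred)
qed

lemma card_cycle_edges:
  assumes "distinct c" "3 \<le> length c"
  shows "card (cycle_edges c) = length c"
proof -
  have w: "distinct xs \<Longrightarrow> card (walk_edges xs) = length xs - 1" for xs :: "'a list"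
  proof (induction xs rule: walk_edges.induct)
    case (1 x y xs)
    have "{x, y} \<notin> walk_edges (y # xs)" using walk_edges_subset[of "{x, y}" "y # xs"] 1 by auto
    then show ?case using 1 finite_walk_edges[of "y # xs"] by simp
  qed auto
  have "c \<noteq> []" using assms(2) by auto
  then show ?thesis
    using w[OF assms(1)] closing_edge_notin_walk_edges[OF assms] assms(2)
    by (simp add: cycle_edges_walk finite_walk_edges)
qed

context cycle_faced_drawing
begin

text \<open>The invariant for concatenating arcs: \<zeta> is the unit flow from \<open>a\<close> to
  \<open>b\<close> through \<open>S\<close>, negative where an arc is run backwards. For
  \<open>a = b\<close> it is a circulation.\<close>

definition traces :: "(real \<Rightarrow> complex) \<Rightarrow> 'v \<Rightarrow> 'v \<Rightarrow> 'v set set \<Rightarrow> ('v set \<Rightarrow> real) \<Rightarrow> bool" where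
  "traces \<gamma> a b S \<zeta> \<longleftrightarrow> pathstart \<gamma> = z a \<and> pathfinish \<gamma> = z b \<and>
     path_image \<gamma> = (\<Union>e\<in>S. path_image (g e)) \<and> S \<subseteq> E \<and>
     (\<forall>x. x \<notin> K \<longrightarrow> winding_number \<gamma> x = wind \<zeta> x) \<and>
     (\<forall>v. (\<Sum>e\<in>E. \<zeta> e * incid src tgt e v) = of_bool (a = v) - of_bool (b = v)) \<and>
     (\<forall>e\<in>E. \<bar>\<zeta> e\<bar> = of_bool (e \<in> S))"

lemma traces_image:
  assumes "traces \<gamma> a b S \<zeta>"
  shows "S \<subseteq> E" "path_image \<gamma> = (\<Union>e\<in>S. path_image (g e))" "path_image \<gamma> \<subseteq> K"
proof -
  show "S \<subseteq> E" "path_image \<gamma> = (\<Union>e\<in>S. path_image (g e))" using assms by (simp_all add: traces_def)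
  then show "path_image \<gamma> \<subseteq> K" using K_edge by blast
qed

lemma traces_edge:
  assumes e: "{a, b} \<in> E"
  shows "\<exists>\<gamma> \<zeta>. arc \<gamma> \<and> traces \<gamma> a b {{a, b}} \<zeta>"
proof -
  let ?e = "{a, b}"
  note en = edge_ends[OF e]
  have sum: "(\<Sum>f\<in>E. (c * of_bool (f = ?e)) * k f) = c * k ?e" for c :: real and k
  proof -
    have "(\<Sum>f\<in>E. (c * of_bool (f = ?e)) * k f) = (\<Sum>f\<in>E. if f = ?e then c * k f else 0)"
      by (rule sum.cong) auto
    then show ?thesis using e by simp
  qed
  have w: "wind (\<lambda>f. c * of_bool (f = ?e)) x = of_real c * winding_number (g ?e) x" for c x
  proof -
    have "wind (\<lambda>f. c * of_bool (f = ?e)) x = (\<Sum>f\<in>E. if f = ?e then of_real c * winding_number (g f) x else 0)"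
      unfolding wind_def by (rule sum.cong) auto
    then show ?thesis using e by simp
  qed
  have notin: "x \<notin> path_image (g ?e)" if "x \<notin> K" for x using that K_edge[OF e] by blast
  \<comment> \<open>The arc of the edge may run either way; if it starts at \<open>b\<close> it is
    reversed and counted with coefficient -1.\<close>
  consider "src ?e = a" "tgt ?e = b" | "src ?e = b" "tgt ?e = a"
    using en(5,6) by (metis doubleton_eq_iff)
  then show ?thesis
  proof cases
    case 1
    have "traces (g ?e) a b {?e} (\<lambda>f. 1 * of_bool (f = ?e))"
      unfolding traces_def sum w using en 1 e by (simp add: incid_def)
    then show ?thesis using arc_g[OF e] by blast
  next
    case 2
    have "traces (reversepath (g ?e)) a b {?e} (\<lambda>f. (- 1) * of_bool (f = ?e))"
      unfolding traces_def sum w using en 2 e notin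
      by (simp add: incid_def winding_number_reversepath path_g)
    then show ?thesis using arc_reversepath[OF arc_g[OF e]] by blast
  qed
qed

lemma traces_join:
  assumes 1: "traces \<gamma>1 a b S1 \<zeta>1" and 2: "traces \<gamma>2 b c S2 \<zeta>2" and "S1 \<inter> S2 = {}"
    and p: "path \<gamma>1" "path \<gamma>2"
  shows "traces (\<gamma>1 +++ \<gamma>2) a c (S1 \<union> S2) (\<lambda>e. \<zeta>1 e + \<zeta>2 e)"
proof -
  have s: "S1 \<subseteq> E" "S2 \<subseteq> E" using 1 2 by (auto simp: traces_def)
  have "x \<notin> path_image \<gamma>1" "x \<notin> path_image \<gamma>2" if "x \<notin> K" for x
    using that traces_image(3)[OF 1] traces_image(3)[OF 2] by blast+
  moreover have j: "pathfinish \<gamma>1 = pathstart \<gamma>2" using 1 2 by (simp add: traces_def)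
  ultimately have "winding_number (\<gamma>1 +++ \<gamma>2) x = winding_number \<gamma>1 x + winding_number \<gamma>2 x" if "x \<notin> K" for x
    using that p by (simp add: winding_number_join)
  moreover have "wind (\<lambda>e. \<zeta>1 e + \<zeta>2 e) x = wind \<zeta>1 x + wind \<zeta>2 x" for x
    by (simp add: wind_def distrib_right sum.distrib)
  moreover have "\<bar>\<zeta>1 e + \<zeta>2 e\<bar> = of_bool (e \<in> S1 \<union> S2)" if "e \<in> E" for e
  proof -
    have "\<bar>\<zeta>1 e\<bar> = of_bool (e \<in> S1)" "\<bar>\<zeta>2 e\<bar> = of_bool (e \<in> S2)" using 1 2 that by (auto simp: traces_def)
    then show ?thesis using assms(3) by (cases "e \<in> S1"; cases "e \<in> S2") auto
  qed
  moreover have "path_image (\<gamma>1 +++ \<gamma>2) = (\<Union>e\<in>S1 \<union> S2. path_image (g e))"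
    using 1 2 j by (simp add: path_image_join traces_def)
  ultimately show ?thesis using 1 2 s
    unfolding traces_def by (simp add: distrib_right sum.distrib)
qed

lemma traces_image_Int:
  assumes "traces \<gamma>1 a b S1 \<zeta>1" "traces \<gamma>2 c d S2 \<zeta>2"
    and "\<And>e f. e \<in> S1 \<Longrightarrow> f \<in> S2 \<Longrightarrow> e \<noteq> f \<and> e \<inter> f \<subseteq> X"
  shows "path_image \<gamma>1 \<inter> path_image \<gamma>2 \<subseteq> z ` X"
proof
  fix x assume "x \<in> path_image \<gamma>1 \<inter> path_image \<gamma>2"
  then obtain e f where ef: "e \<in> S1" "f \<in> S2" "x \<in> path_image (g e)" "x \<in> path_image (g f)" "e \<in> E" "f \<in> E"
    using traces_image(1,2)[OF assms(1)] traces_image(1,2)[OF assms(2)] by blast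
  then have "x \<in> z ` (e \<inter> f)" using cross_g[of e f] assms(3) by blast
  then show "x \<in> z ` X" using assms(3) ef by blast
qed

lemma traces_walk:
  "distinct xs \<Longrightarrow> 2 \<le> length xs \<Longrightarrow> walk_edges xs \<subseteq> E \<Longrightarrow>
     \<exists>\<gamma> \<zeta>. arc \<gamma> \<and> traces \<gamma> (hd xs) (last xs) (walk_edges xs) \<zeta>"
proof (induction xs rule: walk_edges.induct)
  case (1 x y xs)
  obtain \<gamma>1 \<zeta>1 where 1: "arc \<gamma>1" "traces \<gamma>1 x y {{x, y}} \<zeta>1" using traces_edge[of x y] "1.prems" by auto
  show ?case
  proof (cases xs)
    case Nil
    then show ?thesis using 1 by auto
  next
    case (Cons u us)
    have "\<exists>\<gamma> \<zeta>. arc \<gamma> \<and> traces \<gamma> (hd (y # xs)) (last (y # xs)) (walk_edges (y # xs)) \<zeta>"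
      using "1.prems" Cons by (intro "1.IH") auto
    then obtain \<gamma>2 \<zeta>2 where 2: "arc \<gamma>2" "traces \<gamma>2 y (last (y # xs)) (walk_edges (y # xs)) \<zeta>2" by auto
    have sub: "f \<subseteq> set (y # xs)" if "f \<in> walk_edges (y # xs)" for f using walk_edges_subset that by blast
    have x: "x \<notin> set (y # xs)" using "1.prems" by auto
    have "path_image \<gamma>1 \<inter> path_image \<gamma>2 \<subseteq> z ` {y}"
      by (rule traces_image_Int[OF 1(2) 2(2)]) (use sub x in blast)
    then have "arc (\<gamma>1 +++ \<gamma>2)" using 1 2 by (intro arc_join) (auto simp: traces_def)
    moreover have "traces (\<gamma>1 +++ \<gamma>2) x (last (y # xs)) ({{x, y}} \<union> walk_edges (y # xs)) (\<lambda>e. \<zeta>1 e + \<zeta>2 e)"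
      by (rule traces_join[OF 1(2) 2(2)]) (use sub x 1 2 in \<open>auto simp: arc_imp_path\<close>)
    ultimately have "\<exists>\<gamma> \<zeta>. arc \<gamma> \<and> traces \<gamma> x (last (y # xs)) ({{x, y}} \<union> walk_edges (y # xs)) \<zeta>" by blast
    then show ?thesis by simp
  qed
qed auto

text \<open>The arc along the walk and the arc of the closing edge meet only in their common ends,
  by planarity, and so form a simple closed curve.\<close>

lemma cycle_loop:
  assumes "is_cycle E c"
  shows "\<exists>\<gamma> \<zeta>. simple_path \<gamma> \<and> pathfinish \<gamma> = pathstart \<gamma> \<and> circ \<zeta> \<and>
    path_image \<gamma> = (\<Union>e\<in>cycle_edges c. path_image (g e)) \<and>
    (\<forall>x. x \<notin> K \<longrightarrow> winding_number \<gamma> x = wind \<zeta> x) \<and> (\<forall>e\<in>E. \<bar>\<zeta> e\<bar> = of_bool (e \<in> cycle_edges c))"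
proof -
  have c: "3 \<le> length c" "distinct c" "cycle_edges c \<subseteq> E" using assms by (auto simp: is_cycle_def)
  have "c \<noteq> []" using c by auto
  note ce = cycle_edges_walk[OF this]
  obtain \<gamma>1 \<zeta>1 where 1: "arc \<gamma>1" "traces \<gamma>1 (hd c) (last c) (walk_edges c) \<zeta>1"
    using traces_walk[of c] c ce by auto
  obtain \<gamma>2 \<zeta>2 where 2: "arc \<gamma>2" "traces \<gamma>2 (last c) (hd c) {{last c, hd c}} \<zeta>2"
    using traces_edge[of "last c" "hd c"] c ce by auto
  have n: "{last c, hd c} \<notin> walk_edges c" by (rule closing_edge_notin_walk_edges[OF c(2,1)])
  have "path_image \<gamma>1 \<inter> path_image \<gamma>2 \<subseteq> z ` {last c, hd c}"
    by (rule traces_image_Int[OF 1(2) 2(2)]) (use n in blast)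
  then have "simple_path (\<gamma>1 +++ \<gamma>2)"
    using 1 2 by (intro simple_path_join_loop) (auto simp: traces_def)
  moreover have "traces (\<gamma>1 +++ \<gamma>2) (hd c) (hd c) (walk_edges c \<union> {{last c, hd c}}) (\<lambda>e. \<zeta>1 e + \<zeta>2 e)"
    by (rule traces_join[OF 1(2) 2(2)]) (use n 1 2 in \<open>auto simp: arc_imp_path\<close>)
  ultimately show ?thesis
    by (intro exI[of _ "\<gamma>1 +++ \<gamma>2"] exI[of _ "\<lambda>e. \<zeta>1 e + \<zeta>2 e"])
      (auto simp: traces_def ce circulation_def)
qed

text \<open>The face is connected and misses the curve, so it lies on one side. That side is
  connected and meets the face but not its frontier, so it lies in the face.\<close>

lemma face_inside_or_outside:
  assumes F: "F \<in> faces V E z g" and \<gamma>: "simple_path \<gamma>" "pathfinish \<gamma> = pathstart \<gamma>"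
    and fr: "frontier F = path_image \<gamma>"
  shows "F = inside (path_image \<gamma>) \<or> F = outside (path_image \<gamma>)"
proof -
  note J = Jordan_inside_outside[OF \<gamma>]
  note Fp = face_props[OF F]
  have FC: "F \<inter> path_image \<gamma> = {}" using Fp(1) fr by (metis frontier_disjoint_eq inf_commute)
  have full: "Q \<subseteq> F" if "connected Q" "Q \<inter> path_image \<gamma> = {}" "Q \<inter> F \<noteq> {}" for Q
    using connected_Int_frontier[OF that(1), of F] that fr by auto
  let ?I = "inside (path_image \<gamma>)" and ?O = "outside (path_image \<gamma>)"
  have J': "open ?I" "open ?O" "connected ?I" "connected ?O" "?I \<inter> ?O = {}" "?I \<union> ?O = - path_image \<gamma>"
    using J by auto
  have "F \<subseteq> ?I \<union> ?O" using J'(6) FC by auto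
  moreover have "?I \<inter> F = {} \<or> ?O \<inter> F = {}"
    by (rule connectedD[OF Fp(2) J'(1,2)]) (use J'(5,6) FC in auto)
  ultimately have "F \<subseteq> ?I \<or> F \<subseteq> ?O" by blast
  then show ?thesis
  proof
    assume 1: "F \<subseteq> ?I"
    then have "?I \<subseteq> F" using J'(3) Fp(3) by (intro full) (auto simp: inside_no_overlap)
    then show ?thesis using 1 by simp
  next
    assume 2: "F \<subseteq> ?O"
    then have "?O \<subseteq> F" using J'(4) Fp(3) by (intro full) (auto simp: outside_no_overlap)
    then show ?thesis using 2 by simp
  qed
qed

text \<open>The winding number of the bordering curve is 1 or -1 inside and 0 outside. Up to a sign
  it is the indicator of the face minus a constant: \<open>k = 0\<close> for a face inside its
  border, \<open>k = 1\<close> for one outside.\<close>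

lemma face_circulation:
  assumes F: "F \<in> faces V E z g" and bd: "bordered_by E g F c"
  shows "\<exists>\<zeta> \<epsilon> k. circ \<zeta> \<and> (\<forall>e\<in>E. \<bar>\<zeta> e\<bar> = of_bool (e \<in> cycle_edges c)) \<and> \<epsilon> \<in> {1, -1 :: real} \<and>
    (\<forall>x. x \<notin> K \<longrightarrow> wind \<zeta> x = of_real (\<epsilon> * (of_bool (x \<in> F) - k)))"
proof -
  have c: "is_cycle E c" "frontier F = (\<Union>e\<in>cycle_edges c. path_image (g e))"
    using bd by (auto simp: bordered_by_def)
  from cycle_loop[OF c(1)] obtain \<gamma> \<zeta> where \<gamma>: "simple_path \<gamma>" "pathfinish \<gamma> = pathstart \<gamma>"
    and \<zeta>: "circ \<zeta>" "\<forall>e\<in>E. \<bar>\<zeta> e\<bar> = of_bool (e \<in> cycle_edges c)"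
    and im: "path_image \<gamma> = (\<Union>e\<in>cycle_edges c. path_image (g e))"
    and w: "\<And>x. x \<notin> K \<Longrightarrow> wind \<zeta> x = winding_number \<gamma> x" by auto
  note J = Jordan_inside_outside[OF \<gamma>]
  have out: "winding_number \<gamma> x = 0" if "x \<in> outside (path_image \<gamma>)" for x
    using winding_number_zero_in_outside[OF simple_path_imp_path[OF \<gamma>(1)] \<gamma>(2) that] .
  obtain s :: real where s: "s \<in> {1, -1}" "\<And>x. x \<in> inside (path_image \<gamma>) \<Longrightarrow> winding_number \<gamma> x = of_real s"
    by (rule simple_closed_path_winding_number_inside[OF \<gamma>(1)])
      (metis insertCI of_real_1 of_real_minus)+
  have cS: "path_image \<gamma> \<subseteq> K" using c(1) im K_edge by (auto simp: is_cycle_def)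
  have io: "x \<in> inside (path_image \<gamma>) \<longleftrightarrow> x \<notin> outside (path_image \<gamma>)" if "x \<notin> K" for x
    using J that cS by blast
  from face_inside_or_outside[OF F \<gamma>] c(2) im have "F = inside (path_image \<gamma>) \<or> F = outside (path_image \<gamma>)" by simp
  then show ?thesis
  proof
    assume "F = inside (path_image \<gamma>)"
    then have "\<forall>x. x \<notin> K \<longrightarrow> wind \<zeta> x = of_real (s * (of_bool (x \<in> F) - 0))"
      using w s(2) out io by auto
    then show ?thesis using \<zeta> s(1) by blast
  next
    assume "F = outside (path_image \<gamma>)"
    then have "\<forall>x. x \<notin> K \<longrightarrow> wind \<zeta> x = of_real (- s * (of_bool (x \<in> F) - 1))"
      using w s(2) out io by auto
    then show ?thesis using \<zeta> s(1) by (intro exI[of _ \<zeta>] exI[of _ "- s"] exI[of _ 1]) auto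
  qed
qed

text \<open>A face is the inside or the outside of the union of a set of edges, and there are
  finitely many such sets.\<close>

lemma finite_faces: "finite (faces V E z g)"
proof (rule finite_subset)
  let ?U = "\<lambda>S. \<Union>e\<in>S. path_image (g e)"
  show "faces V E z g \<subseteq> (\<lambda>S. inside (?U S)) ` UNIV \<union> (\<lambda>S. outside (?U S)) ` UNIV"
  proof
    fix F assume F: "F \<in> faces V E z g"
    then obtain c where c: "is_cycle E c" "frontier F = ?U (cycle_edges c)"
      using face_cycle[OF F] unfolding bordered_by_def by blast
    from cycle_loop[OF c(1)] obtain \<gamma> where "simple_path \<gamma>" "pathfinish \<gamma> = pathstart \<gamma>"
      "path_image \<gamma> = ?U (cycle_edges c)" by auto
    from face_inside_or_outside[OF F this(1,2)] this(3) c(2) have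
      "F = inside (?U (cycle_edges c)) \<or> F = outside (?U (cycle_edges c))" by simp
    then show "F \<in> (\<lambda>S. inside (?U S)) ` UNIV \<union> (\<lambda>S. outside (?U S)) ` UNIV" by blast
  qed
qed simp

section \<open>The two sides of an edge\<close>

text \<open>A point that identifies its edge, and near which the drawing consists of this edge
  alone; the parameter 1/2 is an arbitrary interior one.\<close>

lemma edge_midpoint:
  assumes e: "e \<in> E"
  shows "\<exists>x r. r > 0 \<and> x \<in> path_image (g e) \<and> ball x r \<inter> K \<subseteq> path_image (g e) \<and>
    (\<forall>f\<in>E. x \<in> path_image (g f) \<longrightarrow> f = e)"
proof -
  let ?x = "g e (1 / 2)"
  let ?K' = "z ` V \<union> (\<Union>f\<in>E - {e}. path_image (g f))"
  have x: "?x \<in> path_image (g e)" by (auto simp: path_image_def)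
  have "inj_on (g e) {0..1}" using arc_g[OF e] by (simp add: arc_def)
  then have "?x \<noteq> pathstart (g e)" "?x \<noteq> pathfinish (g e)"
    using inj_onD[of "g e" "{0..1}" "1 / 2" 0] inj_onD[of "g e" "{0..1}" "1 / 2" 1]
    by (auto simp: pathstart_def pathfinish_def)
  then have "?x \<notin> z ` e" using ends_g[OF e] by blast
  then have xV: "?x \<notin> z ` V" using verts_g[OF e] x by blast
  have xf: "?x \<notin> path_image (g f)" if "f \<in> E - {e}" for f
  proof
    assume "?x \<in> path_image (g f)"
    then have "?x \<in> z ` (e \<inter> f)" using cross_g[OF e, of f] that x by blast
    then show False using xV edge_sub[OF e] by blast
  qed
  have "closed ?K'" by (intro closed_Un closed_UN ballI) (auto intro: finite_imp_closed closed_path_image path_g)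
  moreover have "?x \<notin> ?K'" using xV xf by blast
  ultimately obtain r where r: "r > 0" "ball ?x r \<subseteq> - ?K'" by (meson ComplI open_Compl open_contains_ball)
  then have "ball ?x r \<inter> K \<subseteq> path_image (g e)" by (auto simp: K_def)
  then show ?thesis using r x xf by blast
qed

lemma in_closure_face_part:
  assumes "x \<in> closure (\<Union>F\<in>faces V E z g. A \<inter> F)"
  shows "\<exists>F\<in>faces V E z g. x \<in> closure (A \<inter> F)"
proof -
  have "closed (\<Union>F\<in>faces V E z g. closure (A \<inter> F))"
    by (intro closed_UN finite_faces) simp
  moreover have "(\<Union>F\<in>faces V E z g. A \<inter> F) \<subseteq> (\<Union>F\<in>faces V E z g. closure (A \<inter> F))"
    by (intro UN_mono order_refl closure_subset)
  ultimately have "closure (\<Union>F\<in>faces V E z g. A \<inter> F) \<subseteq> (\<Union>F\<in>faces V E z g. closure (A \<inter> F))"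
    by (metis closure_minimal)
  then show ?thesis using assms by blast
qed

text \<open>Arcs have empty interior, so the midpoint is a limit of face points and, there being
  finitely many faces, lies on the frontier of one. The bordering cycle must use the only edge
  through it.\<close>

lemma edge_on_face_cycle:
  assumes e: "e \<in> E"
  shows "\<exists>F\<in>faces V E z g. \<exists>c. bordered_by E g F c \<and> e \<in> cycle_edges c"
proof -
  obtain x r where r: "r > 0" and x: "x \<in> path_image (g e)" and ball: "ball x r \<inter> K \<subseteq> path_image (g e)"
    and uniq: "\<And>f. f \<in> E \<Longrightarrow> x \<in> path_image (g f) \<Longrightarrow> f = e" using edge_midpoint[OF e] by blast
  have "x \<in> closure (- K)"
  proof (rule ccontr)
    assume "x \<notin> closure (- K)"
    then have "x \<in> interior K" by (simp add: closure_complement)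
    then have "x \<in> interior K \<inter> ball x r" using r by simp
    moreover have "open (interior K \<inter> ball x r)" by auto
    moreover have "interior K \<inter> ball x r \<subseteq> path_image (g e)" using ball interior_subset by blast
    ultimately have "x \<in> interior (path_image (g e))" by (meson interior_maximal subsetD)
    then show False using interior_arc_image[OF arc_g[OF e]] by simp
  qed
  then have "x \<in> closure (\<Union>F\<in>faces V E z g. UNIV \<inter> F)" using Union_faces by simp
  then obtain F where F: "F \<in> faces V E z g" "x \<in> closure F" using in_closure_face_part[of x UNIV] by auto
  have "x \<in> K" using x K_edge[OF e] by blast
  then have "x \<in> frontier F" using F face_props(1,4)[OF F(1)] by (auto simp: frontier_def interior_open)
  obtain c where c: "bordered_by E g F c" using face_cycle[OF F(1)] by blast
  then obtain f where f: "f \<in> cycle_edges c" "x \<in> path_image (g f)" using \<open>x \<in> frontier F\<close>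
    by (auto simp: bordered_by_def)
  then have "f = e" using uniq c by (auto simp: bordered_by_def is_cycle_def)
  then show ?thesis using F c f by blast
qed

text \<open>A cycle through \<open>e\<close> gives a Jordan curve whose inside and outside both
  accumulate at a point \<open>p\<close> of \<open>e\<close>. Along sequences from both sides the
  other arcs contribute no jump in the limit, so the known jump of the curve determines that of
  \<open>g e\<close>, and with it the jump of every circulation.\<close>

lemma edge_sides:
  assumes e: "e \<in> E"
  shows "\<exists>L\<in>faces V E z g. \<exists>R\<in>faces V E z g.
    \<forall>\<zeta> x y. circ \<zeta> \<longrightarrow> x \<in> L \<longrightarrow> y \<in> R \<longrightarrow> wind \<zeta> x - wind \<zeta> y = of_real (\<zeta> e)"
proof -
  obtain p r where r: "r > 0" and p: "p \<in> path_image (g e)" and ball: "ball p r \<inter> K \<subseteq> path_image (g e)"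
    and uniq: "\<And>f. f \<in> E \<Longrightarrow> p \<in> path_image (g f) \<Longrightarrow> f = e" using edge_midpoint[OF e] by blast
  obtain c where c: "is_cycle E c" "e \<in> cycle_edges c"
    using edge_on_face_cycle[OF e] by (auto simp: bordered_by_def)
  from cycle_loop[OF c(1)] obtain \<gamma> \<zeta>0 where \<gamma>: "simple_path \<gamma>" "pathfinish \<gamma> = pathstart \<gamma>"
    and \<zeta>0: "circ \<zeta>0" "\<bar>\<zeta>0 e\<bar> = 1"
    and im: "path_image \<gamma> = (\<Union>e\<in>cycle_edges c. path_image (g e))"
    and w: "\<And>x. x \<notin> K \<Longrightarrow> wind \<zeta>0 x = winding_number \<gamma> x" using e c(2) by auto
  note J = Jordan_inside_outside[OF \<gamma>]
  obtain s :: real where s: "s \<in> {1, -1}" "\<And>x. x \<in> inside (path_image \<gamma>) \<Longrightarrow> winding_number \<gamma> x = of_real s"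
    by (rule simple_closed_path_winding_number_inside[OF \<gamma>(1)])
      (metis insertCI of_real_1 of_real_minus)+
  have p\<gamma>: "p \<in> path_image \<gamma>" using im c(2) p by blast
  \<comment> \<open>Near \<open>p\<close>, points off the curve are off the whole drawing;
    finiteness of the faces lets one face be chosen that still accumulates at
    \<open>p\<close>.\<close>
  have side: "\<exists>F\<in>faces V E z g. p \<in> closure (A \<inter> F)"
    if A: "p \<in> closure A" "A \<inter> path_image \<gamma> = {}" for A
  proof (rule in_closure_face_part)
    have "p \<in> closure (ball p r \<inter> A)"
      using open_Int_closure_subset[of "ball p r" A] A r by auto
    moreover have "ball p r \<inter> A \<subseteq> (\<Union>F\<in>faces V E z g. A \<inter> F)"
    proof
      fix x assume x: "x \<in> ball p r \<inter> A"
      then have "x \<notin> K" using ball A(2) im c(2) by blast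
      then show "x \<in> (\<Union>F\<in>faces V E z g. A \<inter> F)" using x Union_faces by blast
    qed
    ultimately show "p \<in> closure (\<Union>F\<in>faces V E z g. A \<inter> F)" using closure_mono by blast
  qed
  have "p \<in> closure (inside (path_image \<gamma>))" "p \<in> closure (outside (path_image \<gamma>))"
    using p\<gamma> J by (auto simp: frontier_def)
  then obtain L R where L: "L \<in> faces V E z g" "p \<in> closure (inside (path_image \<gamma>) \<inter> L)"
    and R: "R \<in> faces V E z g" "p \<in> closure (outside (path_image \<gamma>) \<inter> R)"
    using side[of "inside (path_image \<gamma>)"] side[of "outside (path_image \<gamma>)"]
      inside_no_overlap[of "path_image \<gamma>"] outside_no_overlap[of "path_image \<gamma>"] by blast
  obtain X where X: "\<And>n. X n \<in> inside (path_image \<gamma>) \<inter> L" "X \<longlonglongrightarrow> p"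
    using L(2) unfolding closure_sequential by blast
  obtain Y where Y: "\<And>n. Y n \<in> outside (path_image \<gamma>) \<inter> R" "Y \<longlonglongrightarrow> p"
    using R(2) unfolding closure_sequential by blast
  have XK: "X n \<notin> K" "Y n \<notin> K" for n using X(1)[of n] Y(1)[of n] face_props(4)[OF L(1)] face_props(4)[OF R(1)] by blast+
  define D where "D f n = winding_number (g f) (X n) - winding_number (g f) (Y n)" for f n
  have D0: "D f \<longlonglongrightarrow> 0" if f: "f \<in> E - {e}" for f
  proof -
    have "p \<notin> path_image (g f)" using uniq f by blast
    then have cont: "isCont (winding_number (g f)) p" using f by (intro continuous_at_winding_number path_g) auto
    have "(\<lambda>n. winding_number (g f) (X n) - winding_number (g f) (Y n))
      \<longlonglongrightarrow> winding_number (g f) p - winding_number (g f) p"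
      by (intro tendsto_diff isCont_tendsto_compose[OF cont] X Y)
    then show ?thesis by (simp add: D_def[abs_def])
  qed
  have wD: "wind \<zeta> (X n) - wind \<zeta> (Y n) = of_real (\<zeta> e) * D e n + (\<Sum>f\<in>E - {e}. of_real (\<zeta> f) * D f n)" for \<zeta> n
  proof -
    have "wind \<zeta> (X n) - wind \<zeta> (Y n) = (\<Sum>f\<in>E. of_real (\<zeta> f) * D f n)"
      by (simp add: wind_def D_def right_diff_distrib sum_subtractf)
    then show ?thesis using e by (simp add: sum.remove)
  qed
  have rest: "(\<lambda>n. \<Sum>f\<in>E - {e}. of_real (\<zeta> f) * D f n) \<longlonglongrightarrow> 0" for \<zeta>
    by (rule tendsto_null_sum) (rule tendsto_mult_right_zero[OF D0])
  have "wind \<zeta>0 (X n) - wind \<zeta>0 (Y n) = of_real s" for n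
    using w XK s(2) X(1)[of n] Y(1)[of n]
      winding_number_zero_in_outside[OF simple_path_imp_path[OF \<gamma>(1)] \<gamma>(2)] by auto
  then have "of_real (\<zeta>0 e) * D e n = of_real s - (\<Sum>f\<in>E - {e}. of_real (\<zeta>0 f) * D f n)" for n
    using wD[of \<zeta>0 n] by simp
  \<comment> \<open>Multiplication by \<open>\<zeta>0 e\<close>, whose square is 1, solves for the
    jump of the arc.\<close>
  then have "(\<lambda>n. of_real (\<zeta>0 e) * (of_real (\<zeta>0 e) * D e n)) \<longlonglongrightarrow> of_real (\<zeta>0 e) * (of_real s - 0)"
    by (simp only:) (intro tendsto_intros rest)
  moreover have "\<zeta>0 e * \<zeta>0 e = 1" using \<zeta>0(2) by (metis abs_mult_self_eq mult_1)
  then have "complex_of_real (\<zeta>0 e) * (of_real (\<zeta>0 e) * x) = x" for x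
    by (metis mult.assoc mult_1 of_real_1 of_real_mult)
  ultimately have De: "D e \<longlonglongrightarrow> of_real (\<zeta>0 e * s)" by simp
  have jump: "wind \<zeta> x - wind \<zeta> y = of_real (\<zeta> e * (\<zeta>0 e * s))" if "circ \<zeta>" "x \<in> L" "y \<in> R" for \<zeta> x y
  proof -
    have "wind \<zeta> x - wind \<zeta> y = of_real (\<zeta> e) * D e n + (\<Sum>f\<in>E - {e}. of_real (\<zeta> f) * D f n)" for n
      using wind_constant[OF that(1) L(1) that(2), of "X n"] wind_constant[OF that(1) R(1) that(3), of "Y n"]
        X(1)[of n] Y(1)[of n] wD[of \<zeta> n] by simp
    moreover have "(\<lambda>n. of_real (\<zeta> e) * D e n + (\<Sum>f\<in>E - {e}. of_real (\<zeta> f) * D f n))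
        \<longlonglongrightarrow> of_real (\<zeta> e) * of_real (\<zeta>0 e * s) + 0"
      by (intro tendsto_intros De rest)
    ultimately have "(\<lambda>n::nat. wind \<zeta> x - wind \<zeta> y) \<longlonglongrightarrow> of_real (\<zeta> e) * of_real (\<zeta>0 e * s) + 0" by simp
    then show ?thesis using LIMSEQ_unique[OF tendsto_const] by auto
  qed
  \<comment> \<open>The sign records whether the orientation of \<open>e\<close> has the inside on
    its left; if not, the two faces are exchanged.\<close>
  have "\<zeta>0 e * s = 1 \<or> \<zeta>0 e * s = -1" using \<zeta>0(2) s(1) by auto
  then show ?thesis
  proof
    assume *: "\<zeta>0 e * s = 1"
    have "wind \<zeta> x - wind \<zeta> y = of_real (\<zeta> e)" if "circ \<zeta>" "x \<in> L" "y \<in> R" for \<zeta> x y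
      using jump[OF that] * by simp
    then show ?thesis using L(1) R(1) by blast
  next
    assume *: "\<zeta>0 e * s = -1"
    have "wind \<zeta> y - wind \<zeta> x = of_real (\<zeta> e)" if "circ \<zeta>" "x \<in> L" "y \<in> R" for \<zeta> x y
      using arg_cong[OF jump[OF that], of uminus] unfolding minus_diff_eq * by simp
    then show ?thesis using L(1) R(1) by blast
  qed
qed

section \<open>The faces as an abstract dual\<close>

definition cyc where "cyc F = (SOME c. bordered_by E g F c)"

lemma cyc: "F \<in> faces V E z g \<Longrightarrow> bordered_by E g F (cyc F)"
  unfolding cyc_def by (rule someI_ex) (rule face_cycle)

text \<open>The midpoint of an edge lies on no other edge, so the frontier determines its edges.
  Hence the length of a bordering cycle is well defined.\<close>

lemma bordered_by_unique:
  assumes "bordered_by E g F c" "bordered_by E g F c'"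
  shows "cycle_edges c = cycle_edges c'"
proof -
  have "cycle_edges c \<subseteq> cycle_edges c'" if c: "bordered_by E g F c" and c': "bordered_by E g F c'" for c c'
  proof
    fix e assume e: "e \<in> cycle_edges c"
    then have eE: "e \<in> E" using c by (auto simp: bordered_by_def is_cycle_def)
    obtain x where x: "x \<in> path_image (g e)" "\<And>f. f \<in> E \<Longrightarrow> x \<in> path_image (g f) \<Longrightarrow> f = e"
      using edge_midpoint[OF eE] by blast
    have "x \<in> frontier F" using c e x by (auto simp: bordered_by_def)
    then obtain f where f: "f \<in> cycle_edges c'" "x \<in> path_image (g f)" using c' by (auto simp: bordered_by_def)
    then have "f = e" using x(2) c' by (auto simp: bordered_by_def is_cycle_def)
    then show "e \<in> cycle_edges c'" using f by simp
  qed
  then show ?thesis using assms by blast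
qed

text \<open>All that is kept of the local picture at \<open>e\<close> is the jump that circulations
  make from \<open>R\<close> to \<open>L\<close>.\<close>

definition separates :: "'v set \<Rightarrow> complex set \<Rightarrow> complex set \<Rightarrow> bool" where
  "separates e L R \<longleftrightarrow> L \<in> faces V E z g \<and> R \<in> faces V E z g \<and>
    (\<forall>\<zeta> x y. circ \<zeta> \<longrightarrow> x \<in> L \<longrightarrow> y \<in> R \<longrightarrow> wind \<zeta> x - wind \<zeta> y = of_real (\<zeta> e))"

definition sides where "sides e = (SOME s. separates e (fst s) (snd s))"

abbreviation "left e \<equiv> fst (sides e)"
abbreviation "right e \<equiv> snd (sides e)"

lemma sides:
  assumes "e \<in> E"
  shows "left e \<in> faces V E z g" "right e \<in> faces V E z g"
    "circ \<zeta> \<Longrightarrow> x \<in> left e \<Longrightarrow> y \<in> right e \<Longrightarrow> wind \<zeta> x - wind \<zeta> y = of_real (\<zeta> e)"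
proof -
  obtain L R where "separates e L R" using edge_sides[OF assms] unfolding separates_def by blast
  then have "separates e (fst (L, R)) (snd (L, R))" by simp
  then have "separates e (left e) (right e)" unfolding sides_def by (rule someI)
  then show "left e \<in> faces V E z g" "right e \<in> faces V E z g"
    "circ \<zeta> \<Longrightarrow> x \<in> left e \<Longrightarrow> y \<in> right e \<Longrightarrow> wind \<zeta> x - wind \<zeta> y = of_real (\<zeta> e)"
    unfolding separates_def by blast+
qed

definition face_point :: "complex set \<Rightarrow> complex" where "face_point F = (SOME x. x \<in> F)"

lemma face_point: "F \<in> faces V E z g \<Longrightarrow> face_point F \<in> F"
  unfolding face_point_def using face_props(3) by (simp add: some_in_eq)

lemma face_point_mem_iff:
  "F \<in> faces V E z g \<Longrightarrow> F' \<in> faces V E z g \<Longrightarrow> face_point F \<in> F' \<longleftrightarrow> F = F'"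
  using face_point faces_disjoint by blast

lemma face_point_notin_K: "F \<in> faces V E z g \<Longrightarrow> face_point F \<notin> K"
  using face_point face_props(4) by blast

text \<open>Comparing the jump of \<open>wind\<close> across an edge with that of the indicator of
  \<open>F\<close> shows that the bordering circulation is, up to the sign
  \<open>\<epsilon> F\<close>, the star of \<open>F\<close> in the dual. The constant
  \<open>k F\<close> cancels in the difference.\<close>

lemma face_circulations:
  "\<exists>Z \<epsilon> k. \<forall>F\<in>faces V E z g. circ (Z F) \<and> \<epsilon> F \<in> {1, -1 :: real} \<and>
    (\<forall>e\<in>E. \<bar>Z F e\<bar> = of_bool (e \<in> cycle_edges (cyc F))) \<and>
    (\<forall>x. x \<notin> K \<longrightarrow> wind (Z F) x = of_real (\<epsilon> F * (of_bool (x \<in> F) - k F))) \<and>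
    (\<forall>e\<in>E. Z F e = \<epsilon> F * (of_bool (left e = F) - of_bool (right e = F)))"
proof -
  have "\<exists>\<zeta> \<epsilon> k. circ \<zeta> \<and> \<epsilon> \<in> {1, -1 :: real} \<and>
    (\<forall>e\<in>E. \<bar>\<zeta> e\<bar> = of_bool (e \<in> cycle_edges (cyc F))) \<and>
    (\<forall>x. x \<notin> K \<longrightarrow> wind \<zeta> x = of_real (\<epsilon> * (of_bool (x \<in> F) - k))) \<and>
    (\<forall>e\<in>E. \<zeta> e = \<epsilon> * (of_bool (left e = F) - of_bool (right e = F)))"
    if F: "F \<in> faces V E z g" for F
  proof -
    obtain \<zeta> \<epsilon> k where \<zeta>: "circ \<zeta>" "\<forall>e\<in>E. \<bar>\<zeta> e\<bar> = of_bool (e \<in> cycle_edges (cyc F))" "\<epsilon> \<in> {1, -1 :: real}"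
      and w: "\<And>x. x \<notin> K \<Longrightarrow> wind \<zeta> x = of_real (\<epsilon> * (of_bool (x \<in> F) - k))"
      using face_circulation[OF F cyc[OF F]] by blast
    have "\<zeta> e = \<epsilon> * (of_bool (left e = F) - of_bool (right e = F))" if e: "e \<in> E" for e
    proof -
      note s = sides(1,2)[OF e]
      have "of_real (\<zeta> e) = wind \<zeta> (face_point (left e)) - wind \<zeta> (face_point (right e))"
        using sides(3)[OF e \<zeta>(1) face_point[OF s(1)] face_point[OF s(2)]] by simp
      also have "\<dots> = of_real (\<epsilon> * (of_bool (left e = F) - of_bool (right e = F)))"
        by (simp add: w face_point_notin_K s face_point_mem_iff F algebra_simps)
      finally show ?thesis by (simp only: of_real_eq_iff)
    qed
    then show ?thesis using \<zeta> w by blast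
  qed
  then show ?thesis by metis
qed

lemma sum_face_indicator:
  assumes "G \<in> faces V E z g"
  shows "(\<Sum>F\<in>faces V E z g. \<phi> F * of_bool (G = F)) = (\<phi> G :: real)"
proof -
  have "(\<Sum>F\<in>faces V E z g. \<phi> F * of_bool (G = F)) = (\<Sum>F\<in>faces V E z g. if F = G then \<phi> F else 0)"
    by (rule sum.cong) auto
  then show ?thesis using assms finite_faces by simp
qed

text \<open>For the converse, a potential \<phi> is expanded in face indicators; each indicator
  gives a bordering circulation, with coefficient \<open>\<phi> F * \<epsilon> F\<close>.\<close>

theorem dual_pair_faces: "dual_pair E src tgt left right"
  unfolding dual_pair_def
proof (intro allI iffI)
  fix \<zeta> assume c: "circ \<zeta>"
  show "\<exists>\<phi>. \<forall>e\<in>E. \<zeta> e = \<phi> (left e) - \<phi> (right e)"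
  proof (intro exI ballI)
    fix e assume e: "e \<in> E"
    have "wind \<zeta> (face_point (left e)) - wind \<zeta> (face_point (right e)) = of_real (\<zeta> e)"
      by (rule sides(3)[OF e c]) (use sides(1,2)[OF e] face_point in auto)
    from arg_cong[OF this, of Re]
    show "\<zeta> e = Re (wind \<zeta> (face_point (left e))) - Re (wind \<zeta> (face_point (right e)))" by simp
  qed
next
  fix \<zeta> :: "'v set \<Rightarrow> real" assume "\<exists>\<phi>. \<forall>e\<in>E. \<zeta> e = \<phi> (left e) - \<phi> (right e)"
  then obtain \<phi> where \<phi>: "\<forall>e\<in>E. \<zeta> e = \<phi> (left e) - \<phi> (right e)" by blast
  obtain Z \<epsilon> where Z: "\<And>F. F \<in> faces V E z g \<Longrightarrow> circ (Z F)" "\<And>F. F \<in> faces V E z g \<Longrightarrow> \<epsilon> F \<in> {1, -1 :: real}"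
    "\<And>F e. F \<in> faces V E z g \<Longrightarrow> e \<in> E \<Longrightarrow> Z F e = \<epsilon> F * (of_bool (left e = F) - of_bool (right e = F))"
    using face_circulations by blast
  have \<zeta>: "\<zeta> e = (\<Sum>F\<in>faces V E z g. \<phi> F * \<epsilon> F * Z F e)" if e: "e \<in> E" for e
  proof -
    have "\<phi> F * \<epsilon> F * Z F e = \<phi> F * of_bool (left e = F) - \<phi> F * of_bool (right e = F)"
      if F: "F \<in> faces V E z g" for F
    proof -
      have "\<epsilon> F * \<epsilon> F = 1" using Z(2)[OF F] by auto
      then have "\<phi> F * \<epsilon> F * (\<epsilon> F * x) = \<phi> F * x" for x by (metis mult.assoc mult_1)
      then show ?thesis by (simp only: Z(3)[OF F e] right_diff_distrib)
    qed
    then show ?thesis using \<phi> e sides(1,2)[OF e] by (simp add: sum_subtractf sum_face_indicator)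
  qed
  have "(\<Sum>e\<in>E. \<zeta> e * incid src tgt e x) = 0" for x
  proof -
    have "(\<Sum>e\<in>E. \<zeta> e * incid src tgt e x) = (\<Sum>e\<in>E. \<Sum>F\<in>faces V E z g. \<phi> F * \<epsilon> F * (Z F e * incid src tgt e x))"
      by (simp add: \<zeta> sum_distrib_right mult.assoc)
    also have "\<dots> = (\<Sum>F\<in>faces V E z g. \<phi> F * \<epsilon> F * (\<Sum>e\<in>E. Z F e * incid src tgt e x))"
      by (subst sum.swap) (simp add: sum_distrib_left)
    also have "\<dots> = 0" using Z(1) by (simp add: circulation_def)
    finally show ?thesis .
  qed
  then show "circ \<zeta>" by (simp add: circulation_def)
qed

section \<open>Connectedness, Euler's formula and face lengths\<close>

text \<open>The combination of bordering circulations with coefficients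
  \<open>\<phi> F * \<epsilon> F\<close> vanishes on every edge, so its winding number is 0
  everywhere. Evaluated in a face \<open>G\<close>, this says that \<open>\<phi> G\<close> equals a
  sum independent of \<open>G\<close>.\<close>

lemma faces_connected:
  assumes eq: "\<forall>e\<in>E. \<phi> (left e) = (\<phi> (right e) :: real)" and F: "F \<in> faces V E z g" "F' \<in> faces V E z g"
  shows "\<phi> F = \<phi> F'"
proof -
  obtain Z \<epsilon> k where Z: "\<And>F. F \<in> faces V E z g \<Longrightarrow> \<epsilon> F \<in> {1, -1 :: real}"
    "\<And>F x. F \<in> faces V E z g \<Longrightarrow> x \<notin> K \<Longrightarrow> wind (Z F) x = of_real (\<epsilon> F * (of_bool (x \<in> F) - k F))"
    "\<And>F e. F \<in> faces V E z g \<Longrightarrow> e \<in> E \<Longrightarrow> Z F e = \<epsilon> F * (of_bool (left e = F) - of_bool (right e = F))"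
    using face_circulations by blast
  have "(\<Sum>F\<in>faces V E z g. \<phi> F * \<epsilon> F * Z F e) = 0" if e: "e \<in> E" for e
  proof -
    have "\<phi> F * \<epsilon> F * Z F e = \<phi> F * of_bool (left e = F) - \<phi> F * of_bool (right e = F)"
      if F: "F \<in> faces V E z g" for F
    proof -
      have "\<epsilon> F * \<epsilon> F = 1" using Z(1)[OF F] by auto
      then have "\<phi> F * \<epsilon> F * (\<epsilon> F * x) = \<phi> F * x" for x by (metis mult.assoc mult_1)
      then show ?thesis by (simp only: Z(3)[OF F e] right_diff_distrib)
    qed
    then show ?thesis using eq e sides(1,2)[OF e] by (simp add: sum_subtractf sum_face_indicator)
  qed
  then have "wind (\<lambda>e. \<Sum>F\<in>faces V E z g. \<phi> F * \<epsilon> F * Z F e) = wind (\<lambda>_. 0)" by (rule wind_cong)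
  then have w0: "(\<Sum>F\<in>faces V E z g. of_real (\<phi> F * \<epsilon> F) * wind (Z F) x) = 0" for x
    unfolding wind_sum[symmetric] by (simp add: wind_def)
  have "\<phi> G = (\<Sum>F\<in>faces V E z g. \<phi> F * k F)" if G: "G \<in> faces V E z g" for G
  proof -
    have "of_real (\<phi> F * \<epsilon> F) * wind (Z F) (face_point G) = complex_of_real (\<phi> F * of_bool (G = F) - \<phi> F * k F)"
      if F: "F \<in> faces V E z g" for F
    proof -
      have "\<epsilon> F * \<epsilon> F = 1" using Z(1)[OF F] by auto
      then have "\<phi> F * \<epsilon> F * (\<epsilon> F * x) = \<phi> F * x" for x by (metis mult.assoc mult_1)
      then show ?thesis
        by (simp only: Z(2)[OF F face_point_notin_K[OF G]] face_point_mem_iff[OF G F] right_diff_distrib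
            of_real_mult[symmetric])
    qed
    then have "complex_of_real (\<Sum>F\<in>faces V E z g. \<phi> F * of_bool (G = F) - \<phi> F * k F) = 0"
      using w0[of "face_point G"] by (simp only: of_real_sum cong: sum.cong)
    then have "(\<Sum>F\<in>faces V E z g. \<phi> F * of_bool (G = F) - \<phi> F * k F) = 0" by (simp only: of_real_eq_0_iff)
    then show ?thesis by (simp add: sum_subtractf sum_face_indicator[OF G])
  qed
  then show ?thesis using F by metis
qed

text \<open>If the graph split into two parts, each face frontier, being a connected Jordan curve,
  would belong to one part. Each part together with its faces would be closed, and the plane would
  be a disjoint union of two nonempty closed sets.\<close>

lemma vertices_connected:
  assumes eq: "\<forall>e\<in>E. \<phi> (src e) = (\<phi> (tgt e) :: real)" and x: "x \<in> V" "y \<in> V"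
  shows "\<phi> x = \<phi> y"
proof (rule ccontr)
  assume ne: "\<phi> x \<noteq> \<phi> y"
  define part where "part A = z ` A \<union> (\<Union>e\<in>{e\<in>E. e \<subseteq> A}. path_image (g e))" for A
  define side where "side A = part A \<union> (\<Union>F\<in>{F\<in>faces V E z g. frontier F \<subseteq> part A}. F)" for A
  define A where "A = {v\<in>V. \<phi> v = \<phi> x}"
  define B where "B = {v\<in>V. \<phi> v \<noteq> \<phi> x}"
  have AB: "A \<subseteq> V" "B \<subseteq> V" "A \<inter> B = {}" "A \<union> B = V" by (auto simp: A_def B_def)
  have edge: "e \<subseteq> A \<or> e \<subseteq> B" if e: "e \<in> E" for e
  proof -
    have "e = {src e, tgt e}" "src e \<in> V" "tgt e \<in> V" using edge_ends[OF e] by blast+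
    moreover have "\<phi> (src e) = \<phi> (tgt e)" using eq e by blast
    ultimately show ?thesis unfolding A_def B_def
      by (metis (mono_tags, lifting) empty_subsetI insert_subset mem_Collect_eq)
  qed
  have clp: "closed (part C)" for C
    unfolding part_def by (intro closed_Un closed_UN ballI) (auto intro: finite_imp_closed closed_path_image path_g)
  \<comment> \<open>The frontiers of the faces in \<open>side C\<close> lie in
    \<open>part C\<close>, so these finitely many faces may be replaced by their closures.\<close>
  have cls: "closed (side C)" for C
  proof -
    have "side C = part C \<union> (\<Union>F\<in>{F\<in>faces V E z g. frontier F \<subseteq> part C}. closure F)"
      unfolding side_def by (auto simp: closure_Un_frontier)
    then show ?thesis using finite_faces by (auto intro!: closed_Un clp closed_UN)
  qed
  have K: "K = part A \<union> part B"
  proof -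
    have "(\<Union>e\<in>E. path_image (g e)) = (\<Union>e\<in>{e\<in>E. e \<subseteq> A}. path_image (g e)) \<union> (\<Union>e\<in>{e\<in>E. e \<subseteq> B}. path_image (g e))"
      using edge by blast
    moreover have "z ` V = z ` A \<union> z ` B" using AB(4) by blast
    ultimately show ?thesis unfolding K_def part_def by (simp only: Un_ac)
  qed
  have dis: "part A \<inter> part B = {}"
  proof -
    have 1: "z ` A \<inter> z ` B = {}" using inj_on_image_Int[OF inj_z AB(1,2)] AB(3) by simp
    have 2: "path_image (g e) \<inter> z ` D = {}" if "e \<in> E" "e \<subseteq> C" "C \<inter> D = {}" "C \<subseteq> V" "D \<subseteq> V" for e C D
    proof -
      have "path_image (g e) \<inter> z ` D \<subseteq> z ` e" using verts_g[OF that(1)] that(5) by blast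
      moreover have "z ` e \<inter> z ` D = {}" using inj_on_image_Int[OF inj_z, of e D] that by auto
      ultimately show ?thesis by blast
    qed
    have 3: "path_image (g e) \<inter> path_image (g f) = {}" if "e \<in> E" "f \<in> E" "e \<subseteq> A" "f \<subseteq> B" for e f
    proof -
      have "e \<inter> f = {}" using that AB(3) by blast
      moreover have "e \<noteq> f" using \<open>e \<inter> f = {}\<close> edge_card[OF that(1)] by auto
      ultimately show ?thesis using cross_g[OF that(1,2)] by simp
    qed
    have 4: "path_image (g e) \<inter> z ` B = {}" if "e \<in> E" "e \<subseteq> A" for e by (rule 2[OF that]) (use AB in auto)
    have 5: "path_image (g e) \<inter> z ` A = {}" if "e \<in> E" "e \<subseteq> B" for e by (rule 2[OF that]) (use AB in auto)
    show ?thesis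
    proof (rule ccontr)
      assume "part A \<inter> part B \<noteq> {}"
      then obtain x where x: "x \<in> part A" "x \<in> part B" by blast
      from x(1) consider "x \<in> z ` A" | e where "e \<in> E" "e \<subseteq> A" "x \<in> path_image (g e)" by (auto simp: part_def)
      then show False
      proof cases
        case a: 1
        from x(2) consider "x \<in> z ` B" | f where "f \<in> E" "f \<subseteq> B" "x \<in> path_image (g f)" by (auto simp: part_def)
        then show False by cases (use a 1 5 in blast)+
      next
        case a: 2
        from x(2) consider "x \<in> z ` B" | f where "f \<in> E" "f \<subseteq> B" "x \<in> path_image (g f)" by (auto simp: part_def)
        then show False
        proof cases
          case 1 then show False using a 4 by blast
        next
          case 2 then show False using a 3[OF a(1) 2(1) a(2) 2(2)] by blast
        qed
      qed
    qed
  qed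
  have fr: "frontier F \<subseteq> part A \<or> frontier F \<subseteq> part B" "frontier F \<noteq> {}" if F: "F \<in> faces V E z g" for F
  proof -
    have c: "is_cycle E (cyc F)" "frontier F = (\<Union>e\<in>cycle_edges (cyc F). path_image (g e))"
      using cyc[OF F] by (auto simp: bordered_by_def)
    from cycle_loop[OF c(1)] obtain \<gamma> where \<gamma>: "simple_path \<gamma>" "path_image \<gamma> = frontier F" using c(2) by auto
    then have con: "connected (frontier F)" "frontier F \<noteq> {}"
      by (metis connected_simple_path_image, metis path_image_nonempty)
    have sub: "frontier F \<subseteq> K" using c K_edge by (auto simp: is_cycle_def)
    have "part A \<inter> frontier F = {} \<or> part B \<inter> frontier F = {}"
      by (rule connected_closedD[OF con(1)]) (use dis sub K clp in auto)
    then show "frontier F \<subseteq> part A \<or> frontier F \<subseteq> part B" using sub K by blast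
    show "frontier F \<noteq> {}" by (rule con(2))
  qed
  have "side A \<union> side B = UNIV"
  proof -
    have "- K \<subseteq> side A \<union> side B" unfolding Union_faces[symmetric] side_def using fr(1) by blast
    moreover have "K \<subseteq> side A \<union> side B" using K by (auto simp: side_def)
    ultimately show ?thesis by blast
  qed
  moreover have "side A \<inter> side B = {}"
  proof -
    have pf: "part A \<inter> F = {}" "part B \<inter> F = {}" if "F \<in> faces V E z g" for F
      using face_props(4)[OF that] K by blast+
    have "F \<inter> G = {}" if F: "F \<in> faces V E z g" "frontier F \<subseteq> part A" and G: "G \<in> faces V E z g" "frontier G \<subseteq> part B" for F G
    proof -
      have "F \<noteq> G" using F G dis fr(2)[OF F(1)] by blast
      then show ?thesis using faces_disjoint[OF F(1) G(1)] by blast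
    qed
    then have "(\<Union>F\<in>{F\<in>faces V E z g. frontier F \<subseteq> part A}. F) \<inter> (\<Union>F\<in>{F\<in>faces V E z g. frontier F \<subseteq> part B}. F) = {}"
      by blast
    moreover have "part A \<inter> (\<Union>F\<in>{F\<in>faces V E z g. frontier F \<subseteq> part B}. F) = {}" using pf(1) by blast
    moreover have "part B \<inter> (\<Union>F\<in>{F\<in>faces V E z g. frontier F \<subseteq> part A}. F) = {}" using pf(2) by blast
    ultimately show ?thesis unfolding side_def using dis by blast
  qed
  ultimately have "side A = {} \<or> side B = {}"
    using connected_closedD[of "UNIV :: complex set" "side A" "side B"] cls connected_UNIV by auto
  moreover have "z x \<in> side A" "z y \<in> side B" using x ne by (auto simp: side_def part_def A_def B_def)
  ultimately show False by blast
qed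

lemma simple_ends_drawing: "simple_ends E src tgt"
  unfolding simple_ends_def
proof
  show "\<forall>e\<in>E. src e \<noteq> tgt e" using edge_ends(6) by blast
  show "inj_on (\<lambda>e. {src e, tgt e}) E"
    by (rule inj_onI) (metis edge_ends(5))
qed

text \<open>Connectedness of graph and dual makes the two cut dimensions \<open>|V| - 1\<close> and
  the number of faces minus 1; \<open>dual_pair_dim\<close> adds them up to
  \<open>|E|\<close>.\<close>

theorem Euler_formula:
  assumes "V \<noteq> {}"
  shows "card V + card (faces V E z g) = card E + 2"
proof -
  obtain x0 where x0: "x0 \<in> V" using assms by blast
  \<comment> \<open>A face is needed as base point. Without faces there could be no edges either,
    and a finite drawing does not fill the plane.\<close>
  have "K \<noteq> UNIV"
  proof
    assume "K = UNIV"
    then have "faces V E z g = {}" by (simp add: faces_eq)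
    then have "E = {}" using edge_on_face_cycle by blast
    then have "finite K" unfolding K_def by simp
    then show False using \<open>K = UNIV\<close> infinite_UNIV_char_0[where 'a = complex] by simp
  qed
  then obtain F0 where F0: "F0 \<in> faces V E z g" using Union_faces by blast
  have "dim (range (cut_vec E src tgt)) + 1 = card V"
    by (rule dim_cut_space_eq[OF _ x0]) (use edge_ends(1,2) vertices_connected x0 in auto)
  moreover have "dim (range (cut_vec E left right)) + 1 = card (faces V E z g)"
    by (rule dim_cut_space_eq[OF finite_faces F0]) (use sides(1,2) faces_connected F0 in auto)
  ultimately show ?thesis using dual_pair_dim[OF dual_pair_faces] by simp
qed

text \<open>An edge borders exactly the faces on its two sides.\<close>

theorem sum_face_lengths: "(\<Sum>F\<in>faces V E z g. length (cyc F)) = 2 * card E"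
proof -
  obtain Z \<epsilon> where Z: "\<And>F. F \<in> faces V E z g \<Longrightarrow> \<epsilon> F \<in> {1, -1 :: real}"
    "\<And>F e. F \<in> faces V E z g \<Longrightarrow> e \<in> E \<Longrightarrow> \<bar>Z F e\<bar> = of_bool (e \<in> cycle_edges (cyc F))"
    "\<And>F e. F \<in> faces V E z g \<Longrightarrow> e \<in> E \<Longrightarrow> Z F e = \<epsilon> F * (of_bool (left e = F) - of_bool (right e = F))"
    using face_circulations by blast
  have mem: "e \<in> cycle_edges (cyc F) \<longleftrightarrow> (left e = F) \<noteq> (right e = F)" if "F \<in> faces V E z g" "e \<in> E" for F e
    using Z(1)[OF that(1)] Z(2)[OF that] unfolding Z(3)[OF that]
    by (cases "left e = F"; cases "right e = F") auto
  have cF: "cycle_edges (cyc F) \<subseteq> E" "card (cycle_edges (cyc F)) = length (cyc F)" if "F \<in> faces V E z g" for F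
    using cyc[OF that] card_cycle_edges[of "cyc F"] by (auto simp: bordered_by_def is_cycle_def)
  \<comment> \<open>The two sides differ because the edge lies on some bordering cycle, whose
    circulation would otherwise vanish on it.\<close>
  have lr: "left e \<noteq> right e" if e: "e \<in> E" for e
  proof -
    obtain F c where F: "F \<in> faces V E z g" "bordered_by E g F c" "e \<in> cycle_edges c"
      using edge_on_face_cycle[OF e] by blast
    then have "e \<in> cycle_edges (cyc F)" using bordered_by_unique[OF F(2) cyc[OF F(1)]] by simp
    then show ?thesis using mem[OF F(1) e] by auto
  qed
  have "(\<Sum>F\<in>faces V E z g. length (cyc F)) = (\<Sum>F\<in>faces V E z g. card {e\<in>E. e \<in> cycle_edges (cyc F)})"
  proof (rule sum.cong)
    fix F assume F: "F \<in> faces V E z g"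
    have "{e\<in>E. e \<in> cycle_edges (cyc F)} = cycle_edges (cyc F)" using cF(1)[OF F] by blast
    then show "length (cyc F) = card {e\<in>E. e \<in> cycle_edges (cyc F)}" using cF(2)[OF F] by simp
  qed simp
  also have "\<dots> = (\<Sum>e\<in>E. card {F\<in>faces V E z g. e \<in> cycle_edges (cyc F)})"
    by (rule sum_multicount_gen[symmetric, THEN trans]) (auto simp: finite_faces)
  also have "\<dots> = (\<Sum>e\<in>E. 2)"
  proof (rule sum.cong)
    fix e assume e: "e \<in> E"
    have "{F\<in>faces V E z g. e \<in> cycle_edges (cyc F)} = {left e, right e}"
      using mem[OF _ e] sides(1,2)[OF e] lr[OF e] by auto
    then show "card {F\<in>faces V E z g. e \<in> cycle_edges (cyc F)} = 2" using lr[OF e] by simp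
  qed simp
  finally show ?thesis by simp
qed

end

section \<open>Infinitesimal flexes\<close>

text \<open>The condition \<open>q > 1\<close> matters at 0, where the difference quotient is
  bounded by the power \<open>q - 1\<close> of the step.\<close>

lemma DERIV_abs_powr:
  assumes "q > 1"
  shows "((\<lambda>y::real. \<bar>y\<bar> powr q) has_real_derivative q * (sgn y * \<bar>y\<bar> powr (q - 1))) (at y)"
proof -
  consider "y > 0" | "y < 0" | "y = 0" by linarith
  then show ?thesis
  proof cases
    case 1
    have "((\<lambda>y::real. y powr q) has_real_derivative q * (sgn y * \<bar>y\<bar> powr (q - 1))) (at y)"
      using 1 by (auto intro!: derivative_eq_intros)
    then show ?thesis
      by (rule has_field_derivative_transform_within_open[of _ _ _ "{0<..}"]) (use 1 in auto)
  next
    case 2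
    have "((\<lambda>y::real. (- y) powr q) has_real_derivative q * (sgn y * \<bar>y\<bar> powr (q - 1))) (at y)"
      using 2 by (auto intro!: derivative_eq_intros)
    then show ?thesis
      by (rule has_field_derivative_transform_within_open[of _ _ _ "{..<0}"]) (use 2 in auto)
  next
    case 3
    have "((\<lambda>h::real. \<bar>h\<bar> powr (q - 1)) \<longlongrightarrow> \<bar>0\<bar> powr (q - 1)) (at 0)"
      using assms by (intro tendsto_powr' tendsto_intros) auto
    then have "((\<lambda>h::real. \<bar>h\<bar> powr (q - 1)) \<longlongrightarrow> 0) (at 0)" using assms by simp
    then have "((\<lambda>h::real. \<bar>h\<bar> powr q / h) \<longlongrightarrow> 0) (at 0)"
    proof (rule Lim_null_comparison[rotated])
      have "norm (\<bar>h\<bar> powr q / h) \<le> \<bar>h\<bar> powr (q - 1)" if "h \<noteq> 0" for h :: real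
        using that by (simp add: powr_diff)
      then show "\<forall>\<^sub>F h::real in at 0. norm (\<bar>h\<bar> powr q / h) \<le> \<bar>h\<bar> powr (q - 1)"
        by (auto simp: eventually_at_filter)
    qed
    then show ?thesis using 3 assms by (simp add: has_field_derivative_iff)
  qed
qed

text \<open>The gradient of the norm is a positive multiple of \<open>signed_powr\<close>. The
  factor \<open>C\<close> stays unspecified, since only the vanishing of derivatives
  matters.\<close>

lemma lq_norm_has_derivative:
  fixes X :: "real \<Rightarrow> real ^ 'd"
  assumes q: "q > 1" and X: "(X has_vector_derivative d) (at 0)" and nz: "X 0 \<noteq> 0"
  shows "\<exists>C>0. ((\<lambda>t. lq_norm q (X t)) has_real_derivative C * (signed_powr (X 0) (q - 1) \<bullet> d)) (at 0)"
proof -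
  let ?S = "\<lambda>t. \<Sum>i\<in>UNIV. \<bar>X t $ i\<bar> powr q"
  obtain i where "X 0 $ i \<noteq> 0" using nz by (auto simp: vec_eq_iff)
  then have S0: "?S 0 > 0" using q by (intro sum_pos2[of _ i]) auto
  have comp: "((\<lambda>t. X t $ i) has_real_derivative d $ i) (at 0)" for i
    using bounded_linear.has_vector_derivative[OF bounded_linear_vec_nth X, of i]
    by (simp add: has_real_derivative_iff_has_vector_derivative)
  have "(?S has_real_derivative (\<Sum>i\<in>UNIV. q * (sgn (X 0 $ i) * \<bar>X 0 $ i\<bar> powr (q - 1)) * d $ i)) (at 0)"
    by (intro DERIV_sum DERIV_chain2[OF DERIV_abs_powr[OF q] comp])
  then have dS: "(?S has_real_derivative q * (signed_powr (X 0) (q - 1) \<bullet> d)) (at 0)"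
    by (simp add: signed_powr_def inner_vec_def sum_distrib_left mult.assoc)
  have "((\<lambda>t. ?S t powr (1 / q)) has_real_derivative
    (1 / q * ?S 0 powr (1 / q - 1)) * (q * (signed_powr (X 0) (q - 1) \<bullet> d))) (at 0)"
    by (rule DERIV_chain2[OF has_real_derivative_powr[OF S0] dS])
  moreover have "(1 / q * ?S 0 powr (1 / q - 1)) * (q * y) = ?S 0 powr (1 / q - 1) * y" for y
    using q by simp
  moreover have "?S 0 powr (1 / q - 1) > 0" using S0 by simp
  ultimately show ?thesis unfolding lq_norm_def by metis
qed

text \<open>The distance between two moving points is constant, so its derivative vanishes.\<close>

lemma inf_rigid_motion_orthogonal:
  fixes \<gamma> :: "real ^ 'd \<Rightarrow> real ^ 'd"
  assumes q: "q > 1" and \<gamma>: "inf_rigid_motion q \<gamma>"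
  shows "signed_powr (x - y) (q - 1) \<bullet> (\<gamma> x - \<gamma> y) = 0"
proof (cases "x = y")
  case False
  obtain \<Gamma> where \<Gamma>: "rigid_motion q \<Gamma>" "\<And>x. (\<Gamma> x has_vector_derivative \<gamma> x) (at 0)"
    using \<gamma> by (auto simp: inf_rigid_motion_def)
  have "((\<lambda>t. \<Gamma> x t - \<Gamma> y t) has_vector_derivative \<gamma> x - \<gamma> y) (at 0)"
    by (intro derivative_intros \<Gamma>)
  moreover have "\<Gamma> x 0 - \<Gamma> y 0 = x - y" using \<Gamma>(1) by (simp add: rigid_motion_def)
  ultimately obtain C where C: "C > 0"
    "((\<lambda>t. lq_norm q (\<Gamma> x t - \<Gamma> y t)) has_real_derivative C * (signed_powr (x - y) (q - 1) \<bullet> (\<gamma> x - \<gamma> y))) (at 0)"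
    using lq_norm_has_derivative[OF q, of "\<lambda>t. \<Gamma> x t - \<Gamma> y t"] False by auto
  have "((\<lambda>t. lq_norm q (x - y)) has_real_derivative 0) (at 0)" by simp
  then have "((\<lambda>t. lq_norm q (\<Gamma> x t - \<Gamma> y t)) has_real_derivative 0) (at 0)"
    by (rule has_field_derivative_transform_within_open[of _ _ _ "{-1<..<1}"])
      (use \<Gamma>(1) in \<open>auto simp: rigid_motion_def\<close>)
  from DERIV_unique[OF this C(2)] C(1) show ?thesis by simp
qed (simp add: signed_powr_0)

lemma flex_condition_iff:
  fixes x d :: "real ^ 'd"
  assumes q: "q > 1" and "x \<noteq> 0"
  shows "(\<lambda>t. lq_norm q (x + t *\<^sub>R d) - lq_norm q x) \<in> o[at 0](\<lambda>t. t) \<longleftrightarrow> signed_powr x (q - 1) \<bullet> d = 0"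
proof -
  have "((\<lambda>t. x + t *\<^sub>R d) has_vector_derivative d) (at 0)"
    by (auto intro!: derivative_eq_intros)
  from lq_norm_has_derivative[OF q this] obtain C where C: "C > 0"
    "((\<lambda>t. lq_norm q (x + t *\<^sub>R d)) has_real_derivative C * (signed_powr x (q - 1) \<bullet> d)) (at 0)"
    using \<open>x \<noteq> 0\<close> by auto
  then have lim: "((\<lambda>t. (lq_norm q (x + t *\<^sub>R d) - lq_norm q x) / t) \<longlongrightarrow> C * (signed_powr x (q - 1) \<bullet> d)) (at 0)"
    by (simp add: has_field_derivative_iff)
  have "(\<lambda>t. lq_norm q (x + t *\<^sub>R d) - lq_norm q x) \<in> o[at 0](\<lambda>t. t) \<longleftrightarrow>
    ((\<lambda>t. (lq_norm q (x + t *\<^sub>R d) - lq_norm q x) / t) \<longlongrightarrow> 0) (at 0)"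
  proof
    assume "(\<lambda>t. lq_norm q (x + t *\<^sub>R d) - lq_norm q x) \<in> o[at 0](\<lambda>t. t)"
    then show "((\<lambda>t. (lq_norm q (x + t *\<^sub>R d) - lq_norm q x) / t) \<longlongrightarrow> 0) (at 0)"
      by (rule smalloD_tendsto)
  next
    assume "((\<lambda>t. (lq_norm q (x + t *\<^sub>R d) - lq_norm q x) / t) \<longlongrightarrow> 0) (at 0)"
    then show "(\<lambda>t. lq_norm q (x + t *\<^sub>R d) - lq_norm q x) \<in> o[at 0](\<lambda>t. t)"
      by (rule smalloI_tendsto) (simp add: eventually_at_filter)
  qed
  also have "\<dots> \<longleftrightarrow> signed_powr x (q - 1) \<bullet> d = 0"
    using lim C(1) tendsto_unique[OF _ lim, of 0] by (auto simp: trivial_limit_at)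
  finally show ?thesis .
qed

lemma rigidity_row_inner:
  assumes "v \<noteq> w"
  shows "rigidity_row q p v w \<bullet> u = signed_powr (p $ v - p $ w) (q - 1) \<bullet> (u $ v - u $ w)"
proof -
  have "rigidity_row q p v w \<bullet> u = (\<Sum>z\<in>UNIV. (if z = v then signed_powr (p $ v - p $ w) (q - 1) \<bullet> u $ v else 0)
      - (if z = w then signed_powr (p $ v - p $ w) (q - 1) \<bullet> u $ w else 0))"
    unfolding rigidity_row_def inner_vec_def[of "\<chi> z. _ z" u]
    by (rule sum.cong) (use assms in auto)
  then show ?thesis by (simp add: sum_subtractf inner_diff_right)
qed

lemma placement_edge:
  assumes "placement E p" "{v, w} \<in> E"
  shows "p $ v \<noteq> p $ w"
  using assms by (auto simp: placement_def)

lemma mem_flexes_iff: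
  assumes q: "q > 1" and p: "placement E p"
  shows "u \<in> flexes q V E p \<longleftrightarrow> (\<forall>v. v \<notin> V \<longrightarrow> u $ v = 0) \<and>
    (\<forall>v w. {v, w} \<in> E \<longrightarrow> signed_powr (p $ v - p $ w) (q - 1) \<bullet> (u $ v - u $ w) = 0)"
proof -
  have "(\<lambda>t. lq_norm q ((p $ v + t *\<^sub>R u $ v) - (p $ w + t *\<^sub>R u $ w)) - lq_norm q (p $ v - p $ w)) \<in> o[at 0](\<lambda>t. t)
    \<longleftrightarrow> signed_powr (p $ v - p $ w) (q - 1) \<bullet> (u $ v - u $ w) = 0" if e: "{v, w} \<in> E" for v w
  proof -
    have nz: "p $ v - p $ w \<noteq> 0" using placement_edge[OF p e] by simp
    have "(p $ v + t *\<^sub>R u $ v) - (p $ w + t *\<^sub>R u $ w) = (p $ v - p $ w) + t *\<^sub>R (u $ v - u $ w)" for t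
      by (simp add: algebra_simps)
    then show ?thesis by (simp only: flex_condition_iff[OF q nz])
  qed
  then show ?thesis unfolding flexes_def by blast
qed

lemma dim_supported_vec:
  "dim {u :: (real ^ 'd) ^ 'v. \<forall>v. v \<notin> V \<longrightarrow> u $ v = 0} = CARD('d) * card V"
proof -
  define D where "D = (\<lambda>(v, b). axis v b :: (real ^ 'd) ^ 'v) ` (V \<times> (Basis :: (real ^ 'd) set))"
  have inj: "inj_on (\<lambda>(v, b). axis v b :: (real ^ 'd) ^ 'v) (V \<times> (Basis :: (real ^ 'd) set))"
    by (auto simp: inj_on_def axis_eq_axis)
  have D: "D \<subseteq> Basis" by (auto simp: D_def Basis_vec_def)
  have "{u :: (real ^ 'd) ^ 'v. \<forall>v. v \<notin> V \<longrightarrow> u $ v = 0} = {u. \<forall>i\<in>Basis. i \<notin> D \<longrightarrow> u \<bullet> i = 0}"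
  proof (intro equalityI subsetI CollectI ballI impI allI)
    fix u :: "(real ^ 'd) ^ 'v" and i assume u: "u \<in> {u. \<forall>v. v \<notin> V \<longrightarrow> u $ v = 0}" and i: "i \<in> Basis" "i \<notin> D"
    obtain v b where "i = axis v b" "b \<in> Basis" using i(1) unfolding Basis_vec_def by blast
    then show "u \<bullet> i = 0" using u i(2) by (auto simp: D_def inner_axis)
  next
    fix u :: "(real ^ 'd) ^ 'v" and v assume u: "u \<in> {u. \<forall>i\<in>Basis. i \<notin> D \<longrightarrow> u \<bullet> i = 0}" and v: "v \<notin> V"
    have "u $ v \<bullet> b = 0" if b: "b \<in> Basis" for b
    proof -
      have "axis v b \<in> Basis" using b unfolding Basis_vec_def by blast
      moreover have "axis v b \<notin> D" using v b by (auto simp: D_def axis_eq_axis)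
      ultimately have "u \<bullet> axis v b = 0" using u by blast
      then show ?thesis by (simp add: inner_axis)
    qed
    then show "u $ v = 0" by (simp add: euclidean_eq_iff[of "u $ v" 0])
  qed
  then have "dim {u :: (real ^ 'd) ^ 'v. \<forall>v. v \<notin> V \<longrightarrow> u $ v = 0} = card D"
    using dim_substandard[OF D] by simp
  also have "\<dots> = CARD('d) * card V" unfolding D_def by (simp add: card_image[OF inj] card_cartesian_product)
  finally show ?thesis .
qed

text \<open>Rank-nullity: the flexes are the vector fields on \<open>V\<close> orthogonal to all
  rows of the rigidity matrix.\<close>

lemma dim_flexes:
  fixes p :: "real ^ 'd ^ 'v::finite"
  assumes q: "q > 1" and p: "placement E p" and E: "simple_graph V E"
  shows "dim (flexes q V E p) + rigidity_rank q E p = CARD('d) * card V"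
proof -
  let ?S = "{u :: real ^ 'd ^ 'v. \<forall>v. v \<notin> V \<longrightarrow> u $ v = 0}"
  let ?R = "{rigidity_row q p v w | v w. {v, w} \<in> E}"
  have ne: "v \<noteq> w" if "{v, w} \<in> E" for v w using E that by (auto simp: simple_graph_def)
  have sS: "subspace ?S" by (auto simp: subspace_def)
  have RS: "span ?R \<subseteq> ?S"
  proof (rule span_minimal[OF _ sS], clarify)
    fix v w x assume "{v, w} \<in> E" "x \<notin> V"
    then have "x \<noteq> v" "x \<noteq> w" using E by (auto simp: simple_graph_def)
    then show "rigidity_row q p v w $ x = 0" by (simp add: rigidity_row_def)
  qed
  have "flexes q V E p = {u \<in> ?S. \<forall>r\<in>span ?R. orthogonal r u}"
  proof (intro set_eqI)
    fix u
    have "(\<forall>r\<in>span ?R. orthogonal r u) \<longleftrightarrow> (\<forall>r\<in>?R. orthogonal r u)"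
      by (meson orthogonal_commute orthogonal_to_span span_base)
    also have "\<dots> \<longleftrightarrow> (\<forall>v w. {v, w} \<in> E \<longrightarrow> signed_powr (p $ v - p $ w) (q - 1) \<bullet> (u $ v - u $ w) = 0)"
    proof -
      have "orthogonal (rigidity_row q p v w) u \<longleftrightarrow> signed_powr (p $ v - p $ w) (q - 1) \<bullet> (u $ v - u $ w) = 0"
        if "{v, w} \<in> E" for v w
        unfolding orthogonal_def rigidity_row_inner[OF ne[OF that]] ..
      then show ?thesis by blast
    qed
    finally show "u \<in> flexes q V E p \<longleftrightarrow> u \<in> {u \<in> ?S. \<forall>r\<in>span ?R. orthogonal r u}"
      by (simp add: mem_flexes_iff[OF q p])
  qed
  then show ?thesis
    using dim_subspace_orthogonal_to_vectors[OF subspace_span sS RS]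
    by (simp add: dim_span rigidity_rank_def dim_supported_vec)
qed

lemma rigidity_rank_le: "rigidity_rank q E p \<le> card (E :: 'v::finite set set)"
  and rigidity_rank_eq_iff:
  "(\<And>e. e \<in> E \<Longrightarrow> e = {t e, h e} \<and> t e \<noteq> h e) \<Longrightarrow>
    rigidity_rank q E p = card E \<longleftrightarrow> stress_free E t h (\<lambda>e. signed_powr (p $ t e - p $ h e) (q - 1))"
proof -
  have sym: "rigidity_row q p v w = rigidity_row q p w v" for v w
  proof -
    have "signed_powr (p $ w - p $ v) (q - 1) = - signed_powr (p $ v - p $ w) (q - 1)"
      using signed_powr_minus[of "p $ v - p $ w"] by simp
    then show ?thesis by (auto simp: rigidity_row_def vec_eq_iff[of "\<chi> z. _ z"] signed_powr_0)
  qed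
  have rows: "{rigidity_row q p v w | v w. {v, w} \<in> E} = (\<lambda>e. rigidity_row q p (t e) (h e)) ` E"
    if e: "\<And>e. e \<in> E \<Longrightarrow> e = {t e, h e}" for t h
  proof (intro equalityI subsetI)
    fix r assume "r \<in> {rigidity_row q p v w | v w. {v, w} \<in> E}"
    then obtain v w where vw: "r = rigidity_row q p v w" "{v, w} \<in> E" by blast
    then have "t {v, w} = v \<and> h {v, w} = w \<or> t {v, w} = w \<and> h {v, w} = v"
      using e[OF vw(2)] by (auto simp: doubleton_eq_iff)
    then show "r \<in> (\<lambda>e. rigidity_row q p (t e) (h e)) ` E" using vw sym by (intro image_eqI[of _ _ "{v, w}"]) auto
  next
    fix r assume "r \<in> (\<lambda>e. rigidity_row q p (t e) (h e)) ` E"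
    then obtain f where f: "f \<in> E" "r = rigidity_row q p (t f) (h f)" by blast
    with e[OF f(1)] have "{t f, h f} \<in> E" by simp
    then show "r \<in> {rigidity_row q p v w | v w. {v, w} \<in> E}" using f by blast
  qed
  show "rigidity_rank q E p \<le> card E"
  proof -
    \<comment> \<open>The row depends only on the unordered edge, so one row per edge bounds the
      rank without a choice of orientations.\<close>
    define k where "k e = (SOME r. \<exists>v w. r = rigidity_row q p v w \<and> e = {v, w})" for e
    have "rigidity_row q p v w = k {v, w}" for v w
      unfolding k_def by (rule some_equality[symmetric]) (auto simp: doubleton_eq_iff sym)
    then have "{rigidity_row q p v w | v w. {v, w} \<in> E} \<subseteq> k ` E" by auto
    then have "dim {rigidity_row q p v w | v w. {v, w} \<in> E} \<le> card (k ` E)" by (rule dim_le_card[OF span_superset[THEN subset_trans[rotated]]]) simp_all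
    then show ?thesis unfolding rigidity_rank_def using card_image_le[of E k] by simp
  qed
  assume e: "\<And>e. e \<in> E \<Longrightarrow> e = {t e, h e} \<and> t e \<noteq> h e"
  have row: "rigidity_row q p (t f) (h f) $ x = incid t h f x *\<^sub>R signed_powr (p $ t f - p $ h f) (q - 1)" if "f \<in> E" for f x
    using e[OF that] by (auto simp: rigidity_row_def incid_def)
  have "rigidity_rank q E p = card E \<longleftrightarrow>
    (\<forall>a. (\<Sum>f\<in>E. a f *\<^sub>R rigidity_row q p (t f) (h f)) = 0 \<longrightarrow> (\<forall>f\<in>E. a f = 0))"
    unfolding rigidity_rank_def using rows[of t h] e by (simp add: dim_image_eq_card_iff)
  also have "\<dots> \<longleftrightarrow> stress_free E t h (\<lambda>e. signed_powr (p $ t e - p $ h e) (q - 1))"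
  proof -
    have "(\<Sum>f\<in>E. a f *\<^sub>R rigidity_row q p (t f) (h f)) = 0 \<longleftrightarrow>
      (\<forall>x. (\<Sum>f\<in>E. (a f * incid t h f x) *\<^sub>R signed_powr (p $ t f - p $ h f) (q - 1)) = 0)" for a
      unfolding vec_eq_iff[where 'b = 'v and 'a = "real ^ 'b"] by (simp add: row cong: sum.cong)
    then show ?thesis unfolding stress_free_def by simp
  qed
  finally show "rigidity_rank q E p = card E \<longleftrightarrow> stress_free E t h (\<lambda>e. signed_powr (p $ t e - p $ h e) (q - 1))" .
qed

section \<open>Trivial flexes\<close>

lemma lq_norm_2: "lq_norm 2 x = norm x"
  by (simp add: lq_norm_def norm_vec_def L2_set_def powr_half_sqrt sum_nonneg flip: power2_eq_square)

text \<open>The rational form of Rodrigues' formula: a rotation about \<open>w\<close> whose half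
  angle has tangent \<open>norm w\<close>. It avoids trigonometric functions.\<close>

lemma rotation_norm:
  fixes w x :: "real ^ 3"
  shows "norm (x + (2 / (1 + w \<bullet> w)) *\<^sub>R (cross3 w x + cross3 w (cross3 w x))) = norm x"
proof -
  define y where "y = cross3 w x"
  define c where "c = 2 / (1 + w \<bullet> w)"
  have "1 + w \<bullet> w \<noteq> 0" using inner_ge_zero[of w] by linarith
  then have c: "c * (1 + w \<bullet> w) = 2" unfolding c_def by (metis nonzero_eq_divide_eq)
  have 1: "x \<bullet> y = 0" "w \<bullet> y = 0" "y \<bullet> cross3 w y = 0" by (simp_all add: y_def dot_cross_self)
  have 2: "x \<bullet> cross3 w y = - (y \<bullet> y)"
    by (simp add: y_def cross3_simps)
  have 3: "cross3 w y \<bullet> cross3 w y = (w \<bullet> w) * (y \<bullet> y)"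
    using dot_cross[of w y w y] 1(2) by (simp add: inner_commute)
  have "(x + c *\<^sub>R (y + cross3 w y)) \<bullet> (x + c *\<^sub>R (y + cross3 w y))
    = x \<bullet> x + 2 * c * (x \<bullet> y + x \<bullet> cross3 w y) + c * c * (y \<bullet> y + 2 * (y \<bullet> cross3 w y) + cross3 w y \<bullet> cross3 w y)"
    by (simp add: inner_add_left inner_add_right inner_commute algebra_simps)
  also have "\<dots> = x \<bullet> x + (y \<bullet> y) * c * (c * (1 + w \<bullet> w) - 2)"
    unfolding 1 2 3 by (simp add: algebra_simps)
  also have "\<dots> = x \<bullet> x" by (simp add: c)
  finally show ?thesis unfolding y_def c_def by (simp add: norm_eq_sqrt_inner)
qed

lemma inf_rigid_motion_2_screw:
  "inf_rigid_motion 2 (\<lambda>x :: real ^ 3. a + cross3 b x)"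
proof -
  \<comment> \<open>With parameter \<open>(t / 2) *\<^sub>R b\<close> the factor 2 of the formula
    cancels, and the velocity at \<open>t = 0\<close> is \<open>cross3 b x\<close>.\<close>
  define R where "R t x = x + (2 / (1 + ((t / 2) *\<^sub>R b) \<bullet> ((t / 2) *\<^sub>R b))) *\<^sub>R
    (cross3 ((t / 2) *\<^sub>R b) x + cross3 ((t / 2) *\<^sub>R b) (cross3 ((t / 2) *\<^sub>R b) x))" for t x
  have R: "R t x = x + (t / (1 + t\<^sup>2 / 4 * (b \<bullet> b))) *\<^sub>R (cross3 b x + (t / 2) *\<^sub>R cross3 b (cross3 b x))" for t x
  proof -
    have "((t / 2) *\<^sub>R b) \<bullet> ((t / 2) *\<^sub>R b) = t\<^sup>2 / 4 * (b \<bullet> b)" by (simp add: power2_eq_square)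
    moreover have "(2 / D) *\<^sub>R ((t / 2) *\<^sub>R c1 + (t / 2) *\<^sub>R (t / 2) *\<^sub>R c2) = (t / D) *\<^sub>R (c1 + (t / 2) *\<^sub>R c2)"
      for D and c1 c2 :: "real ^ 3" by (simp add: scaleR_add_right)
    ultimately show ?thesis unfolding R_def by (simp only: cross_mult_left cross_mult_right)
  qed
  have pos: "1 + t\<^sup>2 / 4 * (b \<bullet> b) \<noteq> 0" for t
    by (smt (verit) divide_nonneg_nonneg inner_ge_zero mult_nonneg_nonneg zero_le_power2)
  have diff: "R t x - R t y = R t (x - y)" for t x y
    by (simp add: R_def right_diff_distrib algebra_simps cross_minus_right Cross3.right_diff_distrib)
  define \<Gamma> where "\<Gamma> x t = t *\<^sub>R a + R t x" for x t
  have norm: "norm (\<Gamma> x t - \<Gamma> y t) = norm (x - y)" for x y t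
  proof -
    have "\<Gamma> x t - \<Gamma> y t = R t (x - y)" unfolding \<Gamma>_def diff[symmetric] by simp
    then show ?thesis unfolding R_def by (simp only: rotation_norm)
  qed
  have "rigid_motion 2 \<Gamma>"
    unfolding rigid_motion_def lq_norm_2 using norm pos
    by (auto simp: \<Gamma>_def R intro!: continuous_intros)
  moreover have "(\<Gamma> x has_vector_derivative a + cross3 b x) (at 0)" for x
  proof -
    have "((\<lambda>t. t / (1 + t\<^sup>2 / 4 * (b \<bullet> b))) has_real_derivative 1) (at 0)"
      by (auto intro!: derivative_eq_intros)
    then show ?thesis unfolding \<Gamma>_def R
      by (auto intro!: derivative_eq_intros)
  qed
  ultimately show ?thesis unfolding inf_rigid_motion_def by blast
qed

text \<open>Linearity of \<gamma> is not presupposed. Orthogonality polarises to skewness of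
  \<open>h\<close>, and pairing with coordinate vectors then writes each component of
  \<open>h\<close> as an inner product with a fixed vector.\<close>

lemma inf_rigid_motion_2_imp_screw:
  fixes \<gamma> :: "real ^ 3 \<Rightarrow> real ^ 3"
  assumes "inf_rigid_motion 2 \<gamma>"
  shows "\<exists>a b. \<forall>x. \<gamma> x = a + cross3 b x"
proof -
  define h where "h x = \<gamma> x - \<gamma> 0" for x
  have orth: "(x - y) \<bullet> (h x - h y) = 0" for x y
    using inf_rigid_motion_orthogonal[OF _ assms, of x y] by (simp add: signed_powr_1 h_def)
  have h0: "h 0 = 0" by (simp add: h_def)
  have self: "x \<bullet> h x = 0" for x using orth[of x 0] h0 by simp
  have skew: "h x \<bullet> y = - (h y \<bullet> x)" for x y
    using orth[of x y] self by (simp add: inner_diff_left inner_diff_right inner_commute)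
  let ?e = "\<lambda>i. axis i (1::real) :: real ^ 3"
  have comp: "h x $ i = - (h (?e i) \<bullet> x)" for x i
    using skew[of x "?e i"] by (simp add: inner_axis)
  have sk: "h (?e i) $ j = - (h (?e j) $ i)" for i j
    using skew[of "?e i" "?e j"] by (simp add: inner_axis)
  \<comment> \<open>The independent entries of a skew 3 by 3 matrix, arranged as the axial
    vector.\<close>
  define b :: "real ^ 3" where "b = vector [h (?e 2) $ 3, h (?e 3) $ 1, h (?e 1) $ 2]"
  have diag: "h (?e i) $ i = 0" for i using sk[of i i] by simp
  have "h x = cross3 b x" for x
    using sk[of 2 1] sk[of 1 3] sk[of 3 2]
    by (simp add: vec_eq_iff forall_3 comp[of x 1] comp[of x 2] comp[of x 3] diag inner_vec_def sum_3
        cross_components b_def vector_3)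
  then have "\<forall>x. \<gamma> x = \<gamma> 0 + cross3 b x" unfolding h_def by (metis add.commute diff_add_cancel)
  then show ?thesis by blast
qed

lemma inf_rigid_motion_const: "inf_rigid_motion q (\<lambda>x. a)"
proof -
  have "rigid_motion q (\<lambda>x t. x + t *\<^sub>R a)"
    unfolding rigid_motion_def by (auto intro!: continuous_intros)
  moreover have "((\<lambda>t. x + t *\<^sub>R a) has_vector_derivative a) (at 0)" for x
    by (auto intro!: derivative_eq_intros)
  ultimately show ?thesis unfolding inf_rigid_motion_def by blast
qed

text \<open>Along one axis, another coordinate of \<gamma> changes by a multiple of
  \<open>r powr s\<close> for a step \<open>r\<close>. Composing steps as \<open>1 + 2\<close> and
  as \<open>2 + 1\<close> is consistent only if the multiple is zero or \<open>2 powr s\<close> is 1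
  or 2, that is, \<open>s\<close> is 0 or 1.\<close>

lemma inf_rigid_motion_imp_const:
  fixes \<gamma> :: "real ^ 'd \<Rightarrow> real ^ 'd"
  assumes q: "q > 1" "q \<noteq> 2" and \<gamma>: "inf_rigid_motion q \<gamma>"
  shows "\<gamma> x = \<gamma> 0"
proof -
  define s where "s = q - 1"
  have s: "s > 0" "s \<noteq> 1" using q by (auto simp: s_def)
  let ?e = "\<lambda>i. axis i (1::real) :: real ^ 'd"
  have orth: "(\<Sum>k\<in>UNIV. sgn ((y - x) $ k) * \<bar>(y - x) $ k\<bar> powr s * (\<gamma> y $ k - \<gamma> x $ k)) = 0" for x y
    using inf_rigid_motion_orthogonal[OF q(1) \<gamma>, of y x]
    by (simp add: signed_powr_def inner_vec_def s_def)
  have self: "\<gamma> (x + c *\<^sub>R ?e i) $ i = \<gamma> x $ i" for x c i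
  proof (cases "c = 0")
    case False
    have "(\<Sum>k\<in>UNIV. if k = i then sgn c * \<bar>c\<bar> powr s * (\<gamma> (x + c *\<^sub>R ?e i) $ k - \<gamma> x $ k) else 0) = 0"
      by (subst orth[of "x + c *\<^sub>R ?e i" x, symmetric]) (rule sum.cong, auto simp: axis_def)
    then show ?thesis using False by (simp add: sgn_0_0)
  qed simp
  \<comment> \<open>Orthogonality for a displacement in two coordinates; \<open>self\<close> removes
    from each coordinate of \<gamma> the shift along its own axis.\<close>
  have pair: "c powr s * (\<gamma> (x + r *\<^sub>R ?e j) $ i - \<gamma> x $ i) + r powr s * (\<gamma> (x + c *\<^sub>R ?e i) $ j - \<gamma> x $ j) = 0"
    if "i \<noteq> j" "c > 0" "r > 0" for x i j c r
  proof -
    let ?y = "x + c *\<^sub>R ?e i + r *\<^sub>R ?e j"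
    have "(\<Sum>k\<in>UNIV. (if k = i then c powr s * (\<gamma> ?y $ k - \<gamma> x $ k) else 0)
        + (if k = j then r powr s * (\<gamma> ?y $ k - \<gamma> x $ k) else 0)) = 0"
      by (subst orth[of ?y x, symmetric]) (rule sum.cong, use that in \<open>auto simp: axis_def\<close>)
    then have "c powr s * (\<gamma> ?y $ i - \<gamma> x $ i) + r powr s * (\<gamma> ?y $ j - \<gamma> x $ j) = 0"
      by (simp add: sum.distrib)
    moreover have "\<gamma> ?y $ j = \<gamma> (x + c *\<^sub>R ?e i) $ j" by (rule self)
    moreover have "\<gamma> ?y $ i = \<gamma> (x + r *\<^sub>R ?e j) $ i"
      using self[of "x + r *\<^sub>R ?e j" c i] by (simp add: add.commute add.left_commute)
    ultimately show ?thesis by simp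
  qed
  have step: "\<gamma> (x + r *\<^sub>R ?e j) $ i = \<gamma> x $ i" if ij: "i \<noteq> j" and r: "r > 0" for x i j r
  proof -
    \<comment> \<open>The case \<open>c = 1\<close> of \<open>pair\<close>: this coefficient does
      not depend on \<open>r\<close>.\<close>
    define C where "C x = \<gamma> x $ j - \<gamma> (x + ?e i) $ j" for x
    have C: "\<gamma> (x + r *\<^sub>R ?e j) $ i = \<gamma> x $ i + C x * r powr s" if "r > 0" for x r
      using pair[OF ij, of 1 r x] that by (simp add: C_def algebra_simps)
    \<comment> \<open>A step \<open>2 * r\<close> compared with two steps \<open>r\<close>; the new
      coefficient turns out not to depend on \<open>r\<close>.\<close>
    have dbl: "C (x + r *\<^sub>R ?e j) = C x * (2 powr s - 1)" if r: "r > 0" for r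
    proof -
      have "\<gamma> (x + (2 * r) *\<^sub>R ?e j) $ i = \<gamma> (x + r *\<^sub>R ?e j) $ i + C (x + r *\<^sub>R ?e j) * r powr s"
        using C[OF r, of "x + r *\<^sub>R ?e j"] by (simp add: add.assoc flip: scaleR_left_distrib)
      then have "C x * (2 * r) powr s = C x * r powr s + C (x + r *\<^sub>R ?e j) * r powr s"
        using C[of "2 * r" x] C[OF r, of x] r by simp
      then have "(C x * 2 powr s) * r powr s = (C x + C (x + r *\<^sub>R ?e j)) * r powr s"
        using r by (simp add: powr_mult algebra_simps)
      then have "C x * 2 powr s = C x + C (x + r *\<^sub>R ?e j)" using r by simp
      then show ?thesis by (simp add: algebra_simps)
    qed
    \<comment> \<open>One step of length 3 split into \<open>a\<close> and \<open>b\<close>; the two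
      splittings together exclude a nonzero \<open>C x\<close>.\<close>
    have tri: "C x * 3 powr s = C x * a powr s + C (x + a *\<^sub>R ?e j) * b powr s"
      if "a > 0" "b > 0" "a + b = 3" for a b
    proof -
      have "\<gamma> (x + 3 *\<^sub>R ?e j) $ i = \<gamma> (x + a *\<^sub>R ?e j) $ i + C (x + a *\<^sub>R ?e j) * b powr s"
        using C[OF that(2), of "x + a *\<^sub>R ?e j"] that(3) by (simp add: add.assoc flip: scaleR_left_distrib)
      then show ?thesis using C[of 3 x] C[OF that(1), of x] by simp
    qed
    have "C x + C x * (2 powr s - 1) * 2 powr s = C x * 2 powr s + C x * (2 powr s - 1)"
      using tri[of 1 2] tri[of 2 1] dbl[of 1] dbl[of 2] by simp
    then have "C x * ((2 powr s - 1) * (2 powr s - 2)) = 0" by (simp add: algebra_simps)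
    moreover have "2 powr s \<noteq> 1" using s(1) by simp
    moreover have "2 powr s \<noteq> 2" using s(2) powr_inj[of 2 s 1] by simp
    ultimately have "C x = 0" by simp
    then show ?thesis using C[OF r, of x] by simp
  qed
  have shift: "\<gamma> (x + c *\<^sub>R ?e j) = \<gamma> x" for x c j
  proof -
    have "\<gamma> (x + c *\<^sub>R ?e j) $ i = \<gamma> x $ i" for i
    proof (cases "i = j")
      case False
      consider "c > 0" | "c = 0" | "c < 0" by linarith
      then show ?thesis
      proof cases
        case 3
        then show ?thesis using step[OF False, of "- c" "x + c *\<^sub>R ?e j"] by simp
      qed (use step[OF False] in auto)
    qed (simp add: self)
    then show ?thesis by (simp add: vec_eq_iff)
  qed
  have "\<gamma> (\<Sum>j\<in>J. x $ j *\<^sub>R ?e j) = \<gamma> 0" if "finite J" for J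
    using that
  proof (induction J)
    case (insert j J)
    then show ?case using shift[of "\<Sum>j\<in>J. x $ j *\<^sub>R ?e j" "x $ j" j] by (simp add: add.commute)
  qed simp
  from this[of UNIV] show ?thesis by (simp add: basis_expansion flip: scalar_mult_eq_scaleR)
qed

lemma dim_trivial_flexes_const:
  fixes p :: "real ^ 'd ^ 'v::finite"
  assumes q: "q > 1" "q \<noteq> 2" and p: "placement E p" and E: "simple_graph V E" and "V \<noteq> {}"
  shows "dim (trivial_flexes q V E p) = CARD('d)"
proof -
  define T where "T a = (\<chi> v. if v \<in> V then a else 0)" for a :: "real ^ 'd"
  have "trivial_flexes q V E p = range (T :: _ \<Rightarrow> real ^ 'd ^ 'v)"
  proof (intro equalityI subsetI)
    fix u assume "u \<in> trivial_flexes q V E p"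
    then obtain \<gamma> where u: "\<And>v. v \<notin> V \<Longrightarrow> u $ v = 0" "\<And>v. v \<in> V \<Longrightarrow> u $ v = \<gamma> (p $ v)" and \<gamma>: "inf_rigid_motion q \<gamma>"
      by (auto simp: trivial_flexes_def flexes_def)
    then have "u = T (\<gamma> 0)" using inf_rigid_motion_imp_const[OF q \<gamma>] by (simp add: T_def vec_eq_iff[of u])
    then show "u \<in> range T" by blast
  next
    fix u :: "real ^ 'd ^ 'v" assume "u \<in> range T"
    then obtain a where u: "u = T a" by blast
    have "v \<in> V" if "{v, w} \<in> E" for v w using that E by (auto simp: simple_graph_def)
    then have "v \<in> V \<and> w \<in> V" if "{v, w} \<in> E" for v w using that by (metis insert_commute)
    then have "u \<in> flexes q V E p" by (auto simp: mem_flexes_iff[OF q(1) p] u T_def)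
    moreover have "\<forall>v\<in>V. u $ v = (\<lambda>x. a) (p $ v)" by (simp add: u T_def)
    ultimately show "u \<in> trivial_flexes q V E p"
      unfolding trivial_flexes_def using inf_rigid_motion_const[of q a] by blast
  qed
  moreover have "linear T" by (rule linearI) (auto simp: T_def vec_eq_iff)
  moreover have "inj T"
  proof (rule injI)
    fix a b assume eq: "T a = T b"
    obtain v where "v \<in> V" using \<open>V \<noteq> {}\<close> by blast
    then show "a = b" using arg_cong[OF eq, of "\<lambda>u. u $ v"] by (simp add: T_def)
  qed
  ultimately show ?thesis by (simp add: dim_image_eq)
qed

text \<open>The six parameters are a translation \<open>a\<close> and an axial vector
  \<open>b\<close>. Condition \<open>nc\<close> makes them independent: every nonzero
  \<open>b\<close> changes some edge vector, which no translation can offset.\<close>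

lemma dim_trivial_flexes_2:
  fixes p :: "real ^ 3 ^ 'v::finite"
  assumes p: "placement E p" and E: "simple_graph V E" and "V \<noteq> {}"
    and nc: "\<And>b. b \<noteq> 0 \<Longrightarrow> \<exists>v w. {v, w} \<in> E \<and> cross3 b (p $ v - p $ w) \<noteq> 0"
  shows "dim (trivial_flexes 2 V E p) = 6"
proof -
  define T where "T ab = (\<chi> v. if v \<in> V then fst ab + cross3 (snd ab) (p $ v) else 0)" for ab :: "(real ^ 3) \<times> (real ^ 3)"
  have "v \<in> V" if "{v, w} \<in> E" for v w using that E by (auto simp: simple_graph_def)
  then have EV: "v \<in> V \<and> w \<in> V" if "{v, w} \<in> E" for v w using that by (metis insert_commute)
  have "trivial_flexes 2 V E p = range T"
  proof (intro equalityI subsetI)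
    fix u assume "u \<in> trivial_flexes 2 V E p"
    then obtain \<gamma> where u: "\<And>v. v \<notin> V \<Longrightarrow> u $ v = 0" "\<And>v. v \<in> V \<Longrightarrow> u $ v = \<gamma> (p $ v)" and \<gamma>: "inf_rigid_motion 2 \<gamma>"
      by (auto simp: trivial_flexes_def flexes_def)
    obtain a b where "\<And>x. \<gamma> x = a + cross3 b x" using inf_rigid_motion_2_imp_screw[OF \<gamma>] by blast
    then have "u = T (a, b)" using u by (simp add: T_def vec_eq_iff[of u])
    then show "u \<in> range T" by blast
  next
    fix u :: "real ^ 3 ^ 'v" assume "u \<in> range T"
    then obtain a b where u: "u = T (a, b)" by auto
    have "(p $ v - p $ w) \<bullet> (u $ v - u $ w) = 0" if "{v, w} \<in> E" for v w
    proof -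
      have "u $ v - u $ w = cross3 b (p $ v - p $ w)"
        using EV[OF that] by (simp add: u T_def Cross3.right_diff_distrib)
      then show ?thesis by (simp add: dot_cross_self)
    qed
    then have "u \<in> flexes 2 V E p" by (auto simp: mem_flexes_iff[OF _ p] signed_powr_1 u T_def)
    moreover have "\<forall>v\<in>V. u $ v = (\<lambda>x. a + cross3 b x) (p $ v)" by (simp add: u T_def)
    ultimately show "u \<in> trivial_flexes 2 V E p"
      unfolding trivial_flexes_def using inf_rigid_motion_2_screw[of a b] by blast
  qed
  moreover have lin: "linear T"
    by (rule linearI) (auto simp: T_def vec_eq_iff[where 'b = 'v] cross_add_left cross_mult_left scaleR_add_right)
  moreover have "inj T"
    unfolding linear_injective_0[OF lin]
  proof (intro allI impI)
    fix ab assume T0: "T ab = 0"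
    obtain a b where ab: "ab = (a, b)" by (cases ab)
    have z: "a + cross3 b (p $ v) = 0" if "v \<in> V" for v
      using arg_cong[OF T0, of "\<lambda>u. u $ v"] that by (simp add: T_def ab)
    have "b = 0"
    proof (rule ccontr)
      assume "b \<noteq> 0"
      then obtain v w where vw: "{v, w} \<in> E" "cross3 b (p $ v - p $ w) \<noteq> 0" using nc by blast
      have "cross3 b (p $ v - p $ w) = (a + cross3 b (p $ v)) - (a + cross3 b (p $ w))"
        by (simp add: Cross3.right_diff_distrib)
      then show False using vw z EV[OF vw(1)] by simp
    qed
    then show "ab = 0" using z \<open>V \<noteq> {}\<close> by (auto simp: ab zero_prod_def)
  qed
  ultimately show ?thesis by (simp add: dim_image_eq)
qed

section \<open>Generic placements and the dimension count\<close>

context cycle_faced_drawing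
begin

text \<open>A generic placement maximises the rank, so it does at least as well as the constructed
  one, whose rank is already the number of edges.\<close>

lemma generic_rigidity_rank:
  fixes p :: "real ^ 3 ^ 'v"
  assumes q: "q > 1" and p: "generic q V p"
  shows "placement E p" "rigidity_rank q E p = card E"
proof -
  have "E \<subseteq> complete_edges V" using edge_sub edge_card by (auto simp: complete_edges_def)
  then have reg: "regular q E p" using p by (auto simp: generic_def)
  then show "placement E p" by (simp add: regular_def)
  obtain x :: "'v \<Rightarrow> real ^ 3" where x: "gen_pos V x"
    and sf: "stress_free E src tgt (\<lambda>e. signed_powr (x (src e) - x (tgt e)) (q - 1))"
    using ex_stress_free_gen_pos[OF _ simple_ends_drawing dual_pair_faces, of "q - 1" V] q edge_ends(1,2) by auto
  let ?x = "\<chi> v. x v"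
  have "placement E ?x"
    unfolding placement_def
  proof (intro allI impI)
    fix v w assume e: "{v, w} \<in> E"
    then have "v \<in> V" "w \<in> V" "v \<noteq> w" using edge_sub[OF e] edge_card[OF e] by auto
    then show "?x $ v \<noteq> ?x $ w" using x by (auto simp: gen_pos_def inj_on_def)
  qed
  then have "rigidity_rank q E ?x \<le> rigidity_rank q E p" using reg by (simp add: regular_def)
  moreover have "rigidity_rank q E ?x = card E"
    by (subst rigidity_rank_eq_iff[where t = src and h = tgt]) (use edge_ends(5,6) sf in auto)
  ultimately show "rigidity_rank q E p = card E" using rigidity_rank_le[of q E p] by simp
qed

text \<open>If all edges were parallel to \<open>b\<close>, dividing a circulation by the signed edge lengths would
  give a stress.\<close>

lemma edges_not_parallel:
  fixes p :: "real ^ 3 ^ 'v"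
  assumes p: "placement E p" and rank: "rigidity_rank 2 E p = card E" and "E \<noteq> {}" and b: "b \<noteq> 0"
  shows "\<exists>v w. {v, w} \<in> E \<and> cross3 b (p $ v - p $ w) \<noteq> 0"
proof (rule ccontr)
  assume "\<not> ?thesis"
  then have par: "cross3 b (p $ v - p $ w) = 0" if "{v, w} \<in> E" for v w using that by blast
  have "\<exists>c. c \<noteq> 0 \<and> p $ src e - p $ tgt e = c *\<^sub>R b" if e: "e \<in> E" for e
  proof -
    have e': "{src e, tgt e} \<in> E" using edge_ends(5)[OF e] e by simp
    then have "p $ src e - p $ tgt e \<noteq> 0" using placement_edge[OF p] by simp
    moreover have "collinear {0, b, p $ src e - p $ tgt e}" using par[OF e'] by (simp add: cross_eq_0)
    ultimately show ?thesis using b by (auto simp: collinear_lemma)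
  qed
  then obtain c where c: "\<And>e. e \<in> E \<Longrightarrow> c e \<noteq> 0" "\<And>e. e \<in> E \<Longrightarrow> p $ src e - p $ tgt e = c e *\<^sub>R b" by metis
  have "stress_free E src tgt (\<lambda>e. signed_powr (p $ src e - p $ tgt e) (2 - 1))"
    using rank by (subst rigidity_rank_eq_iff[symmetric]) (use edge_ends(5,6) in auto)
  then have sf: "stress_free E src tgt (\<lambda>e. p $ src e - p $ tgt e)"
    by (simp add: signed_powr_1)
  obtain e0 where e0: "e0 \<in> E" using \<open>E \<noteq> {}\<close> by blast
  then obtain F k where "F \<in> faces V E z g" "bordered_by E g F k" "e0 \<in> cycle_edges k"
    using edge_on_face_cycle by blast
  then obtain \<zeta> where \<zeta>: "circ \<zeta>" "\<bar>\<zeta> e0\<bar> = 1" using face_circulation[of F k] e0 by force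
  have "(\<Sum>e\<in>E. (\<zeta> e / c e * incid src tgt e x) *\<^sub>R (p $ src e - p $ tgt e)) = 0" for x
  proof -
    have "(\<Sum>e\<in>E. (\<zeta> e / c e * incid src tgt e x) *\<^sub>R (p $ src e - p $ tgt e))
      = (\<Sum>e\<in>E. \<zeta> e * incid src tgt e x) *\<^sub>R b"
      unfolding scaleR_sum_left by (rule sum.cong) (use c in auto)
    then show ?thesis using \<zeta>(1) by (simp add: circulation_def)
  qed
  then have "\<zeta> e0 / c e0 = 0"
    using sf[unfolded stress_free_def, rule_format, of "\<lambda>e. \<zeta> e / c e" e0] e0 by blast
  then show False using \<zeta>(2) c(1)[OF e0] by auto
qed

end

theorem theorem4p14:
  fixes V :: "'v::finite set" and E :: "'v set set"
    and z :: "'v \<Rightarrow> complex" and g :: "'v set \<Rightarrow> real \<Rightarrow> complex"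
    and \<kappa> :: nat and \<Phi> :: "nat \<Rightarrow> complex set" and \<gamma> :: "nat \<Rightarrow> nat"
  assumes "simplicial_via V E z g \<kappa>"
    and "bij_betw \<Phi> {1..\<kappa>} (nontriangular_faces V E z g)"
    and "\<forall>i\<in>{1..\<kappa>}. \<exists>c. bordered_by E g (\<Phi> i) c \<and> length c = \<gamma> i"
  shows "(\<forall>p :: real ^ 3 ^ 'v. generic 2 V p \<longrightarrow>
            int (flex_dim 2 V E p) = (\<Sum>i=1..\<kappa>. int (\<gamma> i)) - 3 * int \<kappa>) \<and>
         (\<forall>q::real. 6 \<le> card V \<and> 1 < q \<and> q \<noteq> 2 \<longrightarrow>
            (\<forall>(p :: real ^ 3 ^ 'v) (p' :: real ^ 3 ^ 'v). generic 2 V p \<and> generic q V p' \<longrightarrow>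
               flex_dim q V E p' = flex_dim 2 V E p + 3))"
proof -
  let ?N = "nontriangular_faces V E z g"
  have G: "simple_graph V E" "3 \<le> card E" "planar_embedding V E z g" "finite ?N" "card ?N = \<kappa>"
    using assms(1) by (simp_all add: simplicial_via_def)
  have \<Phi>N: "\<Phi> ` {1..\<kappa>} = ?N" using assms(2) by (simp add: bij_betw_def)
  \<comment> \<open>Triangular faces have a bordering cycle by definition, the others by
    assumption.\<close>
  interpret cycle_faced_drawing V E z g
  proof
    fix F assume F: "F \<in> faces V E z g"
    show "\<exists>c. bordered_by E g F c"
    proof (cases "triangular E g F")
      case False
      then have "F \<in> \<Phi> ` {1..\<kappa>}" using F \<Phi>N by (simp add: nontriangular_faces_def)
      then show ?thesis using assms(3) by blast
    qed (auto simp: triangular_def)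
  qed (use G in auto)
  have E: "E \<noteq> {}" using G(2) by auto
  then have V: "V \<noteq> {}" using edge_ends(1) by blast
  have len: "length (cyc F) = length c" if "F \<in> faces V E z g" "bordered_by E g F c" for F c
  proof -
    note b = cyc[OF that(1)] that(2)
    have "cycle_edges (cyc F) = cycle_edges c" by (rule bordered_by_unique[OF b])
    then show ?thesis
      using card_cycle_edges[of c] card_cycle_edges[of "cyc F"] b by (simp add: bordered_by_def is_cycle_def)
  qed
  have N: "?N \<subseteq> faces V E z g" by (auto simp: nontriangular_faces_def)
  have "(\<Sum>F\<in>faces V E z g. length (cyc F)) = (\<Sum>F\<in>faces V E z g - ?N. length (cyc F)) + (\<Sum>F\<in>?N. length (cyc F))"
    by (rule sum.subset_diff[OF N finite_faces])
  moreover have "(\<Sum>F\<in>faces V E z g - ?N. length (cyc F)) = (\<Sum>F\<in>faces V E z g - ?N. 3)"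
    by (rule sum.cong) (use len in \<open>auto simp: nontriangular_faces_def triangular_def\<close>)
  moreover have "(\<Sum>F\<in>?N. length (cyc F)) = (\<Sum>i=1..\<kappa>. length (cyc (\<Phi> i)))"
    by (rule sum.reindex_bij_betw[OF assms(2), symmetric])
  moreover have \<gamma>: "length (cyc (\<Phi> i)) = \<gamma> i \<and> 3 \<le> \<gamma> i" if i: "i \<in> {1..\<kappa>}" for i
  proof -
    have "\<Phi> i \<in> faces V E z g" using \<Phi>N N i by blast
    then show ?thesis using assms(3) i len by (fastforce simp: bordered_by_def is_cycle_def)
  qed
  \<comment> \<open>Each edge is counted in two faces; all faces outside \<open>?N\<close> have
    length 3.\<close>
  ultimately have "2 * card E = 3 * card (faces V E z g - ?N) + (\<Sum>i=1..\<kappa>. \<gamma> i)"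
    using sum_face_lengths by simp
  moreover have "card (faces V E z g) = card (faces V E z g - ?N) + \<kappa>"
    using card_Diff_subset[OF G(4) N] card_mono[OF finite_faces N] G(5) by simp
  moreover have "card V + card (faces V E z g) = card E + 2" by (rule Euler_formula[OF V])
  ultimately have edges: "3 * card V + 3 * \<kappa> = card E + 6 + (\<Sum>i=1..\<kappa>. \<gamma> i)" by linarith
  \<comment> \<open>With \<open>edges\<close> this shows that the flexes have dimension at least 6,
    so no subtraction of natural numbers truncates.\<close>
  have "(\<Sum>i=1..\<kappa>. 3) \<le> (\<Sum>i=1..\<kappa>. \<gamma> i)" by (rule sum_mono) (use \<gamma> in blast)
  then have \<gamma>3: "3 * \<kappa> \<le> (\<Sum>i=1..\<kappa>. \<gamma> i)" by simp
  have dim: "dim (flexes q V E p) + card E = 3 * card V" if "1 < q" "generic q V p" for q and p :: "real ^ 3 ^ 'v"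
    using dim_flexes[OF that(1) generic_rigidity_rank(1)[OF that] simple] generic_rigidity_rank(2)[OF that] by simp
  have two: "flex_dim 2 V E p + 3 * \<kappa> = (\<Sum>i=1..\<kappa>. \<gamma> i)" if p: "generic 2 V p" for p :: "real ^ 3 ^ 'v"
  proof -
    note r = generic_rigidity_rank[OF _ p, simplified]
    have "dim (trivial_flexes 2 V E p) = 6"
      by (rule dim_trivial_flexes_2[OF r(1) simple V edges_not_parallel[OF r E]])
    then show ?thesis unfolding flex_dim_def using dim[OF _ p] edges \<gamma>3 by simp
  qed
  have other: "flex_dim q V E p + 3 * \<kappa> = (\<Sum>i=1..\<kappa>. \<gamma> i) + 3" if q: "1 < q" "q \<noteq> 2" and p: "generic q V p"
    for q and p :: "real ^ 3 ^ 'v"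
  proof -
    have "dim (trivial_flexes q V E p) = 3"
      using dim_trivial_flexes_const[OF q generic_rigidity_rank(1)[OF q(1) p] simple V] by simp
    then show ?thesis unfolding flex_dim_def using dim[OF q(1) p] edges \<gamma>3 by simp
  qed
  have "int (flex_dim 2 V E p) = (\<Sum>i=1..\<kappa>. int (\<gamma> i)) - 3 * int \<kappa>" if "generic 2 V p" for p :: "real ^ 3 ^ 'v"
    using arg_cong[OF two[OF that], of int] by simp
  moreover have "flex_dim q V E p' = flex_dim 2 V E p + 3"
    if "1 < q" "q \<noteq> 2" "generic 2 V p" "generic q V p'" for q and p p' :: "real ^ 3 ^ 'v"
    using two[OF that(3)] other[OF that(1,2,4)] by linarith
  ultimately show ?thesis by blast
qed

end
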